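(* Let $Y$ be a random compact subset of $\mathbb{R}^2$ such that $D(a_1)\subset Y\subset D(a_2)$ almost surely for some constants $0<a_1<a_2$, and $\nu(\partial Y)=0$ almost surely. Let $\tilde I$ denote a measurable modification of the colored dead leaves model $I(r_0,r_1)$ (with constant uniform colors), considered on $[0,1]^2$. For all $p\in[1,\infty]$, all $q\in[1,\infty]$ and all $s\in(0,1)$ the following hold (with $1/\infty=0$). (a) If $1<\alpha\le3$ and $0<r_0<r_1<\infty$, or if $\alpha>3$ and $0<r_0<r_1\le\infty$, then under (A-2), $$s<\frac1p\ \Longrightarrow\ \tilde I\in B_p^{s,q}([0,1]^2)\ \text{ almost surely}.$$ (b) If $2<\alpha<3$ and $0=r_0<r_1<\infty$, then under (A-3), $$s<\frac{3-\alpha}{p}\ \Longrightarrow\ \tilde I\in B_p^{s,q}([0,1]^2)\ \text{ almost surely}.$$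
   Context: $\nu$ is Lebesgue measure on $\mathbb{R}^2$; $D(a)$ is the disk of radius $a$ centered at the origin; $|\cdot|$ on $\mathbb{R}^2$ is the Euclidean norm; $\mathring A$, $\partial A$ denote interior and topological boundary. A random closed (compact) set is a random element of the space of closed sets of $\mathbb{R}^2$ with the Borel $\sigma$-field of the Fell topology (a.s. compact). Let $\tilde\gamma(\mathbf{y})=E\,\nu(\mathring Y\cap(\mathbf{y}+\mathring Y))$, $\mathbf{y}\in\mathbb{R}^2$. (A-2): for every unit vector $\mathbf{u}$, the function $x\mapsto\tilde\gamma(x\mathbf{u})$ is differentiable to the right at $x=0$, and the (absolute value of the) derivative is bounded away from zero and infinity independently of $\mathbf{u}$. (A-3): for any $\delta>0$, $\tilde\gamma(\mathbf{x})=\tilde\gamma(0)+o(|\mathbf{x}|^{1-\delta})$ as $\mathbf{x}\to0$. Dead leaves model associated with a random closed set $X$: let $\{(x_i,t_i)\}$ be a homogeneous Poisson point process of intensity one on $\mathbb{R}^2\times\mathbb{R}$ and $(X_i)$ i.i.d. copies of $X$, independent of it. Using only points with $t_i\le 0$, the visible parts are $V_i=(x_i+X_i)\setminus\bigcup_{t_j\in(t_i,0)}(x_j+\mathring X_j)$, $t_i\le 0$; $M=\{V_i\}$, $\partial M=\bigcup_i\partial V_i$. For $r_0>0$, $M(r_0,r_1)$ is the dead leaves model associated with $X=RY$, where $R$ is independent of $Y$ with density proportional to $r^{-\alpha}\mathbf{1}(r_0\le r\le r_1)$. For $r_0>0$, $I(r_0,r_1)$ is the random field on $\mathbb{R}^2$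 equal to $U_i$ on $\mathring V_i\setminus\partial M(r_0,r_1)$ for each $i$, and to $0$ on $\partial M(r_0,r_1)$, where $\{V_i\}$ are the visible parts of $M(r_0,r_1)$ and $(U_i)$ are i.i.d. uniform on $(0,1)$, independent of $M(r_0,r_1)$. For $r_0=0$, $I(0,r_1)$ is a random field whose finite-dimensional distributions are the limits of those of $I(r_0,r_1)$ as $r_0\to0$ (these limits exist). In all the cases of the claim there is a measurable modification $\tilde I$: a jointly measurable (in $\omega$ and $\mathbf{x}$) field, on the same probability space, equal at each fixed $\mathbf{x}$ to $I(r_0,r_1)$ almost surely. $B_p^{s,q}([0,1]^2)$, for $s\in(0,1)$, $p,q\in[1,\infty]$, is the space of $f$ with finite norm $|f|_{B_p^{s,q}}=|f|_p+\left(\int_0^\infty(\omega(f,u)_p\,u^{-s})^q\,\frac{du}{u}\right)^{1/q}$ (with the usual supremum over $u>0$ if $q=\infty$), where $|\cdot|_p$ is the $L^p([0,1]^2)$ norm, $\omega(f,u)_p=\sup_{|\mathbf{y}|<u}|\Delta(f,\mathbf{y})|_p$, and $\Delta(f,\mathbf{y})(\mathbf{x})=(f(\mathbf{x}+\mathbf{y})-f(\mathbf{x}))\mathbf{1}(\mathbf{x}\in[0,1]^2,\ \mathbf{x}+\mathbf{y}\in[0,1]^2)$. *)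

theory Defs
  imports "HOL-Probability.Probability" "HOL-Library.Landau_Symbols"
begin

text \<open>The library's \<open>indep_var\<close> requires both random variables to have values in the same type.\<close>

definition independent_rvs ::
    "'w measure \<Rightarrow> 'a measure \<Rightarrow> ('w \<Rightarrow> 'a) \<Rightarrow> 'b measure \<Rightarrow> ('w \<Rightarrow> 'b) \<Rightarrow> bool" where
  "independent_rvs M S X T Y \<longleftrightarrow>
     X \<in> measurable M S \<and> Y \<in> measurable M T \<and>
     prob_space.indep_set M {X -` A \<inter> space M | A. A \<in> sets S} {Y -` B \<inter> space M | B. B \<in> sets T}"

definition fell_topology :: "'a::topological_space set topology" where
  "fell_topology = topology_generated_by
     ({{F. closed F \<and> F \<inter> K = {}} | K. compact K} \<union> {{F. closed F \<and> F \<inter> G \<noteq> {}} | G. open G})"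

definition fell :: "'a::topological_space set measure" where
  "fell = sigma {F. closed F} {U. openin fell_topology U}"

definition random_compact_set ::
    "'w measure \<Rightarrow> ('w \<Rightarrow> 'a::topological_space set) \<Rightarrow> bool" where
  "random_compact_set N Y \<longleftrightarrow> Y \<in> measurable N fell \<and> (AE \<omega> in N. compact (Y \<omega>))"

definition geometric_covariogram ::
    "'w measure \<Rightarrow> ('w \<Rightarrow> (real^2) set) \<Rightarrow> real^2 \<Rightarrow> real" where
  "geometric_covariogram N Y y =
     (\<integral>\<omega>. measure lborel (interior (Y \<omega>) \<inter> (+) y ` interior (Y \<omega>)) \<partial>N)"

definition condition_A2 :: "'w measure \<Rightarrow> ('w \<Rightarrow> (real^2) set) \<Rightarrow> bool" where
  "condition_A2 N Y \<longleftrightarrow> (\<exists>c C. 0 < c \<and> (\<forall>u. norm u = 1 \<longrightarrow>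
     (\<exists>d. ((\<lambda>x. geometric_covariogram N Y (x *\<^sub>R u)) has_real_derivative d) (at_right 0) \<and>
          c \<le> \<bar>d\<bar> \<and> \<bar>d\<bar> \<le> C)))"

definition condition_A3 :: "'w measure \<Rightarrow> ('w \<Rightarrow> (real^2) set) \<Rightarrow> bool" where
  "condition_A3 N Y \<longleftrightarrow> (\<forall>\<delta>>0.
     (\<lambda>x. geometric_covariogram N Y x - geometric_covariogram N Y 0) \<in> o[at 0](\<lambda>x. norm x powr (1 - \<delta>)))"

text \<open>
  The points are enumerated as a random sequence; points are counted with multiplicity, by their
  indices. The counting formula forces every set of finite mass to contain almost surely only
  finitely many points.
\<close>

definition poisson_process ::
    "'w measure \<Rightarrow> 'a::topological_space measure \<Rightarrow> (nat \<Rightarrow> 'w \<Rightarrow> 'a) \<Rightarrow> bool" where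
  "poisson_process M \<mu> Z \<longleftrightarrow>
     (\<forall>i. Z i \<in> measurable M \<mu>) \<and>
     (\<forall>A\<in>sets \<mu>. emeasure \<mu> A < \<infinity> \<longrightarrow> (\<forall>k::nat.
        measure M {\<omega> \<in> space M. finite {i. Z i \<omega> \<in> A} \<and> card {i. Z i \<omega> \<in> A} = k} =
          exp (- measure \<mu> A) * measure \<mu> A ^ k / fact k)) \<and>
     (\<forall>A::nat \<Rightarrow> 'a set. disjoint_family A \<and> (\<forall>k. A k \<in> sets \<mu> \<and> emeasure \<mu> (A k) < \<infinity>) \<longrightarrow>
        prob_space.indep_vars M (\<lambda>_. count_space UNIV) (\<lambda>k \<omega>. card {i. Z i \<omega> \<in> A k}) UNIV)"

text \<open>
  The arguments are the points \<open>z i = (x\<^sub>i, t\<^sub>i)\<close> and the leaves \<open>X i\<close>. Points with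
  \<open>t\<^sub>i > 0\<close> are not used; they get the empty visible part, which has empty interior and frontier.
\<close>

definition visible_part ::
    "(nat \<Rightarrow> (real^2) \<times> real) \<Rightarrow> (nat \<Rightarrow> (real^2) set) \<Rightarrow> nat \<Rightarrow> (real^2) set" where
  "visible_part z X i =
     (if snd (z i) \<le> 0
      then (+) (fst (z i)) ` X i -
           (\<Union>j \<in> {j. snd (z i) < snd (z j) \<and> snd (z j) < 0}. (+) (fst (z j)) ` interior (X j))
      else {})"

definition dead_leaves_boundary ::
    "(nat \<Rightarrow> (real^2) \<times> real) \<Rightarrow> (nat \<Rightarrow> (real^2) set) \<Rightarrow> (real^2) set" where
  "dead_leaves_boundary z X = (\<Union>i. frontier (visible_part z X i))"

text \<open>
  The interiors of visible parts with distinct negative times are disjoint and the visible parts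
  almost surely cover the plane, so the choice of the least index and the value \<open>0\<close> at uncovered
  points only matter on a null event.
\<close>

definition colored_field ::
    "(nat \<Rightarrow> (real^2) \<times> real) \<Rightarrow> (nat \<Rightarrow> (real^2) set) \<Rightarrow> (nat \<Rightarrow> real) \<Rightarrow> real^2 \<Rightarrow> real" where
  "colored_field z X U y =
     (if y \<notin> dead_leaves_boundary z X \<and> (\<exists>i. y \<in> interior (visible_part z X i))
      then U (LEAST i. y \<in> interior (visible_part z X i))
      else 0)"

definition size_law :: "real \<Rightarrow> real \<Rightarrow> ereal \<Rightarrow> real measure" where
  "size_law \<alpha> r\<^sub>0 r\<^sub>1 =
     (let g = (\<lambda>r. ennreal (r powr (- \<alpha>)) * indicator {r. r\<^sub>0 \<le> r \<and> ereal r \<le> r\<^sub>1} r)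
      in density lborel (\<lambda>r. g r / (\<integral>\<^sup>+ u. g u \<partial>lborel)))"

text \<open>The law of \<open>R Y\<close>, where \<open>R\<close> has law \<^term>\<open>size_law \<alpha> r\<^sub>0 r\<^sub>1\<close> and is independent of \<open>Y\<close>.\<close>

definition leaf_law ::
    "'w measure \<Rightarrow> ('w \<Rightarrow> (real^2) set) \<Rightarrow> real \<Rightarrow> real \<Rightarrow> ereal \<Rightarrow> (real^2) set measure" where
  "leaf_law N Y \<alpha> r\<^sub>0 r\<^sub>1 =
     distr (size_law \<alpha> r\<^sub>0 r\<^sub>1 \<Otimes>\<^sub>M distr N fell Y) fell (\<lambda>(r, K). (\<lambda>x. r *\<^sub>R x) ` K)"

definition dead_leaves_model ::
    "'w measure \<Rightarrow> (real^2) set measure \<Rightarrow>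
     (nat \<Rightarrow> 'w \<Rightarrow> (real^2) \<times> real) \<Rightarrow> (nat \<Rightarrow> 'w \<Rightarrow> (real^2) set) \<Rightarrow> bool" where
  "dead_leaves_model M L Z X \<longleftrightarrow>
     prob_space M \<and>
     poisson_process M lborel Z \<and>
     prob_space.indep_vars M (\<lambda>_. fell) X UNIV \<and>
     (\<forall>i. distr M fell (X i) = L) \<and>
     independent_rvs M
       (Pi\<^sub>M UNIV (\<lambda>_. borel)) (\<lambda>\<omega> i. Z i \<omega>)
       (Pi\<^sub>M UNIV (\<lambda>_. fell)) (\<lambda>\<omega> i. X i \<omega>)"

text \<open>
  Independence of the colors from the dead leaves model is independence from the indexed family of
  visible parts; it follows from independence from points and leaves.
\<close>

definition colored_dead_leaves ::
    "'w measure \<Rightarrow> (real^2) set measure \<Rightarrow> ('w \<Rightarrow> real^2 \<Rightarrow> real) \<Rightarrow> bool" where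
  "colored_dead_leaves M L I \<longleftrightarrow> (\<exists>Z X U.
     dead_leaves_model M L Z X \<and>
     prob_space.indep_vars M (\<lambda>_. borel) U UNIV \<and>
     (\<forall>i. distr M lborel (U i) = uniform_measure lborel {0<..<1::real}) \<and>
     independent_rvs M
       (Pi\<^sub>M UNIV (\<lambda>_. fell)) (\<lambda>\<omega> i. visible_part (\<lambda>i. Z i \<omega>) (\<lambda>i. X i \<omega>) i)
       (Pi\<^sub>M UNIV (\<lambda>_. borel)) (\<lambda>\<omega> i. U i \<omega>) \<and>
     (\<forall>\<omega>\<in>space M. \<forall>y. I \<omega> y = colored_field (\<lambda>i. Z i \<omega>) (\<lambda>i. X i \<omega>) (\<lambda>i. U i \<omega>) y))"

definition random_field :: "'w measure \<Rightarrow> ('w \<Rightarrow> 'a \<Rightarrow> real) \<Rightarrow> bool" where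
  "random_field M I \<longleftrightarrow> prob_space M \<and> (\<forall>y. (\<lambda>\<omega>. I \<omega> y) \<in> borel_measurable M)"

definition fdd :: "'w measure \<Rightarrow> ('w \<Rightarrow> 'a \<Rightarrow> real) \<Rightarrow> 'a set \<Rightarrow> ('a \<Rightarrow> real) measure" where
  "fdd M I J = distr M (Pi\<^sub>M J (\<lambda>_. borel)) (\<lambda>\<omega>. restrict (I \<omega>) J)"

definition fdd_converge ::
    "('r \<Rightarrow> 'b measure) \<Rightarrow> ('r \<Rightarrow> 'b \<Rightarrow> 'a \<Rightarrow> real) \<Rightarrow> 'r filter \<Rightarrow>
     'w measure \<Rightarrow> ('w \<Rightarrow> 'a \<Rightarrow> real) \<Rightarrow> bool" where
  "fdd_converge P K F M I \<longleftrightarrow> (\<forall>J \<phi>. finite J \<and>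
     continuous_map (product_topology (\<lambda>_. euclideanreal) J) euclideanreal \<phi> \<and>
     bounded (\<phi> ` (J \<rightarrow>\<^sub>E UNIV)) \<longrightarrow>
     ((\<lambda>r. \<integral>v. \<phi> v \<partial>(fdd (P r) (K r) J)) \<longlongrightarrow> (\<integral>v. \<phi> v \<partial>(fdd M I J))) F)"

definition measurable_modification ::
    "'w measure \<Rightarrow> ('w \<Rightarrow> 'a::topological_space \<Rightarrow> real) \<Rightarrow> ('w \<Rightarrow> 'a \<Rightarrow> real) \<Rightarrow> bool" where
  "measurable_modification M I I' \<longleftrightarrow>
     (\<lambda>(\<omega>, y). I' \<omega> y) \<in> borel_measurable (M \<Otimes>\<^sub>M borel) \<and>
     (\<forall>y. AE \<omega> in M. I' \<omega> y = I \<omega> y)"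

definition unit_square :: "(real^2) set" where
  "unit_square = {x. \<forall>i. 0 \<le> x $ i \<and> x $ i \<le> 1}"

definition ennreal_powr :: "ennreal \<Rightarrow> real \<Rightarrow> ennreal" where
  "ennreal_powr x a = (if x = \<infinity> then \<infinity> else ennreal (enn2real x powr a))"  (* used for a > 0 only *)

definition Lp_norm :: "ereal \<Rightarrow> (real^2 \<Rightarrow> real) \<Rightarrow> ennreal" where
  "Lp_norm p f =
     (if p = \<infinity> then esssup (lebesgue_on unit_square) (\<lambda>x. ennreal \<bar>f x\<bar>)
      else ennreal_powr
        (\<integral>\<^sup>+ x. ennreal (\<bar>f x\<bar> powr real_of_ereal p) \<partial>lebesgue_on unit_square) (1 / real_of_ereal p))"

definition difference :: "(real^2 \<Rightarrow> real) \<Rightarrow> real^2 \<Rightarrow> real^2 \<Rightarrow> real" where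
  "difference f y x = (f (x + y) - f x) * indicator {x. x \<in> unit_square \<and> x + y \<in> unit_square} x"

definition Lp_modulus :: "ereal \<Rightarrow> (real^2 \<Rightarrow> real) \<Rightarrow> real \<Rightarrow> ennreal" where
  "Lp_modulus p f u = (SUP y \<in> {y. norm y < u}. Lp_norm p (difference f y))"

definition besov_norm :: "ereal \<Rightarrow> ereal \<Rightarrow> real \<Rightarrow> (real^2 \<Rightarrow> real) \<Rightarrow> ennreal" where
  "besov_norm p q s f = Lp_norm p f +
     (if q = \<infinity> then (SUP u \<in> {0<..}. Lp_modulus p f u * ennreal (u powr (- s)))
      else ennreal_powr
        (\<integral>\<^sup>+ u \<in> {0<..}. ennreal_powr (Lp_modulus p f u * ennreal (u powr (- s))) (real_of_ereal q)
             * ennreal (1 / u) \<partial>lborel)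
        (1 / real_of_ereal q))"

definition besov_space :: "ereal \<Rightarrow> ereal \<Rightarrow> real \<Rightarrow> (real^2 \<Rightarrow> real) set" where
  "besov_space p q s =
     {f. f \<in> borel_measurable (lebesgue_on unit_square) \<and> besov_norm p q s f < \<infinity>}"

end

theory Submission
  imports Defs "HOL-Real_Asymp.Real_Asymp"
begin

text \<open>
  The field takes equal values at \<open>x\<close> and \<open>y\<close> when the first leaf, going back in time, that touches
  \<open>{x, y}\<close> contains both points in its interior. The probability that this fails is at most a constant
  times the ratio of the mean area of the positions at which a leaf \<open>R Y\<close> touches the pair without
  covering it, which is \<open>2 E(R\<^sup>2 (\<gamma>(0) - \<gamma>((x - y) / R)))\<close> for the covariogram \<open>\<gamma>\<close> of \<open>Y\<close>, to the rate
  at which leaves cover \<open>x\<close>. Under (A-2) or (A-3) the ratio is \<open>O(\<bar>x - y\<bar>\<^sup>\<theta>)\<close>, for \<open>\<theta> = 1\<close> or any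
  \<open>\<theta> < 3 - \<alpha>\<close>, and in the second case uniformly in \<open>r\<^sub>0\<close>, so the bound passes to the limit.

  As the colors are bounded, all \<open>p\<close>-th powers of increments are dominated by increments. The mean
  increments over pairs at distance at most \<open>u\<close> are therefore of order \<open>u\<^sup>2\<^sup>+\<^sup>\<theta>\<close>; summing over dyadic
  \<open>u\<close> gives an almost sure bound of order \<open>u\<^sup>2\<^sup>+\<^sup>\<kappa>\<close> for every \<open>\<kappa> < \<theta>\<close>, and averaging over an intermediate
  point turns it into a bound of order \<open>u\<^sup>\<kappa>\<^sup>/\<^sup>p\<close> on the \<open>L\<^sup>p\<close> modulus of continuity. For \<open>p = \<infinity>\<close>
  there is nothing to prove, since \<open>s > 0\<close>.
\<close>

section \<open>Measurability in the Fell space\<close>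

text \<open>The points are enumerated in no particular order, so the first leaf at a pair of points
  is not the leaf of any fixed index. Every probability is instead bounded by a sum over all indices
  \<open>i\<close> of the probabilities that leaf \<open>i\<close> has some property while a region
  of later times holds no leaf of some kind. Campbell's formula evaluates such sums, the void
  contributing an exponential factor. It wants a deterministic void, whereas the times between a
  leaf and 0 form a random interval. Slots of fixed length make the region deterministic; what they
  lose is a constant, the 2 that bounds the sum of \<open>exp (- k)\<close>.

  Measurability shapes the rest: neither the map that scales a leaf nor the fields that approximate
  the case \<open>r\<^sub>0 = 0\<close> are known to be measurable. The estimates are therefore
  one-sided, by measurable sets that contain the sets of interest, and closeness of two values of
  the field is expressed by an exceptional event \<open>E\<close> outside which they agree.\<close>

lemma space_fell [simp]: "space fell = {F. closed F}"
  unfolding fell_def by (rule space_measure_of_conv)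

lemma openin_fell_closed: "openin fell_topology U \<Longrightarrow> U \<subseteq> {F. closed F}"
proof -
  have "topspace (fell_topology :: 'a set topology) \<subseteq> {F. closed F}"
    unfolding fell_topology_def by (auto simp: topology_generated_by_topspace)
  then show "openin fell_topology U \<Longrightarrow> U \<subseteq> {F. closed F}"
    using openin_subset by blast
qed

lemma sets_fell: "sets fell = sigma_sets {F. closed F} {U. openin fell_topology U}"
  unfolding fell_def using openin_fell_closed by (intro sets_measure_of) auto

lemma hit_in_sets_fell: "open G \<Longrightarrow> {F. closed F \<and> F \<inter> G \<noteq> {}} \<in> sets fell"
  unfolding sets_fell fell_topology_def
  by (rule sigma_sets.Basic) (auto intro!: topology_generated_by_Basis)

lemma pred_hit_fell: "open G \<Longrightarrow> Measurable.pred fell (\<lambda>F. F \<inter> G \<noteq> {})"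
  using hit_in_sets_fell by (simp add: pred_def)

text \<open>The centre varies together with the set, so hit events of fixed balls do not suffice
  directly. An open ball is met exactly when some ball inside it, with centre in a countable dense
  set and rational radius, is met; the condition \<open>dist c d + r \<le> \<rho>\<close> guarantees
  the inclusion and is measurable in \<open>c\<close>.\<close>

lemma pred_hit_ball:
  "Measurable.pred (borel \<Otimes>\<^sub>M fell) (\<lambda>(c::'a::euclidean_space, F). F \<inter> ball c \<rho> \<noteq> {})"
proof -
  obtain D :: "'a set" where D: "countable D" "\<And>X. open X \<Longrightarrow> X \<noteq> {} \<Longrightarrow> \<exists>d\<in>D. d \<in> X"
    using countable_dense_setE by blast
  have eq: "F \<inter> ball c \<rho> \<noteq> {} \<longleftrightarrow>
      (\<exists>d\<in>D. \<exists>r\<in>\<rat>. F \<inter> ball d r \<noteq> {} \<and> dist c d + r \<le> \<rho>)" for c F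
  proof
    assume "F \<inter> ball c \<rho> \<noteq> {}"
    then obtain w where w: "w \<in> F" "dist c w < \<rho>" by (auto simp: mem_ball)
    \<comment> \<open>Half the margin, because \<open>r\<close> is spent twice: on moving the centre
      from \<open>w\<close> to \<open>d\<close> and on the radius around \<open>d\<close>.\<close>
    define e where "e = (\<rho> - dist c w) / 2"
    have "e > 0" using w by (simp add: e_def)
    then obtain r where r: "r \<in> \<rat>" "0 < r" "r < e"
      using Rats_dense_in_real[of 0 e] by auto
    obtain d where d: "d \<in> D" "dist w d < r" using D(2)[of "ball w r"] r by auto
    have "dist c d + r \<le> dist c w + dist w d + r" using dist_triangle[of c d w] by simp
    also have "\<dots> \<le> \<rho>" using d r by (simp add: e_def)
    finally show "\<exists>d\<in>D. \<exists>r\<in>\<rat>. F \<inter> ball d r \<noteq> {} \<and> dist c d + r \<le> \<rho>"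
      using d r w by (intro bexI[of _ d] bexI[of _ r]) (auto simp: dist_commute)
  next
    assume "\<exists>d\<in>D. \<exists>r\<in>\<rat>. F \<inter> ball d r \<noteq> {} \<and> dist c d + r \<le> \<rho>"
    then obtain d r w where "dist c d + r \<le> \<rho>" "w \<in> F" "dist d w < r" by auto
    moreover have "dist c w \<le> dist c d + dist d w" by (rule dist_triangle)
    ultimately show "F \<inter> ball c \<rho> \<noteq> {}" by (auto simp: disjoint_iff)
  qed
  note pred_hit_fell [measurable]
  have [measurable]: "countable D" "countable (\<rat> :: real set)"
    using D(1) countable_rat by auto
  show ?thesis
    unfolding eq split_beta by measurable
qed

text \<open>Closedness turns membership into a countable intersection: a point lies in a closed set
  iff all balls of radius \<open>1 / Suc n\<close> around it meet the set.\<close>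

lemma pred_mem_fell:
  assumes [measurable]: "f \<in> measurable M (borel :: 'a::euclidean_space measure)" "g \<in> measurable M fell"
  shows "Measurable.pred M (\<lambda>x. f x \<in> g x)"
proof -
  have eq: "f x \<in> g x \<longleftrightarrow> (\<forall>n::nat. case (f x, g x) of (c, F) \<Rightarrow> F \<inter> ball c (1 / Suc n) \<noteq> {})"
    if x: "x \<in> space M" for x
  proof -
    have cl: "closed (g x)" using measurable_space[OF assms(2) x] by simp
    have "f x \<in> closure (g x)" if *: "\<And>n::nat. g x \<inter> ball (f x) (1 / Suc n) \<noteq> {}"
      unfolding closure_approachable
    proof (intro allI impI)
      fix e :: real assume "e > 0"
      then obtain n where "inverse (real (Suc n)) < e" using reals_Archimedean by blast
      then show "\<exists>y\<in>g x. dist y (f x) < e"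
        using *[of n] by (fastforce simp: dist_commute inverse_eq_divide)
    qed
    then show ?thesis using cl by (fastforce simp: disjoint_iff)
  qed
  note pred_hit_ball[measurable]
  have [measurable]: "Measurable.pred M (\<lambda>x. case (f x, g x) of (c, F) \<Rightarrow> F \<inter> ball c (1 / Suc n) \<noteq> {})" for n
    using measurable_compose[OF _ pred_hit_ball, of "\<lambda>x. (f x, g x)" M] by measurable
  show ?thesis by (subst measurable_cong[OF eq]) measurable
qed

text \<open>Countably many membership tests suffice: a closed set that contains all dense points of
  an open ball contains the ball, since the part of the ball outside the set is open and, if
  nonempty, would contain a dense point.\<close>

lemma pred_mem_interior_fell:
  assumes [measurable]: "f \<in> measurable M (borel :: 'a::euclidean_space measure)" "g \<in> measurable M fell"
  shows "Measurable.pred M (\<lambda>x. f x \<in> interior (g x))"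
proof -
  obtain D :: "'a set" where D: "countable D" "\<And>X. open X \<Longrightarrow> X \<noteq> {} \<Longrightarrow> \<exists>d\<in>D. d \<in> X"
    using countable_dense_setE by blast
  have eq: "f x \<in> interior (g x) \<longleftrightarrow> (\<exists>n::nat. \<forall>d\<in>D. dist d (f x) < 1 / Suc n \<longrightarrow> d \<in> g x)"
    if x: "x \<in> space M" for x
  proof
    assume "f x \<in> interior (g x)"
    then obtain e where e: "e > 0" "ball (f x) e \<subseteq> g x" by (meson mem_interior)
    then obtain n where "inverse (real (Suc n)) < e" using reals_Archimedean by blast
    then show "\<exists>n::nat. \<forall>d\<in>D. dist d (f x) < 1 / Suc n \<longrightarrow> d \<in> g x"
      using e by (intro exI[of _ n]) (auto simp: dist_commute inverse_eq_divide)
  next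
    have cl: "closed (g x)" using measurable_space[OF assms(2) x] by simp
    assume "\<exists>n::nat. \<forall>d\<in>D. dist d (f x) < 1 / Suc n \<longrightarrow> d \<in> g x"
    then obtain n :: nat where n: "\<And>d. d \<in> D \<Longrightarrow> dist d (f x) < 1 / Suc n \<Longrightarrow> d \<in> g x" by blast
    have "ball (f x) (1 / Suc n) \<subseteq> g x"
    proof (rule ccontr)
      assume "\<not> ?thesis"
      then have "ball (f x) (1 / Suc n) - g x \<noteq> {}" by auto
      then obtain d where "d \<in> D" "d \<in> ball (f x) (1 / Suc n) - g x"
        using D(2)[of "ball (f x) (1 / Suc n) - g x"] cl by (auto intro: open_Diff)
      then show False using n[of d] by (auto simp: dist_commute)
    qed
    then show "f x \<in> interior (g x)" unfolding mem_interior by (intro exI[of _ "1 / Suc n"]) auto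
  qed
  note pred_mem_fell [measurable (raw)]
  have [measurable]: "countable D" by fact
  show ?thesis by (subst measurable_cong[OF eq]) measurable
qed

lemma ball_subset_in_sets_fell: "{F. closed F \<and> ball (c::'a::euclidean_space) \<rho> \<subseteq> F} \<in> sets fell"
proof -
  obtain D :: "'a set" where D: "countable D" "\<And>X. open X \<Longrightarrow> X \<noteq> {} \<Longrightarrow> \<exists>d\<in>D. d \<in> X"
    using countable_dense_setE by blast
  have eq: "ball c \<rho> \<subseteq> F \<longleftrightarrow> (\<forall>d\<in>D. d \<in> ball c \<rho> \<longrightarrow> d \<in> F)" if cl: "closed F" for F
  proof (intro iffI subsetI, goal_cases)
    case (2 x)
    show ?case
    proof (rule ccontr)
      assume "x \<notin> F"
      then have "ball c \<rho> - F \<noteq> {}" using 2 by auto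
      then obtain d where "d \<in> D" "d \<in> ball c \<rho> - F"
        using D(2)[of "ball c \<rho> - F"] open_Diff[OF open_ball cl] by blast
      then show False using 2 by auto
    qed
  qed auto
  note pred_mem_fell [measurable (raw)]
  have [measurable]: "countable D" by fact
  have "Measurable.pred fell (\<lambda>F::'a set. \<forall>d\<in>D. d \<in> ball c \<rho> \<longrightarrow> d \<in> F)" by measurable
  then have "{F \<in> space fell. \<forall>d\<in>D. d \<in> ball c \<rho> \<longrightarrow> d \<in> F} \<in> sets fell"
    unfolding pred_def .
  also have "{F \<in> space fell. \<forall>d\<in>D. d \<in> ball c \<rho> \<longrightarrow> d \<in> F} = {F. closed F \<and> ball c \<rho> \<subseteq> F}"
    using eq by auto
  finally show ?thesis .
qed

lemma subset_in_sets_fell: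
  assumes "closed C" shows "{F. closed F \<and> F \<subseteq> C} \<in> sets fell"
proof -
  have "{F. closed F \<and> F \<subseteq> C} = space fell - {F. closed F \<and> F \<inter> (- C) \<noteq> {}}" by auto
  also have "\<dots> \<in> sets fell" using assms by (intro sets.compl_sets hit_in_sets_fell) auto
  finally show ?thesis .
qed

section \<open>Marked Poisson processes\<close>

text \<open>There are only countably many finite sets of indices, so the event is a countable union
  over the possible values of the index set. Finiteness is part of the event because
  \<open>card\<close> is 0 on infinite sets.\<close>

lemma pred_finite_card:
  fixes P :: "nat \<Rightarrow> 'a \<Rightarrow> bool"
  assumes [measurable]: "\<And>i. Measurable.pred M (P i)"
  shows "Measurable.pred M (\<lambda>\<omega>. finite {i. P i \<omega>} \<and> card {i. P i \<omega>} = k)"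
proof -
  have eq: "(finite {i. P i \<omega>} \<and> card {i. P i \<omega>} = k) \<longleftrightarrow>
     (\<exists>S\<in>{S::nat set. finite S}. card S = k \<and> (\<forall>i. P i \<omega> \<longleftrightarrow> i \<in> S))" for \<omega>
  proof
    assume "\<exists>S\<in>{S::nat set. finite S}. card S = k \<and> (\<forall>i. P i \<omega> \<longleftrightarrow> i \<in> S)"
    then obtain S where "finite S" "card S = k" "{i. P i \<omega>} = S" by auto
    then show "finite {i. P i \<omega>} \<and> card {i. P i \<omega>} = k" by auto
  next
    assume "finite {i. P i \<omega>} \<and> card {i. P i \<omega>} = k"
    then show "\<exists>S\<in>{S::nat set. finite S}. card S = k \<and> (\<forall>i. P i \<omega> \<longleftrightarrow> i \<in> S)"
      by (intro bexI[of _ "{i. P i \<omega>}"]) auto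
  qed
  have [measurable]: "countable {S::nat set. finite S}" by (rule countable_Collect_finite)
  show ?thesis unfolding eq by measurable
qed

context prob_space
begin

context
  fixes \<mu> :: "'b::topological_space measure" and Z :: "nat \<Rightarrow> 'a \<Rightarrow> 'b"
  assumes poisson: "poisson_process M \<mu> Z"
begin

lemma poisson_measurable: "Z i \<in> measurable M \<mu>"
  using poisson by (auto simp: poisson_process_def)

lemma poisson_prob:
  assumes "A \<in> sets \<mu>" "emeasure \<mu> A < \<infinity>"
  shows "prob {\<omega> \<in> space M. finite {i. Z i \<omega> \<in> A} \<and> card {i. Z i \<omega> \<in> A} = k} =
    exp (- measure \<mu> A) * measure \<mu> A ^ k / fact k"
  using poisson assms unfolding poisson_process_def by blast

text \<open>The counting formula speaks of finite counts; as the Poisson weights sum to 1, no mass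
  remains for infinite ones.\<close>

lemma poisson_finite:
  assumes A [measurable]: "A \<in> sets \<mu>" and "emeasure \<mu> A < \<infinity>"
  shows "AE \<omega> in M. finite {i. Z i \<omega> \<in> A}"
proof -
  note poisson_measurable [measurable]
  let ?m = "measure \<mu> A"
  let ?E = "\<lambda>k. {\<omega> \<in> space M. finite {i. Z i \<omega> \<in> A} \<and> card {i. Z i \<omega> \<in> A} = k}"
  have [measurable]: "?E k \<in> events" for k
    using pred_finite_card[of "\<lambda>i \<omega>. Z i \<omega> \<in> A" M k] by (simp add: pred_def)
  have "(\<lambda>k. exp (- ?m) * (?m ^ k /\<^sub>R fact k)) sums (exp (- ?m) * exp ?m)"
    by (intro sums_mult exp_converges)
  then have "(\<lambda>k. prob (?E k)) sums 1"
    unfolding poisson_prob[OF assms] by (simp add: exp_minus field_simps)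
  moreover have "(\<lambda>k. prob (?E k)) sums prob (\<Union>k. ?E k)"
    by (intro finite_measure_UNION) (auto simp: disjoint_family_on_def)
  ultimately have "prob (\<Union>k. ?E k) = 1" by (rule sums_unique2[symmetric])
  then have "AE \<omega> in M. \<omega> \<in> (\<Union>k. ?E k)" by (intro AE_prob_1) auto
  then show ?thesis by eventually_elim auto
qed

lemma nn_integral_poisson_count:
  fixes f :: "nat \<Rightarrow> ennreal"
  assumes A [measurable]: "A \<in> sets \<mu>" and fin: "emeasure \<mu> A < \<infinity>"
  shows "(\<integral>\<^sup>+\<omega>. f (card {i. Z i \<omega> \<in> A}) \<partial>M) =
    (\<Sum>k. f k * ennreal (exp (- measure \<mu> A) * measure \<mu> A ^ k / fact k))"
proof -
  note poisson_measurable [measurable]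
  let ?E = "\<lambda>k. {\<omega> \<in> space M. finite {i. Z i \<omega> \<in> A} \<and> card {i. Z i \<omega> \<in> A} = k}"
  have [measurable]: "?E k \<in> events" for k
    using pred_finite_card[of "\<lambda>i \<omega>. Z i \<omega> \<in> A" M k] by (simp add: pred_def)
  have "(\<integral>\<^sup>+\<omega>. f (card {i. Z i \<omega> \<in> A}) \<partial>M) = (\<integral>\<^sup>+\<omega>. (\<Sum>k. f k * indicator (?E k) \<omega>) \<partial>M)"
    using poisson_finite[OF A fin] AE_space
  proof (intro nn_integral_cong_AE, eventually_elim)
    fix \<omega> assume "finite {i. Z i \<omega> \<in> A}" "\<omega> \<in> space M"
    then have "(\<lambda>k. f k * indicator (?E k) \<omega>) = (\<lambda>k. if k = card {i. Z i \<omega> \<in> A} then f k else 0)"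
      by (auto simp: indicator_def fun_eq_iff)
    then show "f (card {i. Z i \<omega> \<in> A}) = (\<Sum>k. f k * indicator (?E k) \<omega>)"
      using sums_If_finite_set[of "{card {i. Z i \<omega> \<in> A}}" f]
      by (simp add: sums_iff)
  qed
  also have "\<dots> = (\<Sum>k. f k * emeasure M (?E k))"
    by (subst nn_integral_suminf) (auto simp: nn_integral_cmult)
  also have "\<dots> = (\<Sum>k. f k * ennreal (exp (- measure \<mu> A) * measure \<mu> A ^ k / fact k))"
    unfolding emeasure_eq_measure poisson_prob[OF A fin] by simp
  finally show ?thesis .
qed

text \<open>The probability generating function of a Poisson count. With \<open>s\<close> the
  probability that a mark avoids a given set, it becomes the probability that the marks of all
  points in \<open>A\<close> avoid it.\<close>

lemma nn_integral_poisson_power: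
  assumes A: "A \<in> sets \<mu>" and fin: "emeasure \<mu> A < \<infinity>" and s: "0 \<le> s"
  shows "(\<integral>\<^sup>+\<omega>. ennreal s ^ card {i. Z i \<omega> \<in> A} \<partial>M) = ennreal (exp (- ((1 - s) * measure \<mu> A)))"
proof -
  let ?m = "measure \<mu> A"
  have "(\<integral>\<^sup>+\<omega>. ennreal s ^ card {i. Z i \<omega> \<in> A} \<partial>M) =
    (\<Sum>k. ennreal (s ^ k * (exp (- ?m) * ?m ^ k / fact k)))"
    unfolding nn_integral_poisson_count[OF A fin] using s
    by (simp add: ennreal_mult ennreal_power del: times_divide_eq_right)
  also have "\<dots> = ennreal (exp (- ((1 - s) * ?m)))"
  proof (rule suminf_ennreal_eq)
    have "(\<lambda>k. exp (- ?m) * ((s * ?m) ^ k /\<^sub>R fact k)) sums (exp (- ?m) * exp (s * ?m))"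
      by (intro sums_mult exp_converges)
    then show "(\<lambda>k. s ^ k * (exp (- ?m) * ?m ^ k / fact k)) sums exp (- ((1 - s) * ?m))"
      by (simp add: power_mult_distrib field_simps exp_diff exp_minus)
  qed (use s in auto)
  finally show ?thesis .
qed

lemma nn_integral_poisson_count_of_nat:
  assumes A: "A \<in> sets \<mu>" and fin: "emeasure \<mu> A < \<infinity>"
  shows "(\<integral>\<^sup>+\<omega>. of_nat (card {i. Z i \<omega> \<in> A}) \<partial>M) = emeasure \<mu> A"
proof -
  let ?m = "measure \<mu> A"
  have "(\<integral>\<^sup>+\<omega>. of_nat (card {i. Z i \<omega> \<in> A}) \<partial>M) =
    (\<Sum>k. ennreal (real k * (exp (- ?m) * ?m ^ k / fact k)))"
    unfolding nn_integral_poisson_count[OF A fin] 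
    by (simp add: ennreal_mult ennreal_of_nat_eq_real_of_nat del: times_divide_eq_right)
  also have "\<dots> = ennreal ?m"
  proof (rule suminf_ennreal_eq)
    have "(\<lambda>k. (exp (- ?m) * ?m) * (?m ^ k /\<^sub>R fact k)) sums ((exp (- ?m) * ?m) * exp ?m)"
      by (intro sums_mult exp_converges)
    moreover have "(exp (- ?m) * ?m) * (?m ^ k /\<^sub>R fact k) =
        real (Suc k) * (exp (- ?m) * ?m ^ Suc k / fact (Suc k))" for k
      by (simp add: divide_simps)
    moreover have "exp (- ?m) * ?m * exp ?m = ?m" by (simp add: exp_minus)
    ultimately have "(\<lambda>k. real (Suc k) * (exp (- ?m) * ?m ^ Suc k / fact (Suc k))) sums ?m"
      by simp
    then show "(\<lambda>k. real k * (exp (- ?m) * ?m ^ k / fact k)) sums ?m"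
      using sums_Suc[of "\<lambda>k. real k * (exp (- ?m) * ?m ^ k / fact k)"] by simp
  qed auto
  also have "\<dots> = emeasure \<mu> A" using fin by (simp add: emeasure_eq_ennreal_measure)
  finally show ?thesis .
qed

text \<open>The Poisson probability \<open>1 - exp (- m) * (1 + m)\<close> of at least two points is
  at most \<open>1 - (1 - m) * (1 + m)\<close>. The quadratic order is what excludes coinciding
  times.\<close>

lemma poisson_prob_two_points_le:
  assumes A [measurable]: "A \<in> sets \<mu>" and fin: "emeasure \<mu> A < \<infinity>"
  shows "prob {\<omega> \<in> space M. \<exists>i j. i \<noteq> j \<and> Z i \<omega> \<in> A \<and> Z j \<omega> \<in> A} \<le> (measure \<mu> A)\<^sup>2"
proof -
  note poisson_measurable [measurable]
  let ?m = "measure \<mu> A"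
  let ?E = "\<lambda>k. {\<omega> \<in> space M. finite {i. Z i \<omega> \<in> A} \<and> card {i. Z i \<omega> \<in> A} = k}"
  let ?B = "{\<omega> \<in> space M. \<exists>i j. i \<noteq> j \<and> Z i \<omega> \<in> A \<and> Z j \<omega> \<in> A}"
  have [measurable]: "?E k \<in> events" for k
    using pred_finite_card[of "\<lambda>i \<omega>. Z i \<omega> \<in> A" M k] by (simp add: pred_def)
  have [measurable]: "?B \<in> events" by measurable
  have "\<omega> \<notin> ?E 0 \<union> ?E 1" if "\<omega> \<in> ?B" for \<omega>
  proof -
    obtain i j where ij: "i \<noteq> j" "{i, j} \<subseteq> {i. Z i \<omega> \<in> A}" using \<open>\<omega> \<in> ?B\<close> by auto
    then show ?thesis using card_mono[OF _ ij(2)] by auto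
  qed
  then have disj: "?B \<inter> (?E 0 \<union> ?E 1) = {}" by blast
  have "prob ?B + prob (?E 0 \<union> ?E 1) = prob (?B \<union> (?E 0 \<union> ?E 1))"
    using disj by (intro finite_measure_Union[symmetric]) auto
  also have "\<dots> \<le> 1" by (rule prob_le_1)
  also have "prob (?E 0 \<union> ?E 1) = prob (?E 0) + prob (?E 1)"
    by (intro finite_measure_Union) auto
  also have "\<dots> = exp (- ?m) * (1 + ?m)"
    unfolding poisson_prob[OF A fin] by (simp add: algebra_simps)
  finally have "prob ?B \<le> 1 - exp (- ?m) * (1 + ?m)" by simp
  also have "exp (- ?m) * (1 + ?m) \<ge> (1 - ?m) * (1 + ?m)"
    using exp_ge_add_one_self[of "- ?m"] by (intro mult_right_mono) auto
  then have "1 - exp (- ?m) * (1 + ?m) \<le> ?m\<^sup>2" by (simp add: power2_eq_square algebra_simps)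
  finally show ?thesis .
qed

lemma nn_integral_poisson_power_times_count:
  assumes C: "C \<in> sets \<mu>" "emeasure \<mu> C < \<infinity>" and D: "D \<in> sets \<mu>" "emeasure \<mu> D < \<infinity>"
    and CD: "C \<inter> D = {}" and s: "0 \<le> s"
  shows "(\<integral>\<^sup>+\<omega>. ennreal s ^ card {i. Z i \<omega> \<in> C} * of_nat (card {i. Z i \<omega> \<in> D}) \<partial>M) =
    ennreal (exp (- ((1 - s) * measure \<mu> C))) * emeasure \<mu> D"
proof -
  \<comment> \<open>Independence of counts is stated for infinite disjoint families, so the pair
    \<open>C\<close>, \<open>D\<close> is padded with empty sets.\<close>
  define A where "A k = (if k = 0 then C else if k = 1 then D else {})" for k :: nat
  let ?N = "\<lambda>k \<omega>. card {i. Z i \<omega> \<in> A k}"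
  define f where "f k n = (if k = 0 then ennreal s ^ n else of_nat n)" for k n :: nat
  have "disjoint_family A"
    using CD by (auto simp: disjoint_family_on_def A_def)
  moreover have "\<forall>k. A k \<in> sets \<mu> \<and> emeasure \<mu> (A k) < \<infinity>"
    using C D by (simp add: A_def)
  ultimately have "indep_vars (\<lambda>_. count_space UNIV) ?N UNIV"
    using poisson unfolding poisson_process_def by blast
  then have "indep_vars (\<lambda>_. borel) (\<lambda>k \<omega>. f k (?N k \<omega>)) UNIV"
    by (rule indep_vars_compose2) simp
  then have "indep_vars (\<lambda>_. borel) (\<lambda>k \<omega>. f k (?N k \<omega>)) {0, 1}"
    by (rule indep_vars_subset) simp
  from indep_vars_nn_integral[OF _ this]
  have "(\<integral>\<^sup>+\<omega>. (\<Prod>k\<in>{0,1}. f k (?N k \<omega>)) \<partial>M) = (\<Prod>k\<in>{0,1}. \<integral>\<^sup>+\<omega>. f k (?N k \<omega>) \<partial>M)" by simp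
  then show ?thesis
    using nn_integral_poisson_power[OF C s] nn_integral_poisson_count_of_nat[OF D]
    by (simp add: f_def A_def)
qed

text \<open>Campbell's formula with a discount \<open>s\<close> for each point of \<open>C\<close>.
  The left side integrates \<open>g\<close> against the image of the discounted measure on pairs of
  index and outcome, the right side against a multiple of \<open>\<mu>\<close>. Off
  \<open>C\<close>, where \<open>g\<close> lives, the two measures agree on sets of finite mass by
  the independence of disjoint counts, hence everywhere by \<sigma>-finiteness of
  \<open>\<mu>\<close>.\<close>

lemma nn_integral_poisson_campbell:
  assumes \<mu>: "sigma_finite_measure \<mu>"
    and C [measurable]: "C \<in> sets \<mu>" and finC: "emeasure \<mu> C < \<infinity>" and s: "0 \<le> s"
    and g [measurable]: "g \<in> borel_measurable \<mu>" and gC: "\<And>z. z \<in> C \<Longrightarrow> g z = 0"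
  shows "(\<Sum>i. \<integral>\<^sup>+\<omega>. ennreal s ^ card {i. Z i \<omega> \<in> C} * g (Z i \<omega>) \<partial>M) =
    ennreal (exp (- ((1 - s) * measure \<mu> C))) * (\<integral>\<^sup>+z. g z \<partial>\<mu>)"
proof -
  note poisson_measurable [measurable]
  interpret \<mu>: sigma_finite_measure \<mu> by fact
  define c where "c = ennreal (exp (- ((1 - s) * measure \<mu> C)))"
  define W where "W \<omega> = ennreal s ^ card {i. Z i \<omega> \<in> C}" for \<omega>
  \<comment> \<open>Measurability of the count comes with the independence of a disjoint family that
    contains \<open>C\<close>.\<close>
  have "indep_vars (\<lambda>_. count_space UNIV) (\<lambda>k \<omega>. card {i. Z i \<omega> \<in> (\<lambda>k::nat. if k = 0 then C else {}) k}) UNIV"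
    using poisson C finC unfolding poisson_process_def by (auto simp: disjoint_family_on_def)
  from indep_vars_subset[OF this, of "{0}"]
  have [measurable]: "(\<lambda>\<omega>. card {i. Z i \<omega> \<in> C}) \<in> measurable M (count_space UNIV)"
    unfolding indep_vars_def by simp
  have [measurable]: "W \<in> borel_measurable M"
    unfolding W_def by measurable
  define \<nu> where "\<nu> = distr (count_space UNIV \<Otimes>\<^sub>M density M W) \<mu> (\<lambda>(i, \<omega>). Z i \<omega>)"
  have Z': "(\<lambda>(i, \<omega>). Z i \<omega>) \<in> measurable (count_space UNIV \<Otimes>\<^sub>M density M W) \<mu>"
    by (rule measurable_pair_measure_countable1) auto
  have fin_d: "sigma_finite_measure (density M W)"
  proof -
    have "W \<omega> \<noteq> \<infinity>" for \<omega> unfolding W_def using s by (simp add: ennreal_power)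
    then show ?thesis by (subst sigma_finite_iff_density_finite) auto
  qed
  have int_\<nu>: "(\<integral>\<^sup>+z. u z \<partial>\<nu>) = (\<Sum>i. \<integral>\<^sup>+\<omega>. W \<omega> * u (Z i \<omega>) \<partial>M)"
    if [measurable]: "u \<in> borel_measurable \<mu>" for u
  proof -
    have "(\<integral>\<^sup>+z. u z \<partial>\<nu>) = (\<integral>\<^sup>+x. u (case x of (i, \<omega>) \<Rightarrow> Z i \<omega>) \<partial>(count_space UNIV \<Otimes>\<^sub>M density M W))"
      unfolding \<nu>_def by (rule nn_integral_distr[OF Z']) simp
    also have "\<dots> = (\<integral>\<^sup>+i. \<integral>\<^sup>+\<omega>. u (Z i \<omega>) \<partial>density M W \<partial>count_space UNIV)"
      using measurable_compose[OF Z' that]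
      by (subst sigma_finite_measure.nn_integral_fst[OF fin_d, symmetric]) (auto simp: comp_def split_beta)
    also have "\<dots> = (\<Sum>i. \<integral>\<^sup>+\<omega>. u (Z i \<omega>) \<partial>density M W)" by (rule nn_integral_count_space_nat)
    also have "\<dots> = (\<Sum>i. \<integral>\<^sup>+\<omega>. W \<omega> * u (Z i \<omega>) \<partial>M)" by (simp add: nn_integral_density)
    finally show ?thesis .
  qed
  have finite_case: "(\<Sum>i. \<integral>\<^sup>+\<omega>. W \<omega> * indicator D (Z i \<omega>) \<partial>M) = c * emeasure \<mu> D"
    if D [measurable]: "D \<in> sets \<mu>" and finD: "emeasure \<mu> D < \<infinity>" and CD: "C \<inter> D = {}" for D
  proof -
    have "(\<Sum>i. \<integral>\<^sup>+\<omega>. W \<omega> * indicator D (Z i \<omega>) \<partial>M) = (\<integral>\<^sup>+\<omega>. (\<Sum>i. W \<omega> * indicator D (Z i \<omega>)) \<partial>M)"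
      by (subst nn_integral_suminf) auto
    also have "\<dots> = (\<integral>\<^sup>+\<omega>. W \<omega> * of_nat (card {i. Z i \<omega> \<in> D}) \<partial>M)"
      using poisson_finite[OF D finD]
    proof (intro nn_integral_cong_AE, eventually_elim)
      fix \<omega> assume *: "finite {i. Z i \<omega> \<in> D}"
      have "(\<Sum>i. W \<omega> * indicator D (Z i \<omega>)) = (\<Sum>i\<in>{i. Z i \<omega> \<in> D}. W \<omega> * indicator D (Z i \<omega>))"
        using * by (intro suminf_finite) auto
      also have "\<dots> = W \<omega> * of_nat (card {i. Z i \<omega> \<in> D})" by (simp add: mult.commute)
      finally show "(\<Sum>i. W \<omega> * indicator D (Z i \<omega>)) = W \<omega> * of_nat (card {i. Z i \<omega> \<in> D})" .
    qed
    also have "\<dots> = c * emeasure \<mu> D"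
      unfolding W_def c_def using nn_integral_poisson_power_times_count[OF C finC D finD CD s] .
    finally show ?thesis .
  qed
  have "density \<nu> (indicator (- C)) = density \<mu> (\<lambda>z. c * indicator (- C) z)"
  proof (rule measure_eqI)
    have sp: "space \<nu> = space \<mu>" "sets \<nu> = sets \<mu>" unfolding \<nu>_def by simp_all
    show "sets (density \<nu> (indicator (- C))) = sets (density \<mu> (\<lambda>z. c * indicator (- C) z))"
      by (simp add: sp)
    fix A assume "A \<in> sets (density \<nu> (indicator (- C)))"
    then have A [measurable]: "A \<in> sets \<mu>" by (simp add: sp)
    have ind [measurable]: "indicator (- C) \<in> borel_measurable \<mu>"
      by (subst measurable_cong[of _ _ "indicator (space \<mu> - C)"]) (auto simp: indicator_def)
    have ind' [measurable]: "indicator (- C) \<in> borel_measurable \<nu>"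
      using ind measurable_cong_sets[OF sp(2) refl] by blast
    obtain R :: "nat \<Rightarrow> 'b set" where R: "range R \<subseteq> sets \<mu>" "(\<Union>i. R i) = space \<mu>"
      "\<And>i. emeasure \<mu> (R i) \<noteq> \<infinity>" "incseq R"
      using \<mu>.sigma_finite_incseq by metis
    have A_eq: "A = (\<Union>n. A \<inter> R n)" using R(2) sets.sets_into_space[OF A] by blast
    have incA: "incseq (\<lambda>n. A \<inter> R n)" using R(4) by (fastforce simp: incseq_def)
    have [measurable]: "R n \<in> sets \<mu>" for n using R(1) by auto
    have "emeasure (density \<nu> (indicator (- C))) (A \<inter> R n) =
      emeasure (density \<mu> (\<lambda>z. c * indicator (- C) z)) (A \<inter> R n)" for n
    proof -
      let ?D = "A \<inter> R n - C"
      have D: "?D \<in> sets \<mu>" by simp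
      have "emeasure \<mu> ?D \<le> emeasure \<mu> (R n)" by (intro emeasure_mono) auto
      then have finD: "emeasure \<mu> ?D < \<infinity>" using R(3)[of n] by (auto simp: less_top top_unique)
      have "emeasure (density \<nu> (indicator (- C))) (A \<inter> R n) =
          (\<integral>\<^sup>+z. indicator (- C) z * indicator (A \<inter> R n) z \<partial>\<nu>)"
        by (rule emeasure_density) (auto simp: sp)
      also have "\<dots> = (\<integral>\<^sup>+z. indicator ?D z \<partial>\<nu>)"
        by (intro nn_integral_cong) (auto simp: indicator_def)
      also have "\<dots> = (\<Sum>i. \<integral>\<^sup>+\<omega>. W \<omega> * indicator ?D (Z i \<omega>) \<partial>M)"
        by (rule int_\<nu>) simp
      also have "\<dots> = c * emeasure \<mu> ?D" using finite_case[OF D finD] by blast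
      also have "\<dots> = (\<integral>\<^sup>+z. c * indicator ?D z \<partial>\<mu>)" by (simp add: nn_integral_cmult)
      also have "\<dots> = (\<integral>\<^sup>+z. c * indicator (- C) z * indicator (A \<inter> R n) z \<partial>\<mu>)"
        by (intro nn_integral_cong) (auto simp: indicator_def)
      also have "\<dots> = emeasure (density \<mu> (\<lambda>z. c * indicator (- C) z)) (A \<inter> R n)"
        by (rule emeasure_density[symmetric]) auto
      finally show ?thesis .
    qed
    then have "(SUP n. emeasure (density \<nu> (indicator (- C))) (A \<inter> R n)) =
      (SUP n. emeasure (density \<mu> (\<lambda>z. c * indicator (- C) z)) (A \<inter> R n))" by simp
    then show "emeasure (density \<nu> (indicator (- C))) A =
      emeasure (density \<mu> (\<lambda>z. c * indicator (- C) z)) A"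
      using incA A_eq by (subst (asm) (1 2) SUP_emeasure_incseq) (auto simp: sp)
  qed
  then have eq: "(\<integral>\<^sup>+z. g z \<partial>density \<nu> (indicator (- C))) = (\<integral>\<^sup>+z. g z \<partial>density \<mu> (\<lambda>z. c * indicator (- C) z))"
    by simp
  have ind [measurable]: "indicator (- C) \<in> borel_measurable \<mu>"
    by (subst measurable_cong[of _ _ "indicator (space \<mu> - C)"]) (auto simp: indicator_def)
  have sets_\<nu> [measurable_cong]: "sets \<nu> = sets \<mu>" by (simp add: \<nu>_def)
  have "(\<integral>\<^sup>+z. g z \<partial>density \<nu> (indicator (- C))) = (\<integral>\<^sup>+z. g z \<partial>\<nu>)"
    using gC by (subst nn_integral_density) (auto intro!: nn_integral_cong simp: indicator_def)
  moreover have "(\<integral>\<^sup>+z. g z \<partial>density \<mu> (\<lambda>z. c * indicator (- C) z)) = (\<integral>\<^sup>+z. c * g z \<partial>\<mu>)"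
    using gC by (subst nn_integral_density) (auto intro!: nn_integral_cong simp: indicator_def)
  ultimately have "(\<integral>\<^sup>+z. g z \<partial>\<nu>) = c * (\<integral>\<^sup>+z. g z \<partial>\<mu>)" using eq by (simp add: nn_integral_cmult)
  then show ?thesis unfolding int_\<nu>[OF g] by (simp add: W_def c_def)
qed

end

end

section \<open>Independence of variables with different value spaces, and independent marks\<close>

lemma independent_rvs_measurable:
  assumes "independent_rvs M S X T Y"
  shows "X \<in> measurable M S" "Y \<in> measurable M T"
  by (rule conjunct1[OF assms[unfolded independent_rvs_def]],
      rule conjunct1[OF conjunct2[OF assms[unfolded independent_rvs_def]]])

lemma (in prob_space) independent_rvs_prob:
  assumes ind: "independent_rvs M S X T Y" and A: "A \<in> sets S" and B: "B \<in> sets T"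
  shows "prob ((X -` A \<inter> space M) \<inter> (Y -` B \<inter> space M)) = prob (X -` A \<inter> space M) * prob (Y -` B \<inter> space M)"
proof -
  let ?XS = "{X -` A \<inter> space M | A. A \<in> sets S}" and ?YT = "{Y -` B \<inter> space M | B. B \<in> sets T}"
  have "indep_set ?XS ?YT" using ind unfolding independent_rvs_def by (elim conjE)
  then have *: "\<forall>a\<in>?XS. \<forall>b\<in>?YT. prob (a \<inter> b) = prob a * prob b"
    unfolding indep_sets2_eq by (elim conjE)
  have "X -` A \<inter> space M \<in> ?XS" "Y -` B \<inter> space M \<in> ?YT" using A B by blast+
  then show ?thesis by (rule bspec[OF bspec[OF *]])
qed

lemma (in prob_space) distr_pair_independent_rvs:
  assumes "independent_rvs M S X T Y"
  shows "distr M (S \<Otimes>\<^sub>M T) (\<lambda>\<omega>. (X \<omega>, Y \<omega>)) = distr M S X \<Otimes>\<^sub>M distr M T Y"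
proof -
  have X [measurable]: "X \<in> measurable M S" and Y [measurable]: "Y \<in> measurable M T"
    by (rule independent_rvs_measurable[OF assms])+
  interpret S: prob_space "distr M S X" by (rule prob_space_distr[OF X])
  interpret T: prob_space "distr M T Y" by (rule prob_space_distr[OF Y])
  show ?thesis
  proof (rule sym, rule pair_measure_eqI)
    show "sigma_finite_measure (distr M S X)" "sigma_finite_measure (distr M T Y)"
      by (rule S.sigma_finite_measure_axioms, rule T.sigma_finite_measure_axioms)
    show "sets (distr M S X \<Otimes>\<^sub>M distr M T Y) = sets (distr M (S \<Otimes>\<^sub>M T) (\<lambda>\<omega>. (X \<omega>, Y \<omega>)))"
      unfolding sets_distr by (intro sets_pair_measure_cong sets_distr)
    fix A B assume "A \<in> sets (distr M S X)" "B \<in> sets (distr M T Y)"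
    then have A [measurable]: "A \<in> sets S" and B [measurable]: "B \<in> sets T" by simp_all
    note independent_rvs_prob[OF assms A B]
    moreover have "(\<lambda>\<omega>. (X \<omega>, Y \<omega>)) -` (A \<times> B) \<inter> space M = (X -` A \<inter> space M) \<inter> (Y -` B \<inter> space M)"
      by auto
    ultimately show "emeasure (distr M S X) A * emeasure (distr M T Y) B =
        emeasure (distr M (S \<Otimes>\<^sub>M T) (\<lambda>\<omega>. (X \<omega>, Y \<omega>))) (A \<times> B)"
      using A B X Y measurable_Pair[OF X Y]
      by (simp add: emeasure_distr emeasure_eq_measure ennreal_mult)
  qed
qed

text \<open>
  Conditionally on the points, the marks are i.i.d., so a void event over \<open>C\<close> thins each
  point of \<open>C\<close> with weight \<open>1 - L G\<close>.
\<close>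

lemma (in prob_space) marked_poisson_campbell:
  fixes \<mu> :: "'b::topological_space measure" and Z :: "nat \<Rightarrow> 'a \<Rightarrow> 'b" and X :: "nat \<Rightarrow> 'a \<Rightarrow> 'c"
  assumes poisson: "poisson_process M \<mu> Z" and sets_\<mu>: "sets \<mu> = sets borel"
    and \<mu>: "sigma_finite_measure \<mu>"
    and iid: "indep_vars (\<lambda>_. T) X UNIV" "\<And>i. distr M T (X i) = L"
    and indep: "independent_rvs M (Pi\<^sub>M UNIV (\<lambda>_. borel)) (\<lambda>\<omega> i. Z i \<omega>) (Pi\<^sub>M UNIV (\<lambda>_. T)) (\<lambda>\<omega> i. X i \<omega>)"
    and S [measurable]: "S \<in> sets (borel \<Otimes>\<^sub>M T)" and G [measurable]: "G \<in> sets T"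
    and C [measurable]: "C \<in> sets borel" and finC: "emeasure \<mu> C < \<infinity>"
    and SC: "S \<inter> C \<times> UNIV = {}"
  shows "(\<Sum>i. emeasure M {\<omega> \<in> space M. (Z i \<omega>, X i \<omega>) \<in> S \<and> (\<forall>j. Z j \<omega> \<in> C \<longrightarrow> X j \<omega> \<notin> G)}) =
    ennreal (exp (- (measure L G * measure \<mu> C))) * (\<integral>\<^sup>+z. emeasure L {F. (z, F) \<in> S} \<partial>\<mu>)"
proof -
  have X [measurable]: "X i \<in> measurable M T" for i using iid(1) by (simp add: indep_vars_def)
  have Z [measurable]: "Z i \<in> measurable M borel" for i
    using poisson_measurable[OF poisson, of i] unfolding measurable_cong_sets[OF refl sets_\<mu>] .
  interpret L: prob_space L using prob_space_distr[OF X, of 0] unfolding iid(2) .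
  have sets_L: "sets L = sets T" unfolding iid(2)[of 0, symmetric] by simp
  have space_L: "space L = space T" by (rule sets_eq_imp_space_eq[OF sets_L])
  let ?PZ = "Pi\<^sub>M UNIV (\<lambda>_::nat. borel :: 'b measure)"
  let ?PX = "Pi\<^sub>M UNIV (\<lambda>_::nat. T)"
  interpret PL: product_prob_space "\<lambda>_::nat. L" UNIV ..
  have X_law: "distr M ?PX (\<lambda>\<omega> i. X i \<omega>) = Pi\<^sub>M UNIV (\<lambda>_. L)"
    using iid(1) indep_vars_iff_distr_eq_PiM[of UNIV X "\<lambda>_. T", OF _ X]
    unfolding iid(2) by (simp add: restrict_def)
  have sets_PL: "sets (Pi\<^sub>M UNIV (\<lambda>_::nat. L)) = sets ?PX"
    by (intro sets_PiM_cong refl sets_L)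
  have joint: "distr M (?PZ \<Otimes>\<^sub>M ?PX) (\<lambda>\<omega>. (\<lambda>i. Z i \<omega>, \<lambda>i. X i \<omega>)) =
      distr M ?PZ (\<lambda>\<omega> i. Z i \<omega>) \<Otimes>\<^sub>M Pi\<^sub>M UNIV (\<lambda>_. L)"
    using distr_pair_independent_rvs[OF indep] unfolding X_law .
  define g where "g z = emeasure L {F. (z, F) \<in> S}" for z
  have slice: "{F. (z, F) \<in> S} \<in> sets T" for z
    using sets_Pair1[OF S, of z] by (simp add: vimage_def)
  have "(\<lambda>z. emeasure L (Pair z -` S)) \<in> borel_measurable borel"
    using S sets_pair_measure_cong[OF refl sets_L, of borel] by (intro L.measurable_emeasure_Pair) blast
  then have g_borel: "g \<in> borel_measurable borel" by (simp add: g_def[abs_def] vimage_def)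
  then have g [measurable]: "g \<in> borel_measurable \<mu>"
    using measurable_cong_sets[OF sets_\<mu> refl] by blast
  have prob_compl: "emeasure L (space T - G) = ennreal (1 - measure L G)"
    using L.prob_compl[of G] G by (simp add: L.emeasure_eq_measure sets_L space_L)
  have one: "emeasure M {\<omega> \<in> space M. (Z i \<omega>, X i \<omega>) \<in> S \<and> (\<forall>j. Z j \<omega> \<in> C \<longrightarrow> X j \<omega> \<notin> G)} =
      (\<integral>\<^sup>+\<omega>. ennreal (1 - measure L G) ^ card {j. Z j \<omega> \<in> C} * g (Z i \<omega>) \<partial>M)" for i
  proof -
    define E where "E = {w \<in> space (?PZ \<Otimes>\<^sub>M ?PX).
      (fst w i, snd w i) \<in> S \<and> (\<forall>j. fst w j \<in> C \<longrightarrow> snd w j \<notin> G)}"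
    have E [measurable]: "E \<in> sets (?PZ \<Otimes>\<^sub>M ?PX)" unfolding E_def by measurable
    have E_sets: "sets (distr M ?PZ (\<lambda>\<omega> i. Z i \<omega>) \<Otimes>\<^sub>M Pi\<^sub>M UNIV (\<lambda>_. L)) = sets (?PZ \<Otimes>\<^sub>M ?PX)"
      "sets (?PZ \<Otimes>\<^sub>M Pi\<^sub>M UNIV (\<lambda>_. L)) = sets (?PZ \<Otimes>\<^sub>M ?PX)"
      by (intro sets_pair_measure_cong sets_PL refl sets_distr)+
    have Zm [measurable]: "(\<lambda>\<omega> i. Z i \<omega>) \<in> measurable M ?PZ"
      and Xm [measurable]: "(\<lambda>\<omega> i. X i \<omega>) \<in> measurable M ?PX"
      by (rule independent_rvs_measurable[OF indep])+
    have "{\<omega> \<in> space M. (Z i \<omega>, X i \<omega>) \<in> S \<and> (\<forall>j. Z j \<omega> \<in> C \<longrightarrow> X j \<omega> \<notin> G)} =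
        (\<lambda>\<omega>. (\<lambda>i. Z i \<omega>, \<lambda>i. X i \<omega>)) -` E \<inter> space M"
      using measurable_space[OF Zm] measurable_space[OF Xm] by (auto simp: E_def space_pair_measure)
    then have "emeasure M {\<omega> \<in> space M. (Z i \<omega>, X i \<omega>) \<in> S \<and> (\<forall>j. Z j \<omega> \<in> C \<longrightarrow> X j \<omega> \<notin> G)} =
        emeasure (distr M (?PZ \<Otimes>\<^sub>M ?PX) (\<lambda>\<omega>. (\<lambda>i. Z i \<omega>, \<lambda>i. X i \<omega>))) E"
      by (simp add: emeasure_distr)
    also have "\<dots> = (\<integral>\<^sup>+z. emeasure (Pi\<^sub>M UNIV (\<lambda>_. L)) (Pair z -` E) \<partial>distr M ?PZ (\<lambda>\<omega> i. Z i \<omega>))"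
      unfolding joint using E E_sets by (intro PL.emeasure_pair_measure_alt) simp
    also have "\<dots> = (\<integral>\<^sup>+\<omega>. emeasure (Pi\<^sub>M UNIV (\<lambda>_. L)) (Pair (\<lambda>i. Z i \<omega>) -` E) \<partial>M)"
      using E E_sets by (intro nn_integral_distr[OF Zm] PL.measurable_emeasure_Pair) simp
    also have "\<dots> = (\<integral>\<^sup>+\<omega>. ennreal (1 - measure L G) ^ card {j. Z j \<omega> \<in> C} * g (Z i \<omega>) \<partial>M)"
    proof (intro nn_integral_cong_AE)
      have "AE \<omega> in M. finite {j. Z j \<omega> \<in> C}"
        using poisson_finite[OF poisson, of C] finC sets_\<mu> by simp
      then show "AE \<omega> in M. emeasure (Pi\<^sub>M UNIV (\<lambda>_. L)) (Pair (\<lambda>i. Z i \<omega>) -` E) =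
          ennreal (1 - measure L G) ^ card {j. Z j \<omega> \<in> C} * g (Z i \<omega>)"
        using AE_space
      proof eventually_elim
        fix \<omega> assume fin: "finite {j. Z j \<omega> \<in> C}" and \<omega>: "\<omega> \<in> space M"
        let ?J = "{j. Z j \<omega> \<in> C}"
        show "emeasure (Pi\<^sub>M UNIV (\<lambda>_. L)) (Pair (\<lambda>i. Z i \<omega>) -` E) =
          ennreal (1 - measure L G) ^ card ?J * g (Z i \<omega>)"
        proof (cases "i \<in> ?J")
          case True
          then have "{F. (Z i \<omega>, F) \<in> S} = {}" using SC by auto
          moreover have "Pair (\<lambda>i. Z i \<omega>) -` E = {}" using True SC by (auto simp: E_def)
          ultimately show ?thesis by (simp add: g_def)
        next
          case False
          \<comment> \<open>Given the points, the event constrains finitely many marks: mark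
            \<open>i\<close> lies in a slice of \<open>S\<close>, and the marks at points of
            \<open>C\<close> avoid \<open>G\<close>. As \<open>S\<close> has nothing above
            \<open>C\<close>, index \<open>i\<close> is not among the latter, and the probabilities
            multiply.\<close>
          define A where "A j = (if j = i then {F. (Z i \<omega>, F) \<in> S} else space T - G)" for j
          have "Pair (\<lambda>i. Z i \<omega>) -` E = {x \<in> space (Pi\<^sub>M UNIV (\<lambda>_. L)). \<forall>j\<in>insert i ?J. x j \<in> A j}"
            using False by (auto simp: E_def A_def space_pair_measure space_PiM space_L)
          also have "emeasure (Pi\<^sub>M UNIV (\<lambda>_. L)) \<dots> = (\<Prod>j\<in>insert i ?J. emeasure L (A j))"
            using fin slice by (intro PL.emeasure_PiM_Collect) (auto simp: A_def sets_L)
          also have "\<dots> = emeasure L (A i) * (\<Prod>j\<in>?J. emeasure L (A j))"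
            using False fin by (intro prod.insert) auto
          also have "(\<Prod>j\<in>?J. emeasure L (A j)) = (\<Prod>j\<in>?J. ennreal (1 - measure L G))"
            using False by (intro prod.cong refl) (auto simp: A_def prob_compl)
          also have "emeasure L (A i) * \<dots> = g (Z i \<omega>) * ennreal (1 - measure L G) ^ card ?J"
            by (simp add: A_def g_def)
          finally show ?thesis by (simp add: mult.commute)
        qed
      qed
    qed
    finally show ?thesis .
  qed
  have "g z = 0" if "z \<in> C" for z
  proof -
    have "{F. (z, F) \<in> S} = {}" using SC that by auto
    then show ?thesis by (simp add: g_def)
  qed
  then have "(\<Sum>i. \<integral>\<^sup>+\<omega>. ennreal (1 - measure L G) ^ card {j. Z j \<omega> \<in> C} * g (Z i \<omega>) \<partial>M) =
      ennreal (exp (- ((1 - (1 - measure L G)) * measure \<mu> C))) * (\<integral>\<^sup>+z. g z \<partial>\<mu>)"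
    using finC by (intro nn_integral_poisson_campbell[OF poisson \<mu>]) (auto simp: sets_\<mu>)
  then show ?thesis unfolding one g_def by simp
qed

section \<open>Translates, products and exceptional times of the points\<close>

lemma mem_translation_iff: "(x::'a::ab_group_add) \<in> (+) c ` F \<longleftrightarrow> x - c \<in> F"
  by (auto intro!: image_eqI[of _ _ "x - c"])

lemma emeasure_lborel_Times:
  fixes A :: "'a::euclidean_space set" and B :: "'b::euclidean_space set"
  assumes "A \<in> sets borel" "B \<in> sets borel"
  shows "emeasure lborel (A \<times> B) = emeasure lborel A * emeasure lborel B"
  using assms by (simp add: lborel_prod[symmetric] lborel.emeasure_pair_measure_Times)

lemma (in prob_space) poisson_null_set:
  assumes poisson: "poisson_process M \<mu> Z" and A: "A \<in> sets \<mu>" "emeasure \<mu> A = 0"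
  shows "AE \<omega> in M. \<forall>i. Z i \<omega> \<notin> A"
proof -
  note [measurable] = poisson_measurable[OF poisson] A(1)
  have "measure \<mu> A = 0" using A by (simp add: measure_def)
  then have "prob {\<omega> \<in> space M. finite {i. Z i \<omega> \<in> A} \<and> card {i. Z i \<omega> \<in> A} = 0} = 1"
    using poisson_prob[OF poisson, of A 0] A by simp
  moreover have "{\<omega> \<in> space M. finite {i. Z i \<omega> \<in> A} \<and> card {i. Z i \<omega> \<in> A} = 0} =
      {\<omega> \<in> space M. \<forall>i. Z i \<omega> \<notin> A}" by auto
  ultimately show ?thesis by (intro AE_I_eq_1) (auto simp: emeasure_eq_measure)
qed

lemma (in prob_space) poisson_times_nonzero:
  fixes Z :: "nat \<Rightarrow> 'a \<Rightarrow> 'b::euclidean_space \<times> real"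
  assumes poisson: "poisson_process M lborel Z"
  shows "AE \<omega> in M. \<forall>i. snd (Z i \<omega>) \<noteq> 0"
proof -
  have "emeasure lborel ((UNIV :: 'b set) \<times> {0::real}) = 0"
    by (subst emeasure_lborel_Times) auto
  then have "AE \<omega> in M. \<forall>i. Z i \<omega> \<notin> UNIV \<times> {0}"
    using borel_closed[of "(UNIV :: 'b set) \<times> {0::real}"] closed_Times[of "UNIV :: 'b set" "{0::real}"]
    by (intro poisson_null_set[OF poisson]) auto
  then show ?thesis by eventually_elim (auto simp: mem_Times_iff)
qed

text \<open>Two points of equal time in a bounded window lie in one of the \<open>m\<close> thin
  slabs that cut it. A slab has mass of order \<open>1 / m\<close> and holds two points with
  probability of order \<open>1 / m\<^sup>2\<close>, so the union over the slabs has probability of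
  order \<open>1 / m\<close>, which tends to 0.\<close>

lemma (in prob_space) poisson_times_distinct:
  fixes Z :: "nat \<Rightarrow> 'a \<Rightarrow> 'b::euclidean_space \<times> real"
  assumes poisson: "poisson_process M lborel Z"
  shows "AE \<omega> in M. \<forall>i j. i \<noteq> j \<longrightarrow> snd (Z i \<omega>) < 0 \<longrightarrow> snd (Z i \<omega>) \<noteq> snd (Z j \<omega>)"
proof -
  have Z [measurable]: "Z i \<in> measurable M borel" for i
    using poisson_measurable[OF poisson, of i] by simp
  have [measurable]: "(\<lambda>\<omega>. snd (Z i \<omega>)) \<in> borel_measurable M" for i
    by (rule measurable_compose[OF Z]) (intro borel_measurable_continuous_onI continuous_intros)
  define W where "W n = ball (0::'b) (real n) \<times> {- real n ..< 0}" for n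
  define Bad where "Bad n = {\<omega> \<in> space M. \<exists>i j. i \<noteq> j \<and> Z i \<omega> \<in> W n \<and> Z j \<omega> \<in> W n \<and> snd (Z i \<omega>) = snd (Z j \<omega>)}" for n
  have [measurable]: "W n \<in> sets borel" for n
    unfolding W_def by (intro borel_Times) auto
  have [measurable]: "Bad n \<in> events" for n
    unfolding Bad_def by measurable
  have "prob (Bad n) = 0" for n
  proof (cases "n = 0")
    case True
    then show ?thesis by (simp add: Bad_def W_def)
  next
    case False
    define v where "v = measure lborel (ball (0::'b) (real n))"
    have vb: "emeasure lborel (ball (0::'b) (real n)) = ennreal v"
      using emeasure_lborel_ball_finite[of "0::'b" "real n"]
      by (simp add: v_def emeasure_eq_ennreal_measure less_top)
    have "prob (Bad n) \<le> (v * n)\<^sup>2 / real m" if m: "m > 0" for m :: nat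
    proof -
      define w where "w = real n / real m"
      have w: "w > 0" "w * m = n" using m False by (auto simp: w_def)
      define S where "S l = ball (0::'b) (real n) \<times> {- (real (Suc l) * w) ..< - (real l * w)}" for l
      have S [measurable]: "S l \<in> sets borel" for l
        unfolding S_def by (intro borel_Times) auto
      have mS: "emeasure lborel (S l) = ennreal (v * w)" for l
        unfolding S_def using w(1)
        by (subst emeasure_lborel_Times) (auto simp: vb v_def ennreal_mult algebra_simps)
      have "Bad n \<subseteq> (\<Union>l<m. {\<omega> \<in> space M. \<exists>i j. i \<noteq> j \<and> Z i \<omega> \<in> S l \<and> Z j \<omega> \<in> S l})"
      proof
        fix \<omega> assume "\<omega> \<in> Bad n"
        then obtain i j where \<omega>: "\<omega> \<in> space M" and ij: "i \<noteq> j" "Z i \<omega> \<in> W n" "Z j \<omega> \<in> W n"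
          "snd (Z i \<omega>) = snd (Z j \<omega>)" by (auto simp: Bad_def)
        define t where "t = - snd (Z i \<omega>) / w"
        \<comment> \<open>Slab \<open>l\<close> holds the rescaled ages \<open>t\<close> from
          \<open>l\<close> (excluded) to \<open>l + 1\<close> (included); hence the ceiling minus
          one and not the floor.\<close>
        define l where "l = nat (\<lceil>t\<rceil> - 1)"
        have t: "0 < t" "t \<le> m" using ij(2) w by (auto simp: t_def W_def mem_Times_iff field_simps)
        then have "\<lceil>t\<rceil> \<ge> 1" "\<lceil>t\<rceil> \<le> int m" by (auto simp: ceiling_le_iff)
        then have l: "real l < t" "t \<le> real (Suc l)" "l < m"
          using t unfolding l_def by linarith+
        then have "- (real (Suc l) * w) \<le> snd (Z i \<omega>)" "snd (Z i \<omega>) < - (real l * w)"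
          using w(1) by (auto simp: t_def field_simps)
        then have "Z i \<omega> \<in> S l" "Z j \<omega> \<in> S l"
          using ij by (auto simp: S_def W_def mem_Times_iff)
        then show "\<omega> \<in> (\<Union>l<m. {\<omega> \<in> space M. \<exists>i j. i \<noteq> j \<and> Z i \<omega> \<in> S l \<and> Z j \<omega> \<in> S l})"
          using \<omega> ij(1) l(3) by blast
      qed
      then have "prob (Bad n) \<le> prob (\<Union>l<m. {\<omega> \<in> space M. \<exists>i j. i \<noteq> j \<and> Z i \<omega> \<in> S l \<and> Z j \<omega> \<in> S l})"
        by (intro finite_measure_mono) auto
      also have "\<dots> \<le> (\<Sum>l<m. prob {\<omega> \<in> space M. \<exists>i j. i \<noteq> j \<and> Z i \<omega> \<in> S l \<and> Z j \<omega> \<in> S l})"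
        by (intro finite_measure_subadditive_finite) auto
      also have "\<dots> \<le> (\<Sum>l<m. (v * w)\<^sup>2)"
      proof (intro sum_mono)
        fix l
        have "measure lborel (S l) = v * w" using mS[of l] w(1) by (simp add: measure_def v_def)
        then show "prob {\<omega> \<in> space M. \<exists>i j. i \<noteq> j \<and> Z i \<omega> \<in> S l \<and> Z j \<omega> \<in> S l} \<le> (v * w)\<^sup>2"
          using poisson_prob_two_points_le[OF poisson, of "S l"] mS[of l] by simp
      qed
      also have "\<dots> = (v * n)\<^sup>2 / real m"
        using m by (simp add: w_def power2_eq_square field_simps)
      finally show ?thesis .
    qed
    then have "prob (Bad n) \<le> (v * n)\<^sup>2 / real (Suc m)" for m by blast
    moreover have "(\<lambda>m. (v * n)\<^sup>2 / real (Suc m)) \<longlonglongrightarrow> 0"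
      using LIMSEQ_Suc[OF lim_const_over_n] by simp
    ultimately have "prob (Bad n) \<le> 0" by (intro LIMSEQ_le_const) auto
    then show ?thesis by (simp add: measure_le_0_iff)
  qed
  then have "AE \<omega> in M. \<omega> \<notin> Bad n" for n
    by (intro AE_not_in) (auto simp: null_sets_def emeasure_eq_measure)
  then have "AE \<omega> in M. \<forall>n. \<omega> \<notin> Bad n" by (simp add: AE_all_countable)
  then show ?thesis using AE_space
  proof eventually_elim
    case (elim \<omega>)
    show ?case
    proof (intro allI impI notI)
      fix i j :: nat assume ij: "i \<noteq> j" "snd (Z i \<omega>) < 0" "snd (Z i \<omega>) = snd (Z j \<omega>)"
      obtain n :: nat where "norm (fst (Z i \<omega>)) + norm (fst (Z j \<omega>)) - snd (Z i \<omega>) < real n"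
        using reals_Archimedean2 by blast
      moreover have "norm (fst (Z i \<omega>)) \<ge> 0" "norm (fst (Z j \<omega>)) \<ge> 0" by auto
      ultimately have "norm (fst (Z i \<omega>)) < n" "norm (fst (Z j \<omega>)) < n" "- snd (Z i \<omega>) \<le> n"
        using ij(2) by linarith+
      then have "Z i \<omega> \<in> W n" "Z j \<omega> \<in> W n" using ij by (auto simp: W_def mem_Times_iff)
      then have "\<omega> \<in> Bad n" using ij elim(2) by (auto simp: Bad_def)
      then show False using elim(1) by blast
    qed
  qed
qed

section \<open>The first leaf at a pair of points\<close>

text \<open>Finitely many closed leaves later than \<open>i\<close> come near \<open>y\<close> and
  none contains it, so a neighbourhood of \<open>y\<close> inside leaf \<open>i\<close> stays
  visible. Visible parts of older leaves miss the interior of leaf \<open>i\<close>, which is open,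
  and those of later leaves lie in closed sets without \<open>y\<close>; so \<open>y\<close> is in
  the closure of no other visible part. Hence \<open>y\<close> is off the boundary and
  \<open>i\<close> is the only index that \<open>LEAST\<close> can choose.\<close>

lemma colored_field_eq_color_of_first_leaf:
  fixes z :: "nat \<Rightarrow> (real^2) \<times> real" and X :: "nat \<Rightarrow> (real^2) set"
  assumes closed: "\<And>j. closed (X j)"
    and i: "snd (z i) < 0" "y \<in> (+) (fst (z i)) ` interior (X i)"
    and first: "\<And>j. snd (z i) < snd (z j) \<Longrightarrow> snd (z j) < 0 \<Longrightarrow> y \<notin> (+) (fst (z j)) ` X j"
    and distinct: "\<And>j. j \<noteq> i \<Longrightarrow> snd (z j) \<noteq> snd (z i)"
    and nonzero: "\<And>j. snd (z j) \<noteq> 0"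
    and e: "e > 0"
    and fin: "finite {j. snd (z i) < snd (z j) \<and> snd (z j) < 0 \<and> (+) (fst (z j)) ` X j \<inter> ball y e \<noteq> {}}"
  shows "colored_field z X U y = U i"
proof -
  let ?T = "\<lambda>j. (+) (fst (z j)) ` X j" and ?V = "visible_part z X"
  define J where "J = {j. snd (z i) < snd (z j) \<and> snd (z j) < 0 \<and> ?T j \<inter> ball y e \<noteq> {}}"
  define W where "W = ball y e \<inter> interior (?T i) \<inter> (\<Inter>j\<in>J. - ?T j)"
  have clT: "closed (?T j)" for j using closed by (intro closed_translation)
  have intT: "interior (?T j) = (+) (fst (z j)) ` interior (X j)" for j by (rule interior_translation)
  have "open W" unfolding W_def using fin clT by (intro open_Int open_INT ballI) (auto simp: J_def)
  moreover have "y \<in> W" using i e first by (auto simp: W_def J_def intT)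
  moreover have "W \<subseteq> ?V i"
  proof
    fix w assume w: "w \<in> W"
    have "w \<notin> (+) (fst (z j)) ` interior (X j)" if "snd (z i) < snd (z j)" "snd (z j) < 0" for j
    proof
      assume "w \<in> (+) (fst (z j)) ` interior (X j)"
      then have "w \<in> ?T j" using interior_subset by blast
      with w that have "j \<in> J" by (auto simp: W_def J_def)
      with w \<open>w \<in> ?T j\<close> show False by (auto simp: W_def)
    qed
    moreover have "w \<in> ?T i" using w interior_subset by (auto simp: W_def)
    ultimately show "w \<in> ?V i" using i(1) unfolding visible_part_def by auto
  qed
  ultimately have in_i: "y \<in> interior (?V i)" by (meson interior_maximal subsetD)
  have not_closure: "y \<notin> closure (?V k)" if k: "k \<noteq> i" for k
  proof -
    consider "snd (z k) > 0" | "snd (z k) < snd (z i)" | "snd (z i) < snd (z k)" "snd (z k) < 0"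
      using distinct[OF k] nonzero[of k] by linarith
    then show ?thesis
    proof cases
      case 1
      then show ?thesis by (simp add: visible_part_def)
    next
      case 2
      have "interior (?T i) \<inter> ?V k = {}"
        using 2 i(1) unfolding intT visible_part_def by auto
      then have "interior (?T i) \<inter> closure (?V k) = {}"
        by (simp add: open_Int_closure_eq_empty)
      then show ?thesis using i(2) intT by blast
    next
      case 3
      have "?V k \<subseteq> ?T k" by (auto simp: visible_part_def)
      then have "closure (?V k) \<subseteq> ?T k" using clT by (rule closure_minimal)
      then show ?thesis using first[OF 3] by blast
    qed
  qed
  have "y \<notin> dead_leaves_boundary z X"
    unfolding dead_leaves_boundary_def frontier_def
  proof
    assume "y \<in> (\<Union>k. closure (?V k) - interior (?V k))"
    then obtain k where k: "y \<in> closure (?V k)" "y \<notin> interior (?V k)" by blast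
    have "k = i" using not_closure[of k] k(1) by blast
    then show False using in_i k(2) by simp
  qed
  moreover have "(LEAST k. y \<in> interior (?V k)) = i"
  proof (rule Least_equality, fact in_i)
    fix k assume "y \<in> interior (?V k)"
    then have "y \<in> closure (?V k)" using interior_subset closure_subset by blast
    then have "k = i" using not_closure[of k] by blast
    then show "i \<le> k" by simp
  qed
  moreover have "\<exists>k. y \<in> interior (?V k)" using in_i by blast
  ultimately show ?thesis by (simp only: colored_field_def simp_thms if_True)
qed

lemma nn_integral_lborel_fst_times_indicator:
  fixes f :: "'a::euclidean_space \<Rightarrow> ennreal" and T :: "'b::euclidean_space set"
  assumes [measurable]: "f \<in> borel_measurable borel" "T \<in> sets borel"
  shows "(\<integral>\<^sup>+z. f (fst z) * indicator T (snd z) \<partial>lborel) = (\<integral>\<^sup>+x. f x \<partial>lborel) * emeasure lborel T"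
proof -
  have "(\<integral>\<^sup>+z. f (fst z) * indicator T (snd z) \<partial>(lborel \<Otimes>\<^sub>M lborel)) =
      (\<integral>\<^sup>+x. \<integral>\<^sup>+y. f x * indicator T y \<partial>lborel \<partial>lborel)"
    by (subst lborel.nn_integral_fst[symmetric]) auto
  also have "\<dots> = (\<integral>\<^sup>+x. f x * emeasure lborel T \<partial>lborel)"
    by (simp add: nn_integral_cmult_indicator)
  also have "\<dots> = (\<integral>\<^sup>+x. f x \<partial>lborel) * emeasure lborel T"
    by (rule nn_integral_multc) simp
  finally show ?thesis by (simp add: lborel_prod)
qed

text \<open>Such a leaf touches the pair without settling both colors at once. Touching refers to
  the closed set and containing to the interior, so that boundary cases count as bad, as the
  criterion for the color of the first leaf requires.\<close>

definition straddles :: "'a::topological_space \<Rightarrow> 'a \<Rightarrow> 'a set \<Rightarrow> bool" where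
  "straddles x y F \<longleftrightarrow> (x \<in> F \<or> y \<in> F) \<and> \<not> (x \<in> interior F \<and> y \<in> interior F)"

abbreviation straddling :: "real^2 \<Rightarrow> real^2 \<Rightarrow> (real^2) set set" where
  "straddling x y \<equiv> {F. closed F \<and> straddles x y F}"

abbreviation hitting :: "real^2 \<Rightarrow> (real^2) set set" where
  "hitting c \<equiv> {F. closed F \<and> F \<inter> ball c 1 \<noteq> {}}"

abbreviation covering :: "real \<Rightarrow> (real^2) set set" where
  "covering \<rho> \<equiv> {F. closed F \<and> ball 0 \<rho> \<subseteq> F}"

lemma pred_straddles:
  fixes f g :: "'b \<Rightarrow> 'a::euclidean_space"
  assumes f: "f \<in> borel_measurable M" and g: "g \<in> borel_measurable M" and h: "h \<in> measurable M fell"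
  shows "Measurable.pred M (\<lambda>w. straddles (f w) (g w) (h w))"
proof -
  note [measurable] = pred_mem_fell[OF f h] pred_mem_fell[OF g h]
    pred_mem_interior_fell[OF f h] pred_mem_interior_fell[OF g h]
  show ?thesis unfolding straddles_def by measurable
qed

lemma straddles_sets:
  "{w \<in> space (borel \<Otimes>\<^sub>M fell). straddles (x - fst w) (y - fst w) (snd w)} \<in>
    sets (borel \<Otimes>\<^sub>M (fell :: 'a::euclidean_space set measure))"
proof -
  have "Measurable.pred (borel \<Otimes>\<^sub>M (fell :: 'a set measure)) (\<lambda>w. straddles (x - fst w) (y - fst w) (snd w))"
    by (rule pred_straddles) measurable
  then show ?thesis by (simp add: pred_def)
qed

section \<open>Expected numbers of leaves behind a void\<close>

locale dead_leaves =
  fixes M :: "'w measure" and L :: "(real^2) set measure"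
    and Z :: "nat \<Rightarrow> 'w \<Rightarrow> (real^2) \<times> real" and X :: "nat \<Rightarrow> 'w \<Rightarrow> (real^2) set"
  assumes model: "dead_leaves_model M L Z X"

sublocale dead_leaves \<subseteq> prob_space M
  using model by (simp add: dead_leaves_model_def)

context dead_leaves
begin

abbreviation color_at :: "'w \<Rightarrow> (nat \<Rightarrow> real) \<Rightarrow> real^2 \<Rightarrow> real" where
  "color_at \<omega> U x \<equiv> colored_field (\<lambda>i. Z i \<omega>) (\<lambda>i. X i \<omega>) U x"

lemma poisson: "poisson_process M lborel Z"
  using model by (simp add: dead_leaves_model_def)

lemma marks_iid: "indep_vars (\<lambda>_. fell) X UNIV" "distr M fell (X i) = L"
  using model by (simp_all add: dead_leaves_model_def)

lemma points_indep_marks: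
  "independent_rvs M (Pi\<^sub>M UNIV (\<lambda>_. borel)) (\<lambda>\<omega> i. Z i \<omega>) (Pi\<^sub>M UNIV (\<lambda>_. fell)) (\<lambda>\<omega> i. X i \<omega>)"
  using model by (simp add: dead_leaves_model_def)

lemma mark_measurable: "X i \<in> measurable M fell"
  using marks_iid(1) by (simp add: indep_vars_def)

lemma point_measurable: "Z i \<in> measurable M borel"
  using poisson_measurable[OF poisson, of i] by simp

lemma closed_mark: "\<omega> \<in> space M \<Longrightarrow> closed (X i \<omega>)"
  using measurable_space[OF mark_measurable] by fastforce

lemma prob_space_L: "prob_space L"
  using prob_space_distr[OF mark_measurable, of 0] by (simp only: marks_iid(2))

lemma sets_L: "sets L = sets fell"
  unfolding marks_iid(2)[of 0, symmetric] by simp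

text \<open>Position and leaf are constrained by \<open>S\<close>, time separately by
  \<open>T\<close>, so that the intensity factors into a planar integral and a length.
  \<open>C\<close> and \<open>G\<close> describe the void: no point of \<open>C\<close> carries a
  mark in \<open>G\<close>; an empty \<open>C\<close> imposes nothing.\<close>

definition event :: "((real^2) \<times> (real^2) set) set \<Rightarrow> real set \<Rightarrow> ((real^2) \<times> real) set \<Rightarrow>
    (real^2) set set \<Rightarrow> nat \<Rightarrow> 'w set" where
  "event S T C G i = {\<omega> \<in> space M. (fst (Z i \<omega>), X i \<omega>) \<in> S \<and> snd (Z i \<omega>) \<in> T \<and>
     (\<forall>j. Z j \<omega> \<in> C \<longrightarrow> X j \<omega> \<notin> G)}"

lemma event_sets:
  assumes [measurable]: "S \<in> sets (borel \<Otimes>\<^sub>M fell)" "T \<in> sets borel" "C \<in> sets borel" "G \<in> sets fell"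
  shows "event S T C G i \<in> sets M"
proof -
  note point_measurable [measurable] mark_measurable [measurable]
  have [measurable]: "(\<lambda>\<omega>. fst (Z i \<omega>)) \<in> borel_measurable M" "(\<lambda>\<omega>. snd (Z i \<omega>)) \<in> borel_measurable M"
    by (rule measurable_compose[OF point_measurable];
        intro borel_measurable_continuous_onI continuous_intros)+
  show ?thesis unfolding event_def by measurable
qed

lemma measurable_slice_L:
  assumes "S \<in> sets (borel \<Otimes>\<^sub>M fell)"
  shows "(\<lambda>x. emeasure L {F. (x, F) \<in> S}) \<in> borel_measurable borel"
proof -
  interpret L: prob_space L by (rule prob_space_L)
  have "(\<lambda>x. emeasure L (Pair x -` S)) \<in> borel_measurable borel"
    using assms sets_pair_measure_cong[OF refl sets_L, of borel] by (intro L.measurable_emeasure_Pair) blast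
  then show ?thesis by (simp add: vimage_def)
qed

lemma sum_event:
  assumes S: "S \<in> sets (borel \<Otimes>\<^sub>M fell)" and T: "T \<in> sets borel" and C: "C \<in> sets borel"
    and G: "G \<in> sets fell" and finC: "emeasure lborel C < \<infinity>" and TC: "\<And>z. z \<in> C \<Longrightarrow> snd z \<notin> T"
  shows "(\<Sum>i. emeasure M (event S T C G i)) =
    ennreal (exp (- (measure L G * measure lborel C))) *
    ((\<integral>\<^sup>+x. emeasure L {F. (x, F) \<in> S} \<partial>lborel) * emeasure lborel T)"
proof -
  define S' where "S' = {w \<in> space (borel \<Otimes>\<^sub>M fell). (fst (fst w), snd w) \<in> S \<and> snd (fst w) \<in> T}"
  note [measurable] = S T
  have [measurable]: "fst \<in> borel_measurable (borel :: ((real^2) \<times> real) measure)"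
    "snd \<in> borel_measurable (borel :: ((real^2) \<times> real) measure)"
    by (intro borel_measurable_continuous_onI continuous_intros)+
  have S': "S' \<in> sets (borel \<Otimes>\<^sub>M fell)" unfolding S'_def by measurable
  have SF: "(x, F) \<in> S \<Longrightarrow> closed F" for x F
    using sets.sets_into_space[OF S] by (auto simp: space_pair_measure)
  have ev: "event S T C G i = {\<omega> \<in> space M. (Z i \<omega>, X i \<omega>) \<in> S' \<and> (\<forall>j. Z j \<omega> \<in> C \<longrightarrow> X j \<omega> \<notin> G)}" for i
    unfolding event_def S'_def using SF by (auto simp: space_pair_measure)
  have "S' \<inter> C \<times> UNIV = {}" using TC by (auto simp: S'_def)
  then have "(\<Sum>i. emeasure M (event S T C G i)) =
      ennreal (exp (- (measure L G * measure lborel C))) * (\<integral>\<^sup>+z. emeasure L {F. (z, F) \<in> S'} \<partial>lborel)"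
    unfolding ev
    by (intro marked_poisson_campbell[OF poisson sets_lborel _ marks_iid points_indep_marks S' G C finC])
       (rule lborel.sigma_finite_measure_axioms)
  also have "(\<integral>\<^sup>+z. emeasure L {F. (z, F) \<in> S'} \<partial>lborel) =
      (\<integral>\<^sup>+z. emeasure L {F. (fst z, F) \<in> S} * indicator T (snd z) \<partial>lborel)"
  proof (intro nn_integral_cong)
    fix z :: "(real^2) \<times> real"
    have "{F. (z, F) \<in> S'} = (if snd z \<in> T then {F. (fst z, F) \<in> S} else {})"
      using SF by (auto simp: S'_def space_pair_measure)
    then show "emeasure L {F. (z, F) \<in> S'} = emeasure L {F. (fst z, F) \<in> S} * indicator T (snd z)"
      by simp
  qed
  also have "\<dots> = (\<integral>\<^sup>+x. emeasure L {F. (x, F) \<in> S} \<partial>lborel) * emeasure lborel T"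
    by (rule nn_integral_lborel_fst_times_indicator[OF measurable_slice_L[OF S] T])
  finally show ?thesis .
qed

text \<open>For a bounded window of times, the probabilities that leaf \<open>i\<close> meets the
  unit ball have a finite sum over \<open>i\<close>. The Borel-Cantelli lemma then applies along the
  indices, without any order in time.\<close>

lemma leaves_locally_finite:
  assumes fin: "(\<integral>\<^sup>+z. emeasure L (hitting (x - z)) \<partial>lborel) < \<infinity>"
  shows "AE \<omega> in M. \<forall>n::nat. finite {j. - real n \<le> snd (Z j \<omega>) \<and> snd (Z j \<omega>) < 0 \<and>
    (+) (fst (Z j \<omega>)) ` X j \<omega> \<inter> ball x 1 \<noteq> {}}"
proof -
  define S where "S = {w \<in> space (borel \<Otimes>\<^sub>M fell). snd w \<inter> ball (x - fst w) 1 \<noteq> {}}"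
  have "Measurable.pred (borel \<Otimes>\<^sub>M fell) (\<lambda>w. case (x - fst w, snd w) of (c, F) \<Rightarrow> F \<inter> ball c 1 \<noteq> {})"
    by (rule measurable_compose[OF _ pred_hit_ball]) measurable
  then have S: "S \<in> sets (borel \<Otimes>\<^sub>M fell)" unfolding S_def pred_def by simp
  have slice: "{F. (z, F) \<in> S} = hitting (x - z)" for z
    by (auto simp: S_def space_pair_measure)
  have one: "AE \<omega> in M. finite {j. - real n \<le> snd (Z j \<omega>) \<and> snd (Z j \<omega>) < 0 \<and>
    (+) (fst (Z j \<omega>)) ` X j \<omega> \<inter> ball x 1 \<noteq> {}}" for n
  proof -
    let ?E = "event S {- real n ..< 0} {} {}"
    have E: "?E i \<in> events" for i by (intro event_sets S) auto
    have "(\<Sum>i. emeasure M (?E i)) < \<infinity>"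
      using fin by (subst sum_event[OF S]) (auto simp: slice ennreal_mult_less_top)
    then have "summable (\<lambda>i. prob (?E i))"
      unfolding emeasure_eq_measure by (intro summable_suminf_not_top) auto
    then have "AE \<omega> in M. eventually (\<lambda>i. \<omega> \<in> space M - ?E i) sequentially"
      using E by (intro borel_cantelli_AE1) (auto simp: less_top[symmetric])
    then show ?thesis using AE_space
    proof eventually_elim
      case (elim \<omega>)
      obtain m where "\<forall>i\<ge>m. \<omega> \<in> space M - ?E i"
        using elim(1) unfolding eventually_sequentially by (rule exE)
      then have m: "\<omega> \<notin> ?E i" if "i \<ge> m" for i using that by simp
      have "j < m" if j: "- real n \<le> snd (Z j \<omega>)" "snd (Z j \<omega>) < 0"
        "(+) (fst (Z j \<omega>)) ` X j \<omega> \<inter> ball x 1 \<noteq> {}" for j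
      proof (rule ccontr)
        assume "\<not> j < m"
        obtain w where "w \<in> (+) (fst (Z j \<omega>)) ` X j \<omega> \<inter> ball x 1"
          using j(3) unfolding ex_in_conv[symmetric] by (rule exE)
        then have w: "w \<in> ball x 1" "w - fst (Z j \<omega>) \<in> X j \<omega>"
          unfolding Int_iff mem_translation_iff by (rule conjunct2, rule conjunct1)
        have "w - fst (Z j \<omega>) \<in> ball (x - fst (Z j \<omega>)) 1" using w(1) by (simp add: dist_norm)
        then have "(fst (Z j \<omega>), X j \<omega>) \<in> S"
          using w(2) closed_mark[OF elim(2), of j] by (auto simp: S_def space_pair_measure)
        then have "\<omega> \<in> ?E j" using j elim(2) by (simp add: event_def)
        then show False using m[of j] \<open>\<not> j < m\<close> by simp
      qed
      then have "{j. - real n \<le> snd (Z j \<omega>) \<and> snd (Z j \<omega>) < 0 \<and>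
          (+) (fst (Z j \<omega>)) ` X j \<omega> \<inter> ball x 1 \<noteq> {}} \<subseteq> {..<m}"
        by (intro subsetI, unfold mem_Collect_eq lessThan_iff) (elim conjE)
      then show ?case by (rule finite_subset) simp
    qed
  qed
  then show ?thesis by (simp add: AE_all_countable)
qed

end

context dead_leaves
begin

text \<open>
  Time is cut into slots of length \<open>\<epsilon> = 1 / (p * v)\<close>, where \<open>p\<close> is the probability that a leaf
  covers the ball of radius \<open>\<rho>\<close> around its centre and \<open>v\<close> is the area of that ball. If the first
  leaf to touch \<open>{x, y}\<close> does so in slot \<open>k\<close> and does not contain both points in its interior, then
  none of the slots before \<open>k\<close> has a leaf that is centred within \<open>\<rho>\<close> of \<open>x\<close> and covers its ball; this
  has probability at most \<open>exp (- k) * \<epsilon> * b\<close>, where \<open>b\<close> is the mean area of the positions at which a leaf straddles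
  \<open>x\<close> and \<open>y\<close>.
\<close>

lemma color_discrepancy:
  assumes \<rho>: "\<rho> > 0" and p: "measure L (covering \<rho>) > 0"
    and fin: "\<And>x. (\<integral>\<^sup>+z. emeasure L (hitting (x - z)) \<partial>lborel) < \<infinity>"
  shows "\<exists>E\<in>events.
    emeasure M E \<le> ennreal (2 / (measure L (covering \<rho>) * measure lborel (ball (0::real^2) \<rho>))) *
      (\<integral>\<^sup>+z. emeasure L (straddling (x - z) (y - z)) \<partial>lborel) \<and>
    (AE \<omega> in M. \<omega> \<notin> E \<longrightarrow> (\<forall>U. color_at \<omega> U x = color_at \<omega> U y))"
proof -
  define G where "G = covering \<rho>"
  define p where "p = measure L G"
  define v where "v = measure lborel (ball (0::real^2) \<rho>)"
  define \<epsilon> where "\<epsilon> = 1 / (p * v)"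
  define b where "b = (\<integral>\<^sup>+z. emeasure L (straddling (x - z) (y - z)) \<partial>lborel)"
  have G: "G \<in> sets fell" unfolding G_def by (rule ball_subset_in_sets_fell)
  have p_pos: "p > 0" using p by (simp add: p_def G_def)
  have v_pos: "v > 0" unfolding v_def using \<rho> by (simp add: content_ball_pos)
  have \<epsilon>_pos: "\<epsilon> > 0" using p_pos v_pos by (simp add: \<epsilon>_def)
  have vb: "emeasure lborel (ball x \<rho>) = ennreal v"
    using \<rho> by (simp add: v_def emeasure_ball content_ball)
  \<comment> \<open>The void demanded ahead of slot \<open>k\<close>: centres within
    \<open>\<rho>\<close> of \<open>x\<close>, over the \<open>k\<close> slots nearest to time 0.
    The length \<open>\<epsilon>\<close> is chosen to make \<open>k\<close> the mean number of
    leaves of \<open>G\<close> in it.\<close>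
  define C where "C k = ball x \<rho> \<times> {- (real k * \<epsilon>) ..< 0}" for k
  define T where "T k = {- (real (Suc k) * \<epsilon>) ..< - (real k * \<epsilon>)}" for k
  have C: "C k \<in> sets borel" for k unfolding C_def by (intro borel_Times) auto
  have T: "T k \<in> sets borel" for k by (simp add: T_def)
  have emT: "emeasure lborel (T k) = ennreal \<epsilon>" for k
    using \<epsilon>_pos by (simp add: T_def algebra_simps)
  have emC: "emeasure lborel (C k) = ennreal (v * (real k * \<epsilon>))" for k
    unfolding C_def using \<epsilon>_pos v_pos by (subst emeasure_lborel_Times) (auto simp: vb ennreal_mult)
  have finC: "emeasure lborel (C k) < \<infinity>" for k by (simp add: emC)
  have mC: "measure L G * measure lborel (C k) = real k" for k
  proof -
    have "measure lborel (C k) = v * (real k * \<epsilon>)"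
      using v_pos \<epsilon>_pos emC[of k] by (simp add: measure_def)
    then show ?thesis using p_pos v_pos by (simp add: p_def[symmetric] \<epsilon>_def)
  qed
  define S where "S = {w \<in> space (borel \<Otimes>\<^sub>M fell). straddles (x - fst w) (y - fst w) (snd w)}"
  have S: "S \<in> sets (borel \<Otimes>\<^sub>M fell)" unfolding S_def by (rule straddles_sets)
  have sliceS: "{F. (z, F) \<in> S} = straddling (x - z) (y - z)" for z
    by (auto simp: S_def space_pair_measure)
  define E where "E = (\<Union>k. \<Union>i. event S (T k) (C k) G i)"
  have ev: "event S (T k) (C k) G i \<in> events" for k i by (intro event_sets S T C G)
  have E: "E \<in> events" unfolding E_def using ev by (intro sets.countable_UN) auto
  have TC: "z \<in> C k \<Longrightarrow> snd z \<notin> T k" for z k by (auto simp: C_def T_def)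

  have "emeasure M E \<le> (\<Sum>k. emeasure M (\<Union>i. event S (T k) (C k) G i))"
    unfolding E_def using ev by (intro emeasure_subadditive_countably) (auto intro: sets.countable_UN)
  also have "\<dots> \<le> (\<Sum>k. \<Sum>i. emeasure M (event S (T k) (C k) G i))"
    using ev by (intro suminf_le emeasure_subadditive_countably) auto
  also have "\<dots> = (\<Sum>k. ennreal (exp (- real k)) * (b * ennreal \<epsilon>))"
    by (subst sum_event[OF S T C G finC TC]) (simp_all add: mC emT sliceS b_def)
  \<comment> \<open>Comparison with powers of \<open>1 / 2\<close> replaces the exact geometric sum
    by the simple constant 2.\<close>
  also have "\<dots> \<le> (\<Sum>k. ennreal ((1 / 2) ^ k) * (b * ennreal \<epsilon>))"
  proof (intro suminf_le mult_right_mono ennreal_leI)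
    fix k
    have "2 \<le> exp (1::real)" using exp_ge_add_one_self[of 1] by simp
    then have "exp (- 1 :: real) \<le> 1 / 2" by (simp add: exp_minus field_simps)
    then have "exp (- 1 :: real) ^ k \<le> (1 / 2) ^ k" by (intro power_mono) auto
    then show "exp (- real k) \<le> (1 / 2) ^ k" by (simp add: exp_of_nat_mult[symmetric])
  qed auto
  also have "\<dots> = (\<Sum>k. ennreal ((1 / 2) ^ k)) * (b * ennreal \<epsilon>)" by simp
  also have "(\<Sum>k. ennreal ((1 / 2) ^ k)) = ennreal 2"
    using geometric_sums[of "1 / 2 :: real"] by (intro suminf_ennreal_eq) auto
  also have "ennreal 2 * (b * ennreal \<epsilon>) = ennreal (2 * \<epsilon>) * b"
    using \<epsilon>_pos by (simp add: ennreal_mult mult_ac)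
  finally have mE: "emeasure M E \<le> ennreal (2 / (p * v)) * b" by (simp add: \<epsilon>_def)

  define Void where "Void k = {\<omega> \<in> space M. \<forall>j. Z j \<omega> \<in> C k \<longrightarrow> X j \<omega> \<notin> G}" for k
  have Void: "Void k \<in> events" for k
  proof -
    note point_measurable [measurable] mark_measurable [measurable] C [measurable] G [measurable]
    show ?thesis unfolding Void_def by measurable
  qed
  \<comment> \<open>The Campbell sum counts leaves behind a void and does not speak of a void alone.
    A test leaf is therefore added: in the equally long window \<open>T'\<close> just before
    \<open>C k\<close> there is either some point, an event of probability at most the mean number
    \<open>k / p\<close> times \<open>exp (- k)\<close>, or none, which has probability
    \<open>exp (- (k / p))\<close>.\<close>
  have Void_le: "prob (Void k) \<le> real k * exp (- real k) / p + exp (- (real k / p))" for k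
  proof -
    define T' where "T' = {- (2 * real k * \<epsilon>) ..< - (real k * \<epsilon>)}"
    define D where "D = ball x \<rho> \<times> T'"
    define B where "B = ball x \<rho> \<times> {F :: (real^2) set. closed F}"
    have emT': "emeasure lborel T' = ennreal (real k * \<epsilon>)"
      using \<epsilon>_pos by (simp add: T'_def algebra_simps)
    have D: "D \<in> sets borel" unfolding D_def T'_def by (intro borel_Times) auto
    have vk: "v * (real k * \<epsilon>) = real k / p" using v_pos by (simp add: \<epsilon>_def)
    have emD: "emeasure lborel D = ennreal (real k / p)"
      unfolding D_def using \<epsilon>_pos v_pos vk
      by (subst emeasure_lborel_Times) (auto simp: vb emT' ennreal_mult[symmetric], auto simp: T'_def)
    have mD: "measure lborel D = real k / p" using emD p_pos by (simp add: measure_def)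
    have B: "B \<in> sets (borel \<Otimes>\<^sub>M fell)" 
      using sets.top[of fell] unfolding B_def by (intro pair_measureI) simp_all
    let ?N = "{\<omega> \<in> space M. finite {i. Z i \<omega> \<in> D} \<and> card {i. Z i \<omega> \<in> D} = 0}"
    have N: "?N \<in> events"
      using pred_finite_card[of "\<lambda>i \<omega>. Z i \<omega> \<in> D" M 0] point_measurable D
      by (simp add: pred_def measurable_sets_borel measurable_sets)
    have probN: "prob ?N = exp (- (real k / p))"
      using poisson_prob[OF poisson, of D 0] D emD mD by simp
    have evB: "event B T' (C k) G i \<in> events" for i
      by (intro event_sets B C G) (simp add: T'_def)
    have "AE \<omega> in M. finite {i. Z i \<omega> \<in> D}"
      using poisson_finite[OF poisson, of D] D emD by simp
    then have "AE \<omega> in M. \<omega> \<in> Void k \<longrightarrow> \<omega> \<in> (\<Union>i. event B T' (C k) G i) \<union> ?N"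
      using AE_space
    proof eventually_elim
      case (elim \<omega>)
      show ?case
      proof
        assume V: "\<omega> \<in> Void k"
        show "\<omega> \<in> (\<Union>i. event B T' (C k) G i) \<union> ?N"
        proof (cases "{i. Z i \<omega> \<in> D} = {}")
          case True
          then show ?thesis using elim by simp
        next
          case False
          then obtain i where "Z i \<omega> \<in> D" by auto
          then have "\<omega> \<in> event B T' (C k) G i"
            using V closed_mark[OF elim(2)] elim(2)
            by (auto simp: event_def Void_def D_def B_def mem_Times_iff)
          then show ?thesis by blast
        qed
      qed
    qed
    then have "emeasure M (Void k) \<le> emeasure M ((\<Union>i. event B T' (C k) G i) \<union> ?N)"
      using evB N by (intro emeasure_mono_AE) (auto intro!: sets.Un sets.countable_UN)
    also have "\<dots> \<le> emeasure M (\<Union>i. event B T' (C k) G i) + emeasure M ?N"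
      using evB N by (intro emeasure_subadditive) (auto intro!: sets.countable_UN)
    also have "\<dots> \<le> ennreal (exp (- real k)) * (ennreal v * ennreal (real k * \<epsilon>)) + emeasure M ?N"
    proof (rule add_right_mono)
      have "emeasure M (\<Union>i. event B T' (C k) G i) \<le> (\<Sum>i. emeasure M (event B T' (C k) G i))"
        using evB by (intro emeasure_subadditive_countably) auto
      also have "\<dots> = ennreal (exp (- real k)) *
          ((\<integral>\<^sup>+z. emeasure L {F. (z, F) \<in> B} \<partial>lborel) * ennreal (real k * \<epsilon>))"
        by (subst sum_event[OF B _ C G finC]) (auto simp: mC emT', auto simp: C_def T'_def)
      also have "(\<integral>\<^sup>+z. emeasure L {F. (z, F) \<in> B} \<partial>lborel) \<le> (\<integral>\<^sup>+z. indicator (ball x \<rho>) z \<partial>lborel)"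
      proof (intro nn_integral_mono)
        interpret L: prob_space L by (rule prob_space_L)
        fix z
        have "{F. (z, F) \<in> B} = {}" if "z \<notin> ball x \<rho>" using that by (auto simp: B_def)
        then show "emeasure L {F. (z, F) \<in> B} \<le> indicator (ball x \<rho>) z"
          using L.emeasure_le_1 by (cases "z \<in> ball x \<rho>") auto
      qed
      also have "(\<integral>\<^sup>+z. indicator (ball x \<rho>) z \<partial>lborel) = ennreal v" by (simp add: vb)
      finally show "emeasure M (\<Union>i. event B T' (C k) G i) \<le>
          ennreal (exp (- real k)) * (ennreal v * ennreal (real k * \<epsilon>))"
        by (simp add: mult_left_mono mult_right_mono)
    qed
    also have "\<dots> = ennreal (real k * exp (- real k) / p + exp (- (real k / p)))"
      unfolding emeasure_eq_measure probN using \<epsilon>_pos v_pos p_pos vk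
      by (simp add: ennreal_mult[symmetric] ennreal_plus[symmetric] mult_ac del: ennreal_plus)
    finally show ?thesis
      using p_pos by (subst (asm) emeasure_eq_measure, subst (asm) ennreal_le_iff) auto
  qed
  have "AE \<omega> in M. \<omega> \<notin> (\<Inter>k. Void k)"
  proof (intro AE_not_in)
    have "prob (\<Inter>k. Void k) \<le> prob (Void k)" for k
      using Void by (intro finite_measure_mono) auto
    then have "prob (\<Inter>k. Void k) \<le> real k * exp (- real k) / p + exp (- (real k / p))" for k
      using Void_le order_trans by blast
    moreover have "(\<lambda>k::nat. real k * exp (- real k) / p + exp (- (real k / p))) \<longlonglongrightarrow> 0"
    proof -
      have "(\<lambda>k::nat. real k * exp (- real k)) \<longlonglongrightarrow> 0" by real_asymp
      moreover have "(\<lambda>k. exp (- 1 / p) ^ k) \<longlonglongrightarrow> 0"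
        using p_pos by (intro LIMSEQ_power_zero) simp
      ultimately have "(\<lambda>k::nat. real k * exp (- real k) / p + exp (- 1 / p) ^ k) \<longlonglongrightarrow> 0 / p + 0"
        using p_pos by (intro tendsto_add tendsto_divide tendsto_const) auto
      then show ?thesis by (simp add: exp_of_nat_mult[symmetric])
    qed
    ultimately have "prob (\<Inter>k. Void k) \<le> 0" by (intro LIMSEQ_le_const) auto
    then show "(\<Inter>k. Void k) \<in> null_sets M"
      using Void by (auto simp: null_sets_def emeasure_eq_measure measure_le_0_iff)
  qed
  then have "AE \<omega> in M. \<omega> \<notin> E \<longrightarrow> (\<forall>U. color_at \<omega> U x = color_at \<omega> U y)"
    using AE_space poisson_times_nonzero[OF poisson] poisson_times_distinct[OF poisson]
      leaves_locally_finite[OF fin, of x] leaves_locally_finite[OF fin, of y]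
  proof eventually_elim
    case (elim \<omega>)
    let ?t = "\<lambda>j. snd (Z j \<omega>)" and ?T = "\<lambda>j. (+) (fst (Z j \<omega>)) ` X j \<omega>"
    show ?case
    proof (intro impI allI)
      fix U assume nE: "\<omega> \<notin> E"
      obtain k j0 where j0: "Z j0 \<omega> \<in> C k" "X j0 \<omega> \<in> G"
        using elim(1,2) by (auto simp: Void_def)
      then have j0': "?t j0 < 0" "x \<in> ?T j0"
        by (auto simp: C_def G_def mem_Times_iff mem_translation_iff dist_norm norm_minus_commute subset_iff)
      \<comment> \<open>Leaf \<open>j0\<close> covers \<open>x\<close>, so only leaves at least as
        recent as \<open>j0\<close> matter. Finitely many of them touch \<open>x\<close> or
        \<open>y\<close>, and the first one going back in time is the one of largest time.\<close>
      define H where "H = {j. ?t j0 \<le> ?t j \<and> ?t j < 0 \<and> (x \<in> ?T j \<or> y \<in> ?T j)}"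
      obtain n :: nat where n: "- ?t j0 \<le> real n" using real_arch_simple by blast
      have "H \<subseteq> {j. - real n \<le> ?t j \<and> ?t j < 0 \<and> ?T j \<inter> ball x 1 \<noteq> {}} \<union>
          {j. - real n \<le> ?t j \<and> ?t j < 0 \<and> ?T j \<inter> ball y 1 \<noteq> {}}"
      proof
        fix j assume j: "j \<in> H"
        then have "- real n \<le> ?t j" "?t j < 0" using n by (auto simp: H_def)
        moreover have "x \<in> ?T j \<inter> ball x 1 \<or> y \<in> ?T j \<inter> ball y 1" using j by (auto simp: H_def)
        ultimately show "j \<in> {j. - real n \<le> ?t j \<and> ?t j < 0 \<and> ?T j \<inter> ball x 1 \<noteq> {}} \<union>
          {j. - real n \<le> ?t j \<and> ?t j < 0 \<and> ?T j \<inter> ball y 1 \<noteq> {}}" by blast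
      qed
      then have finH: "finite H"
        by (rule finite_subset) (intro finite_UnI elim(5)[rule_format] elim(6)[rule_format])
      have "j0 \<in> H" using j0' by (simp add: H_def)
      then have "Max (?t ` H) \<in> ?t ` H" using finH by (intro Max_in) auto
      moreover have "\<And>j. j \<in> H \<Longrightarrow> ?t j \<le> Max (?t ` H)" using finH by simp
      ultimately obtain i where i: "i \<in> H" "\<And>j. j \<in> H \<Longrightarrow> ?t j \<le> ?t i" by fastforce
      then have ti: "?t j0 \<le> ?t i" "?t i < 0" by (auto simp: H_def)
      have first: "x \<notin> ?T j \<and> y \<notin> ?T j" if "?t i < ?t j" "?t j < 0" for j
        using i(2)[of j] that ti by (fastforce simp: H_def)
      have both: "x \<in> (+) (fst (Z i \<omega>)) ` interior (X i \<omega>) \<and> y \<in> (+) (fst (Z i \<omega>)) ` interior (X i \<omega>)"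
      proof (rule ccontr)
        assume "\<not> ?thesis"
        then have "straddles (x - fst (Z i \<omega>)) (y - fst (Z i \<omega>)) (X i \<omega>)"
          using i(1) unfolding straddles_def by (simp add: H_def mem_translation_iff)
        then have inS: "(fst (Z i \<omega>), X i \<omega>) \<in> S"
          using closed_mark[OF elim(2), of i] by (simp add: S_def space_pair_measure)
        define s where "s = - ?t i / \<epsilon>"
        define l where "l = nat (\<lceil>s\<rceil> - 1)"
        have "s > 0" using ti \<epsilon>_pos by (simp add: s_def divide_neg_pos)
        then have "\<lceil>s\<rceil> \<ge> 1" by linarith
        then have "real l < s" "s \<le> real (Suc l)" unfolding l_def by linarith+
        then have l: "?t i < - (real l * \<epsilon>)" "?t i \<in> T l"
          using \<epsilon>_pos by (auto simp: s_def T_def field_simps)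
        \<comment> \<open>A leaf of \<open>G\<close> at a point of \<open>C l\<close> would cover
          \<open>x\<close> at a later time than that of \<open>i\<close>, contrary to
          \<open>i\<close> being the first to touch the pair.\<close>
        have "X j \<omega> \<notin> G" if "Z j \<omega> \<in> C l" for j
        proof
          assume "X j \<omega> \<in> G"
          then have "x \<in> ?T j" using that
            by (auto simp: C_def G_def mem_Times_iff mem_translation_iff dist_norm norm_minus_commute subset_iff)
          then show False using first[of j] that l(1) by (auto simp: C_def mem_Times_iff)
        qed
        then have "\<omega> \<in> event S (T l) (C l) G i" using inS l(2) elim(2) by (simp add: event_def)
        then show False using nE by (auto simp: E_def)
      qed
      have fin_i: "finite {j. ?t i < ?t j \<and> ?t j < 0 \<and> ?T j \<inter> ball w 1 \<noteq> {}}"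
        if "\<forall>n::nat. finite {j. - real n \<le> ?t j \<and> ?t j < 0 \<and> ?T j \<inter> ball w 1 \<noteq> {}}" for w
        using ti n by (intro finite_subset[OF _ that[rule_format, of n]]) auto
      have distinct: "?t j \<noteq> ?t i" if "j \<noteq> i" for j
        using elim(4) that ti(2) by metis
      have "color_at \<omega> U w = U i"
        if "w \<in> (+) (fst (Z i \<omega>)) ` interior (X i \<omega>)" "w = x \<or> w = y" for w
        using that first distinct ti(2) elim(3) closed_mark[OF elim(2)] fin_i[OF elim(5)] fin_i[OF elim(6)]
        by (intro colored_field_eq_color_of_first_leaf[where e = 1]) auto
      then show "color_at \<omega> U x = color_at \<omega> U y"
        using both by simp
    qed
  qed
  then show ?thesis using E mE by (auto simp: p_def v_def b_def G_def)
qed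

end

section \<open>The law of a leaf\<close>

text \<open>
  The law of \<open>R Y\<close> is the image of a product measure under scaling, a map into the Fell space whose
  measurability would require second countability of the Fell topology. This can be avoided: an image
  measure that is not zero is given by preimages in any case.
\<close>

lemma emeasure_distr_nonzero:
  assumes "emeasure (distr M N f) (space N) \<noteq> 0" and "A \<in> sets N"
  shows "emeasure (distr M N f) A = emeasure M (f -` A \<inter> space M)"
proof -
  have conv: "emeasure (distr M N f) B = (if B \<in> sigma_sets (space N) (sets N) \<and>
      measure_space (space N) (sigma_sets (space N) (sets N)) (\<lambda>A. emeasure M (f -` A \<inter> space M))
      then emeasure M (f -` B \<inter> space M) else 0)" for B
    unfolding distr_def emeasure_measure_of_conv by (rule refl)
  show ?thesis
    using assms by (simp add: conv sets.sigma_sets_eq split: if_splits)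
qed

lemma interior_scaleR:
  fixes K :: "'a::euclidean_space set"
  assumes "r \<noteq> 0" shows "interior ((*\<^sub>R) r ` K) = (*\<^sub>R) r ` interior K"
proof -
  have "linear ((*\<^sub>R) r :: 'a \<Rightarrow> 'a)" by (rule linear_scaleR)
  moreover have "inj ((*\<^sub>R) r :: 'a \<Rightarrow> 'a)" using assms by (simp add: inj_on_def)
  ultimately show ?thesis by (intro interior_injective_linear_image)
qed

lemma mem_scaleR_image_iff:
  fixes x :: "'a::real_vector"
  assumes "r \<noteq> 0" shows "x \<in> (*\<^sub>R) r ` K \<longleftrightarrow> x /\<^sub>R r \<in> K"
  using assms by (auto intro!: image_eqI[of _ _ "x /\<^sub>R r"])

lemma straddles_scaleR_iff:
  fixes x y :: "'a::euclidean_space"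
  assumes "r \<noteq> 0" shows "straddles x y ((*\<^sub>R) r ` K) \<longleftrightarrow> straddles (x /\<^sub>R r) (y /\<^sub>R r) K"
  using assms by (simp only: straddles_def interior_scaleR mem_scaleR_image_iff not_False_eq_True)

text \<open>
  Outside the frontier a straddled position lies in exactly one of the sets \<open>interior K\<close> and
  \<open>k + interior K\<close>.
\<close>

lemma emeasure_straddles_le:
  fixes K :: "(real^2) set"
  assumes K: "closed K" "bounded K" "emeasure lborel (frontier K) = 0"
  shows "emeasure lborel {w. straddles w (w - k) K} \<le>
    ennreal (2 * (measure lborel (interior K) - measure lborel (interior K \<inter> (+) k ` interior K)))"
proof -
  let ?A = "interior K" and ?B = "(+) k ` interior K"
  have bB: "?A \<in> sets borel" "?B \<in> sets borel"
    using open_translation[of "interior K" k] by auto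
  have front: "(+) k ` frontier K \<in> sets borel"
    by (rule borel_closed[OF closed_translation[OF frontier_closed]])
  have fin: "emeasure lborel ?A < \<infinity>" "emeasure lborel ?B < \<infinity>"
    by (rule emeasure_bounded_finite[OF bounded_interior[OF K(2)]],
        rule emeasure_bounded_finite[OF bounded_translation[OF bounded_interior[OF K(2)]]])
  have frontB: "emeasure lborel ((+) k ` frontier K) = 0"
  proof -
    have "emeasure lborel ((+) k ` frontier K) = emeasure lebesgue ((+) k ` frontier K)"
      using front by simp
    also have "\<dots> = emeasure lebesgue (frontier K)"
      using emeasure_lebesgue_affine[of 1 k "frontier K"] by (simp add: add.commute[of _ k])
    finally show ?thesis using K(3) by simp
  qed
  have mB: "measure lborel ?B = measure lborel ?A"
  proof -
    have "measure lebesgue ((+) k ` interior K) = measure lebesgue (interior K)"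
      by (rule measure_translation)
    then show ?thesis using bB by (simp add: measure_completion)
  qed
  have diff: "emeasure lborel (P - Q) = ennreal (measure lborel P - measure lborel (P \<inter> Q))"
    if "P \<in> sets borel" "Q \<in> sets borel" "emeasure lborel P < \<infinity>" for P Q :: "(real^2) set"
  proof -
    have eq: "P - Q = P - P \<inter> Q" by auto
    have "emeasure lborel (P - P \<inter> Q) \<le> emeasure lborel P" using that by (intro emeasure_mono) auto
    then have "emeasure lborel (P - P \<inter> Q) = ennreal (measure lborel (P - P \<inter> Q))"
      using that(3) by (intro emeasure_eq_ennreal_measure) (auto simp: top_unique)
    also have "measure lborel (P - P \<inter> Q) = measure lborel P - measure lborel (P \<inter> Q)"
      using that by (intro measure_Diff) auto
    finally show ?thesis unfolding eq .
  qed
  have "{w. straddles w (w - k) K} \<subseteq> ((?A - ?B) \<union> (?B - ?A)) \<union> (frontier K \<union> (+) k ` frontier K)"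
  proof
    fix w assume "w \<in> {w. straddles w (w - k) K}"
    then have "w \<in> K \<or> w - k \<in> K" "\<not> (w \<in> ?A \<and> w \<in> ?B)"
      by (auto simp: straddles_def mem_translation_iff)
    moreover have "w \<in> K \<Longrightarrow> w \<in> ?A \<or> w \<in> frontier K" "w - k \<in> K \<Longrightarrow> w \<in> ?B \<or> w \<in> (+) k ` frontier K"
      using K(1) unfolding mem_translation_iff frontier_def by (simp_all add: closure_closed)
    ultimately show "w \<in> ((?A - ?B) \<union> (?B - ?A)) \<union> (frontier K \<union> (+) k ` frontier K)" by blast
  qed
  then have "emeasure lborel {w. straddles w (w - k) K} \<le>
      emeasure lborel (((?A - ?B) \<union> (?B - ?A)) \<union> (frontier K \<union> (+) k ` frontier K))"
    using bB front by (intro emeasure_mono) auto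
  also have "\<dots> \<le> emeasure lborel ((?A - ?B) \<union> (?B - ?A)) + emeasure lborel (frontier K \<union> (+) k ` frontier K)"
    using bB front by (intro emeasure_subadditive) auto
  also have "\<dots> \<le> (emeasure lborel (?A - ?B) + emeasure lborel (?B - ?A)) +
      (emeasure lborel (frontier K) + emeasure lborel ((+) k ` frontier K))"
    using bB front by (intro add_mono emeasure_subadditive) auto
  also have "\<dots> = emeasure lborel (?A - ?B) + emeasure lborel (?B - ?A)"
    using K(3) frontB by simp
  also have "emeasure lborel (?A - ?B) = ennreal (measure lborel ?A - measure lborel (?A \<inter> ?B))"
    using diff[OF bB fin(1)] .
  also have "emeasure lborel (?B - ?A) = ennreal (measure lborel ?A - measure lborel (?A \<inter> ?B))"
    using diff[OF bB(2) bB(1) fin(2)] by (simp only: mB Int_commute)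
  also have "ennreal (measure lborel ?A - measure lborel (?A \<inter> ?B)) +
      ennreal (measure lborel ?A - measure lborel (?A \<inter> ?B)) =
      ennreal (2 * (measure lborel ?A - measure lborel (?A \<inter> ?B)))"
  proof -
    have "measure lborel (?A \<inter> ?B) \<le> measure lborel ?A"
      using fin bB by (intro measure_mono_fmeasurable) (auto simp: fmeasurable_def)
    then show ?thesis by (simp add: ennreal_plus[symmetric] del: ennreal_plus)
  qed
  finally show ?thesis .
qed

section \<open>The grain and its mean overlap with its translates\<close>

locale random_grain =
  fixes N :: "'n measure" and Y :: "'n \<Rightarrow> (real^2) set" and a\<^sub>1 a\<^sub>2 :: real
  assumes prob_N: "prob_space N" and Y: "random_compact_set N Y"
    and a: "0 < a\<^sub>1" "a\<^sub>1 < a\<^sub>2"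
    and between: "AE \<omega> in N. cball 0 a\<^sub>1 \<subseteq> Y \<omega> \<and> Y \<omega> \<subseteq> cball 0 a\<^sub>2"
    and frontier_null: "AE \<omega> in N. emeasure lborel (frontier (Y \<omega>)) = 0"

sublocale random_grain \<subseteq> prob_space N
  by (rule prob_N)

context random_grain
begin

lemma Y_measurable: "Y \<in> measurable N fell"
  using Y by (simp add: random_compact_set_def)

lemma closed_Y: "\<omega> \<in> space N \<Longrightarrow> closed (Y \<omega>)"
  using measurable_space[OF Y_measurable] by fastforce

abbreviation overlap :: "real^2 \<Rightarrow> 'n \<Rightarrow> real" where
  "overlap k \<omega> \<equiv> measure lborel (interior (Y \<omega>) \<inter> (+) k ` interior (Y \<omega>))"

abbreviation covariogram_defect :: "real^2 \<Rightarrow> real" where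
  "covariogram_defect k \<equiv> geometric_covariogram N Y 0 - geometric_covariogram N Y k"

text \<open>The overlap area is the measure of a slice of a jointly measurable set of outcomes and
  points, hence measurable in the outcome.\<close>

lemma covariogram_integrand_measurable:
  "(\<lambda>\<omega>. overlap k \<omega>) \<in> borel_measurable N"
proof -
  note Y_measurable [measurable] pred_mem_interior_fell [measurable (raw)]
  have "{w \<in> space (N \<Otimes>\<^sub>M borel). snd w \<in> interior (Y (fst w)) \<and> snd w - k \<in> interior (Y (fst w))} \<in>
      sets (N \<Otimes>\<^sub>M borel)" (is "?S \<in> _") by measurable
  then have "?S \<in> sets (N \<Otimes>\<^sub>M lborel)" by (simp cong: sets_pair_measure_cong)
  from lborel.measurable_emeasure_Pair[OF this]
  have "(\<lambda>\<omega>. enn2real (emeasure lborel (Pair \<omega> -` ?S))) \<in> borel_measurable N" by measurable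
  also have "(\<lambda>\<omega>. enn2real (emeasure lborel (Pair \<omega> -` ?S))) \<in> borel_measurable N \<longleftrightarrow> ?thesis"
  proof (rule measurable_cong)
    fix \<omega> assume "\<omega> \<in> space N"
    then have "Pair \<omega> -` ?S = interior (Y \<omega>) \<inter> (+) k ` interior (Y \<omega>)"
      by (auto simp: space_pair_measure mem_translation_iff)
    then show "enn2real (emeasure lborel (Pair \<omega> -` ?S)) =
        overlap k \<omega>"
      by (simp add: measure_def)
  qed
  finally show ?thesis .
qed

lemma covariogram_integrand_le:
  assumes "Y \<omega> \<subseteq> cball 0 a\<^sub>2"
  shows "overlap k \<omega> \<le> measure lborel (cball (0::real^2) a\<^sub>2)"
proof (rule measure_mono_fmeasurable)
  show "interior (Y \<omega>) \<inter> (+) k ` interior (Y \<omega>) \<subseteq> cball 0 a\<^sub>2"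
    using assms interior_subset by blast
  show "interior (Y \<omega>) \<inter> (+) k ` interior (Y \<omega>) \<in> sets lborel"
    unfolding sets_lborel by (rule borel_open[OF open_Int[OF open_interior open_translation[OF open_interior]]])
  show "cball (0::real^2) a\<^sub>2 \<in> fmeasurable lborel"
    using emeasure_lborel_cball_finite[of "0::real^2" a\<^sub>2] by (intro fmeasurableI) auto
qed

lemma covariogram_integrable:
  "integrable N (\<lambda>\<omega>. overlap k \<omega>)"
  using between
  by (intro integrable_const_bound[where B = "measure lborel (cball (0::real^2) a\<^sub>2)"]
      covariogram_integrand_measurable, elim AE_mp) (auto intro!: AE_I2 covariogram_integrand_le)

lemma covariogram_zero: "geometric_covariogram N Y 0 = (\<integral>\<omega>. measure lborel (interior (Y \<omega>)) \<partial>N)"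
  by (simp add: geometric_covariogram_def)

lemma AE_overlap_le: "AE \<omega> in N. overlap k \<omega> \<le> measure lborel (interior (Y \<omega>))"
  using between
proof eventually_elim
  case (elim \<omega>)
  have "bounded (interior (Y \<omega>))"
    using elim bounded_subset[OF bounded_cball] bounded_interior by blast
  then have "emeasure lborel (interior (Y \<omega>)) < \<infinity>" by (rule emeasure_bounded_finite)
  moreover have "interior (Y \<omega>) \<inter> (+) k ` interior (Y \<omega>) \<in> sets lborel"
    unfolding sets_lborel by (rule borel_open[OF open_Int[OF open_interior open_translation[OF open_interior]]])
  ultimately show ?case by (intro measure_mono_fmeasurable fmeasurableI) auto
qed

lemma nn_integral_covariogram_defect:
  "(\<integral>\<^sup>+\<omega>. ennreal (2 * (measure lborel (interior (Y \<omega>)) -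
      overlap k \<omega>)) \<partial>N) =
   ennreal (2 * (covariogram_defect k))"
proof -
  have int0: "integrable N (\<lambda>\<omega>. measure lborel (interior (Y \<omega>)))"
    using covariogram_integrable[of 0] by simp
  show ?thesis
    unfolding covariogram_zero geometric_covariogram_def[of N Y k]
    using AE_overlap_le[of k] int0 covariogram_integrable[of k]
    by (subst nn_integral_eq_integral) auto
qed

end

section \<open>Leaves as grains of random size\<close>

lemma emeasure_lborel_reflect_scale:
  fixes x :: "'a::euclidean_space"
  assumes r: "r \<noteq> 0" and P: "{w. P w} \<in> sets borel"
  shows "emeasure lborel {z. P ((x - z) /\<^sub>R r)} = ennreal (\<bar>r\<bar> ^ DIM('a)) * emeasure lborel {w. P w}"
proof -
  let ?A = "{z. P ((x - z) /\<^sub>R r)}"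
  have "(\<lambda>z. (x - z) /\<^sub>R r) -` {w. P w} \<inter> space borel \<in> sets borel"
    by (rule measurable_sets[OF _ P]) measurable
  then have A [measurable]: "?A \<in> sets borel" by (simp add: vimage_def)
  have "emeasure lborel ?A =
      emeasure (density (distr lborel borel (\<lambda>w. x + (- r) *\<^sub>R w)) (\<lambda>_. ennreal (\<bar>- r\<bar> ^ DIM('a)))) ?A"
    using lborel_affine[of "- r" x] r by simp
  also have "\<dots> = (\<integral>\<^sup>+w. ennreal (\<bar>r\<bar> ^ DIM('a)) * indicator ?A (x + (- r) *\<^sub>R w) \<partial>lborel)"
    by (subst emeasure_density) (auto simp: nn_integral_distr)
  also have "\<dots> = (\<integral>\<^sup>+w. ennreal (\<bar>r\<bar> ^ DIM('a)) * indicator {w. P w} w \<partial>lborel)"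
    using r by (intro nn_integral_cong) (simp add: indicator_def)
  also have "\<dots> = ennreal (\<bar>r\<bar> ^ DIM('a)) * emeasure lborel {w. P w}"
    using P by (simp add: nn_integral_cmult_indicator)
  finally show ?thesis .
qed

text \<open>The assumption \<open>prob_L\<close> makes \<open>L\<close> a genuine image measure: the
  push-forward along a map not known to be measurable could be null by default. In the application
  it holds because \<open>L\<close> is the law of a leaf in a given model.\<close>

locale scaled_grain = random_grain N Y a\<^sub>1 a\<^sub>2
  for N :: "'n measure" and Y :: "'n \<Rightarrow> (real^2) set" and a\<^sub>1 a\<^sub>2 :: real +
  fixes R :: "real measure" and L :: "(real^2) set measure"
  assumes prob_R: "prob_space R" and sets_R: "sets R = sets borel"
    and R_pos: "AE r in R. 0 < r"
    and L: "L = distr (R \<Otimes>\<^sub>M distr N fell Y) fell (\<lambda>(r, K). (\<lambda>x. r *\<^sub>R x) ` K)"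
    and prob_L: "prob_space L"
begin

definition Q :: "(real^2) set measure" where "Q = distr N fell Y"

lemma sets_Q: "sets Q = sets fell"
  by (simp add: Q_def)

lemma space_Q: "space Q = {K. closed K}"
  by (simp add: Q_def)

lemma space_R: "space R = UNIV"
  using sets_eq_imp_space_eq[OF sets_R] by simp

lemma prob_Q: "prob_space Q"
  unfolding Q_def by (rule prob_space_distr[OF Y_measurable])

lemma pair_RQ: "pair_sigma_finite R Q"
proof -
  interpret R: prob_space R by (rule prob_R)
  interpret Q: prob_space Q by (rule prob_Q)
  show ?thesis by unfold_locales
qed

lemma sets_RQ: "sets (R \<Otimes>\<^sub>M Q) = sets (borel \<Otimes>\<^sub>M fell)"
  by (intro sets_pair_measure_cong sets_R sets_Q)

lemma space_RQ: "space (R \<Otimes>\<^sub>M Q) = UNIV \<times> {K. closed K}"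
  by (simp add: space_pair_measure space_R space_Q)

lemma sets_L: "sets L = sets fell"
  by (simp add: L)

text \<open>The preimage of \<open>A\<close> under scaling is not known to be measurable, so its
  measure is bounded by that of a measurable \<open>B\<close> which contains it up to a null
  set.\<close>

lemma emeasure_L_le:
  assumes A: "A \<in> sets fell" and B: "B \<in> sets (borel \<Otimes>\<^sub>M fell)"
    and AB: "AE w in R \<Otimes>\<^sub>M Q. closed (snd w) \<longrightarrow> (*\<^sub>R) (fst w) ` snd w \<in> A \<longrightarrow> w \<in> B"
  shows "emeasure L A \<le> emeasure (R \<Otimes>\<^sub>M Q) B"
proof -
  interpret L: prob_space L by (rule prob_L)
  have "emeasure L (space fell) = 1"
    using L.emeasure_space_1 by (simp add: L)
  then have "emeasure L A = emeasure (R \<Otimes>\<^sub>M Q) ((\<lambda>(r, K). (*\<^sub>R) r ` K) -` A \<inter> space (R \<Otimes>\<^sub>M Q))"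
    using A unfolding L Q_def[symmetric] by (intro emeasure_distr_nonzero) auto
  also have "\<dots> \<le> emeasure (R \<Otimes>\<^sub>M Q) B"
  proof (rule emeasure_mono_AE)
    show "AE w in R \<Otimes>\<^sub>M Q. w \<in> (\<lambda>(r, K). (*\<^sub>R) r ` K) -` A \<inter> space (R \<Otimes>\<^sub>M Q) \<longrightarrow> w \<in> B"
      using AB by eventually_elim (auto simp: space_RQ split_beta)
    show "B \<in> sets (R \<Otimes>\<^sub>M Q)" using B by (simp add: sets_RQ)
  qed
  finally show ?thesis .
qed

lemma AE_grain:
  "AE w in R \<Otimes>\<^sub>M Q. 0 < fst w \<and> cball 0 a\<^sub>1 \<subseteq> snd w \<and> snd w \<subseteq> cball 0 a\<^sub>2 \<or> \<not> closed (snd w)"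
proof -
  interpret RQ: pair_sigma_finite R Q by (rule pair_RQ)
  \<comment> \<open>Open discs suffice, since a closed set that contains an open disc contains its
    closure.\<close>
  define G where "G = {K. closed K \<and> ball 0 a\<^sub>1 \<subseteq> K} \<inter> {K. closed K \<and> K \<subseteq> cball (0::real^2) a\<^sub>2}"
  have G: "G \<in> sets fell" unfolding G_def
    by (intro sets.Int ball_subset_in_sets_fell subset_in_sets_fell closed_cball)
  have ball: "cball 0 a\<^sub>1 \<subseteq> K" if "K \<in> G" for K
    using closure_minimal[of "ball 0 a\<^sub>1" K] that a by (simp add: closure_ball G_def)
  have "AE \<omega> in N. Y \<omega> \<in> G"
    using between AE_space
  proof eventually_elim
    case (elim \<omega>)
    then show ?case using closed_Y[of \<omega>] ball_subset_cball[of "0::real^2" a\<^sub>1] by (auto simp: G_def)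
  qed
  moreover have "{K \<in> space fell. K \<in> G} = G" by (auto simp: G_def)
  ultimately have Q_AE: "AE K in Q. K \<in> G"
    unfolding Q_def using G Y_measurable by (subst AE_distr_iff) simp_all
  have "{0<..} \<times> G \<in> sets (R \<Otimes>\<^sub>M Q)"
    using G by (intro pair_measureI) (auto simp: sets_R sets_Q)
  moreover have "{w \<in> space (R \<Otimes>\<^sub>M Q). 0 < fst w \<and> snd w \<in> G} = {0<..} \<times> G"
    by (auto simp: space_RQ G_def)
  ultimately have meas: "{w \<in> space (R \<Otimes>\<^sub>M Q). 0 < fst w \<and> snd w \<in> G} \<in> sets (R \<Otimes>\<^sub>M Q)" by simp
  have "AE r in R. AE K in Q. 0 < fst (r, K) \<and> snd (r, K) \<in> G"
    using R_pos
  proof eventually_elim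
    case (elim r)
    show ?case using Q_AE by eventually_elim (simp add: elim)
  qed
  then have "AE w in R \<Otimes>\<^sub>M Q. 0 < fst w \<and> snd w \<in> G"
    by (rule RQ.AE_pair_measure[OF meas])
  then show ?thesis
  proof eventually_elim
    case (elim w)
    then show ?case using ball[of "snd w"] by (simp add: G_def)
  qed
qed

text \<open>What is at hand for \<open>L\<close> are upper bounds, so the complement is estimated:
  almost surely, a leaf that fails to cover the ball has size below
  \<open>\<rho> / a\<^sub>1\<close>.\<close>

lemma measure_L_ball_subset_ge:
  assumes \<rho>: "0 < \<rho>"
  shows "measure R {r. \<rho> / a\<^sub>1 \<le> r} \<le> measure L (covering \<rho>)"
proof -
  interpret R: prob_space R by (rule prob_R)
  interpret Q: prob_space Q by (rule prob_Q)
  interpret L: prob_space L by (rule prob_L)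
  let ?G = "covering \<rho>"
  have G: "?G \<in> sets fell" by (rule ball_subset_in_sets_fell)
  have "emeasure L (space fell - ?G) \<le> emeasure (R \<Otimes>\<^sub>M Q) ({..< \<rho> / a\<^sub>1} \<times> space Q)"
  proof (rule emeasure_L_le)
    show "AE w in R \<Otimes>\<^sub>M Q. closed (snd w) \<longrightarrow>
        (*\<^sub>R) (fst w) ` snd w \<in> space fell - ?G \<longrightarrow> w \<in> {..< \<rho> / a\<^sub>1} \<times> space Q"
      using AE_grain
    proof eventually_elim
      case (elim w)
      show ?case
      proof (intro impI)
        assume w: "closed (snd w)" "(*\<^sub>R) (fst w) ` snd w \<in> space fell - ?G"
        then have r: "0 < fst w" "cball 0 a\<^sub>1 \<subseteq> snd w" using elim by auto
        have "fst w < \<rho> / a\<^sub>1"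
        proof (rule ccontr)
          assume "\<not> fst w < \<rho> / a\<^sub>1"
          then have "\<rho> \<le> fst w * a\<^sub>1" using a by (simp add: field_simps)
          have "ball 0 \<rho> \<subseteq> (*\<^sub>R) (fst w) ` snd w"
          proof
            fix v :: "real^2" assume "v \<in> ball 0 \<rho>"
            then have "norm v \<le> fst w * a\<^sub>1" using \<open>\<rho> \<le> fst w * a\<^sub>1\<close> by simp
            then have "norm (v /\<^sub>R fst w) \<le> a\<^sub>1" using r(1) by (simp add: field_simps)
            then have "v /\<^sub>R fst w \<in> snd w" using r(2) by auto
            then show "v \<in> (*\<^sub>R) (fst w) ` snd w" using r(1) by (simp add: mem_scaleR_image_iff)
          qed
          then show False using w by auto
        qed
        then show "w \<in> {..< \<rho> / a\<^sub>1} \<times> space Q" using w(1) by (simp add: mem_Times_iff space_Q)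
      qed
    qed
  qed (use G in \<open>auto intro!: pair_measureI sets.compl_sets simp: space_Q simp del: space_fell, simp add: space_fell[symmetric] del: space_fell\<close>)
  also have "\<dots> = emeasure R {..< \<rho> / a\<^sub>1}"
    by (subst Q.emeasure_pair_measure_Times) (auto simp: sets_R Q.emeasure_space_1)
  finally have "measure L (space fell - ?G) \<le> measure R {..< \<rho> / a\<^sub>1}"
    by (simp add: L.emeasure_eq_measure R.emeasure_eq_measure)
  moreover have "measure L (space fell - ?G) = 1 - measure L ?G"
    using L.prob_compl[of ?G] G sets_eq_imp_space_eq[OF sets_L] by (simp add: sets_L)
  moreover have "measure R {..< \<rho> / a\<^sub>1} = 1 - measure R {r. \<rho> / a\<^sub>1 \<le> r}"
  proof -
    have "space R - {r. \<rho> / a\<^sub>1 \<le> r} = {..< \<rho> / a\<^sub>1}" by (auto simp: space_R)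
    moreover have "{r. \<rho> / a\<^sub>1 \<le> r} \<in> sets R" by (simp add: sets_R)
    ultimately show ?thesis using R.prob_compl by fastforce
  qed
  ultimately show ?thesis by simp
qed

text \<open>A leaf of size \<open>r\<close> placed at \<open>z\<close> meets the unit ball about
  \<open>x\<close> only if \<open>z\<close> is within \<open>1 + a\<^sub>2 * r\<close> of
  \<open>x\<close>. Exchanging the integrals leaves the mean area of a disc of that radius, which is
  finite with the second moment of the size.\<close>

lemma hit_ball_integral_finite:
  assumes fin: "(\<integral>\<^sup>+r. ennreal (r\<^sup>2) \<partial>R) < \<infinity>"
  shows "(\<integral>\<^sup>+z. emeasure L (hitting (x - z)) \<partial>lborel) < \<infinity>"
proof -
  interpret R: prob_space R by (rule prob_R)
  interpret Q: prob_space Q by (rule prob_Q)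
  interpret P: pair_sigma_finite "lborel :: (real^2) measure" R ..
  note [measurable_cong] = sets_R
  let ?D = "{w :: (real^2) \<times> real. dist x (fst w) < 1 + a\<^sub>2 * snd w}"
  have "?D \<in> sets (borel :: ((real^2) \<times> real) measure)"
    by (intro borel_open open_Collect_less continuous_intros)
  then have D: "?D \<in> sets (lborel \<Otimes>\<^sub>M R)"
    unfolding sets_pair_measure_cong[OF sets_lborel sets_R] borel_prod .
  have slice: "{r. dist x z < 1 + a\<^sub>2 * r} \<in> sets borel" for z
    by (intro borel_open open_Collect_less continuous_intros)
  have "emeasure L (hitting (x - z)) \<le> emeasure R {r. dist x z < 1 + a\<^sub>2 * r}" for z
  proof -
    have "emeasure L (hitting (x - z)) \<le>
        emeasure (R \<Otimes>\<^sub>M Q) ({r. dist x z < 1 + a\<^sub>2 * r} \<times> space Q)"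
    proof (rule emeasure_L_le)
      show "AE w in R \<Otimes>\<^sub>M Q. closed (snd w) \<longrightarrow>
          (*\<^sub>R) (fst w) ` snd w \<in> hitting (x - z) \<longrightarrow>
          w \<in> {r. dist x z < 1 + a\<^sub>2 * r} \<times> space Q"
        using AE_grain
      proof eventually_elim
        case (elim w)
        show ?case
        proof (intro impI)
          assume w: "closed (snd w)" "(*\<^sub>R) (fst w) ` snd w \<in> hitting (x - z)"
          then have r: "0 < fst w" "snd w \<subseteq> cball 0 a\<^sub>2" using elim by auto
          have "(*\<^sub>R) (fst w) ` snd w \<inter> ball (x - z) 1 \<noteq> {}" using w(2) by simp
          then obtain v where "v \<in> (*\<^sub>R) (fst w) ` snd w \<inter> ball (x - z) 1"
            unfolding ex_in_conv[symmetric] by (rule exE)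
          then obtain k where k: "k \<in> snd w" "fst w *\<^sub>R k \<in> ball (x - z) 1" by fastforce
          have "norm k \<le> a\<^sub>2" using k(1) r(2) by auto
          then have "norm (fst w *\<^sub>R k) \<le> a\<^sub>2 * fst w" using r(1) by (simp add: mult.commute)
          moreover have "norm (x - z) \<le> dist (x - z) (fst w *\<^sub>R k) + norm (fst w *\<^sub>R k)"
            using norm_triangle_ineq[of "x - z - fst w *\<^sub>R k" "fst w *\<^sub>R k"] by (simp add: dist_norm)
          ultimately have "dist x z < 1 + a\<^sub>2 * fst w"
            using k(2) by (simp add: dist_norm[of x z])
          then show "w \<in> {r. dist x z < 1 + a\<^sub>2 * r} \<times> space Q"
            using w(1) by (simp add: mem_Times_iff space_Q)
        qed
      qed
      show "hitting (x - z) \<in> sets fell" by (intro hit_in_sets_fell open_ball)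
      show "{r. dist x z < 1 + a\<^sub>2 * r} \<times> space Q \<in> sets (borel \<Otimes>\<^sub>M fell)"
        using sets.top[of Q] unfolding sets_Q by (intro pair_measureI slice)
    qed
    also have "\<dots> = emeasure R {r. dist x z < 1 + a\<^sub>2 * r}"
      using slice[of z] by (subst Q.emeasure_pair_measure_Times) (auto simp: sets_R Q.emeasure_space_1)
    finally show ?thesis .
  qed
  then have "(\<integral>\<^sup>+z. emeasure L (hitting (x - z)) \<partial>lborel) \<le>
      (\<integral>\<^sup>+z. emeasure R (Pair z -` ?D) \<partial>lborel)"
    by (intro nn_integral_mono) (simp add: vimage_def)
  also have "\<dots> = (\<integral>\<^sup>+r. emeasure lborel ((\<lambda>z. (z, r)) -` ?D) \<partial>R)"
    using R.emeasure_pair_measure_alt[OF D] P.emeasure_pair_measure_alt2[OF D] by simp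
  also have "\<dots> \<le> (\<integral>\<^sup>+r. ennreal (unit_ball_vol 2 * 2) + ennreal (unit_ball_vol 2 * 2 * a\<^sub>2\<^sup>2) * ennreal (r\<^sup>2) \<partial>R)"
  proof (intro nn_integral_mono_AE)
    show "AE r in R. emeasure lborel ((\<lambda>z. (z, r)) -` ?D) \<le>
        ennreal (unit_ball_vol 2 * 2) + ennreal (unit_ball_vol 2 * 2 * a\<^sub>2\<^sup>2) * ennreal (r\<^sup>2)"
      using R_pos
    proof eventually_elim
      case (elim r)
      have "(\<lambda>z. (z, r)) -` ?D = ball x (1 + a\<^sub>2 * r)" by (auto simp: vimage_def)
      then have "emeasure lborel ((\<lambda>z. (z, r)) -` ?D) = ennreal (unit_ball_vol 2 * (1 + a\<^sub>2 * r)\<^sup>2)"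
        using elim a by (simp add: emeasure_ball)
      also have "\<dots> \<le> ennreal (unit_ball_vol 2 * 2 + unit_ball_vol 2 * 2 * a\<^sub>2\<^sup>2 * r\<^sup>2)"
      proof (intro ennreal_leI)
        have "(1 + a\<^sub>2 * r)\<^sup>2 \<le> 2 + 2 * a\<^sub>2\<^sup>2 * r\<^sup>2"
          using sum_squares_bound[of 1 "a\<^sub>2 * r"] by (simp add: power2_sum power_mult_distrib)
        then have "unit_ball_vol 2 * (1 + a\<^sub>2 * r)\<^sup>2 \<le> unit_ball_vol 2 * (2 + 2 * a\<^sub>2\<^sup>2 * r\<^sup>2)"
          by (intro mult_left_mono) auto
        then show "unit_ball_vol 2 * (1 + a\<^sub>2 * r)\<^sup>2 \<le> unit_ball_vol 2 * 2 + unit_ball_vol 2 * 2 * a\<^sub>2\<^sup>2 * r\<^sup>2"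
          by (simp add: algebra_simps)
      qed
      also have "\<dots> = ennreal (unit_ball_vol 2 * 2) + ennreal (unit_ball_vol 2 * 2 * a\<^sub>2\<^sup>2) * ennreal (r\<^sup>2)"
        by (subst ennreal_plus) (auto simp: ennreal_mult)
      finally show ?case .
    qed
  qed
  also have "\<dots> = ennreal (unit_ball_vol 2 * 2) + ennreal (unit_ball_vol 2 * 2 * a\<^sub>2\<^sup>2) * (\<integral>\<^sup>+r. ennreal (r\<^sup>2) \<partial>R)"
    by (subst nn_integral_add) (auto simp: nn_integral_cmult R.emeasure_space_1)
  also have "\<dots> < \<infinity>" using fin by (simp add: ennreal_mult_less_top)
  finally show ?thesis .
qed

text \<open>For a fixed size \<open>r\<close> and grain \<open>K\<close>, the substitution
  \<open>w = (x - z) / r\<close> turns straddled positions into those of the unscaled grain for the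
  shift \<open>(x - y) / r\<close>, with Jacobian \<open>r\<^sup>2\<close>; averaging over the grain
  then produces the covariogram.\<close>

lemma straddle_integral_le:
  "(\<integral>\<^sup>+z. emeasure L (straddling (x - z) (y - z)) \<partial>lborel) \<le>
   (\<integral>\<^sup>+r. ennreal (r\<^sup>2) *
      ennreal (2 * (covariogram_defect ((x - y) /\<^sub>R r))) \<partial>R)"
proof -
  interpret R: prob_space R by (rule prob_R)
  interpret Q: prob_space Q by (rule prob_Q)
  interpret RQ: pair_prob_space R Q ..
  interpret P: pair_sigma_finite "lborel :: (real^2) measure" "R \<Otimes>\<^sub>M Q" ..
  define S :: "((real^2) \<times> real \<times> (real^2) set) set" where
    "S = {w \<in> space (borel \<Otimes>\<^sub>M (borel \<Otimes>\<^sub>M fell)). 0 < fst (snd w) \<and>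
      straddles ((x - fst w) /\<^sub>R fst (snd w)) ((y - fst w) /\<^sub>R fst (snd w)) (snd (snd w))}"
  have S: "S \<in> sets (borel \<Otimes>\<^sub>M (borel \<Otimes>\<^sub>M fell))"
  proof -
    have [measurable]: "Measurable.pred (borel \<Otimes>\<^sub>M (borel \<Otimes>\<^sub>M fell)) (\<lambda>w :: (real^2) \<times> real \<times> (real^2) set.
        straddles ((x - fst w) /\<^sub>R fst (snd w)) ((y - fst w) /\<^sub>R fst (snd w)) (snd (snd w)))"
      by (rule pred_straddles) measurable
    show ?thesis unfolding S_def by measurable
  qed
  then have S': "S \<in> sets (lborel \<Otimes>\<^sub>M (R \<Otimes>\<^sub>M Q))"
    unfolding sets_pair_measure_cong[OF sets_lborel sets_RQ] .
  have "(\<integral>\<^sup>+z. emeasure L (straddling (x - z) (y - z)) \<partial>lborel) \<le>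
      (\<integral>\<^sup>+z. emeasure (R \<Otimes>\<^sub>M Q) (Pair z -` S) \<partial>lborel)"
  proof (intro nn_integral_mono emeasure_L_le)
    fix z
    have "{F \<in> space fell. straddles (x - z) (y - z) F} \<in> sets fell"
      using pred_straddles[of "\<lambda>_. x - z" fell "\<lambda>_. y - z" "\<lambda>F. F"] by (simp add: pred_def)
    then show "straddling (x - z) (y - z) \<in> sets fell" by simp
    show "Pair z -` S \<in> sets (borel \<Otimes>\<^sub>M fell)" using S by (rule sets_Pair1)
    show "AE w in R \<Otimes>\<^sub>M Q. closed (snd w) \<longrightarrow>
        (*\<^sub>R) (fst w) ` snd w \<in> straddling (x - z) (y - z) \<longrightarrow> w \<in> Pair z -` S"
      using AE_grain
    proof eventually_elim
      case (elim w)
      then show ?case by (auto simp: S_def space_pair_measure straddles_scaleR_iff mem_Times_iff)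
    qed
  qed
  also have "\<dots> = (\<integral>\<^sup>+w. emeasure lborel ((\<lambda>z. (z, w)) -` S) \<partial>(R \<Otimes>\<^sub>M Q))"
    using RQ.P.emeasure_pair_measure_alt[OF S'] P.emeasure_pair_measure_alt2[OF S'] by simp
  also have "\<dots> = (\<integral>\<^sup>+r. \<integral>\<^sup>+K. emeasure lborel ((\<lambda>z. (z, (r, K))) -` S) \<partial>Q \<partial>R)"
    using P.measurable_emeasure_Pair2[OF S'] by (subst Q.nn_integral_fst) auto
  also have "\<dots> \<le> (\<integral>\<^sup>+r. ennreal (r\<^sup>2) *
      ennreal (2 * (covariogram_defect ((x - y) /\<^sub>R r))) \<partial>R)"
  proof (intro nn_integral_mono_AE)
    show "AE r in R. (\<integral>\<^sup>+K. emeasure lborel ((\<lambda>z. (z, (r, K))) -` S) \<partial>Q) \<le> ennreal (r\<^sup>2) *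
        ennreal (2 * (covariogram_defect ((x - y) /\<^sub>R r)))"
      using R_pos
    proof eventually_elim
      case (elim r)
      let ?k = "(x - y) /\<^sub>R r"
      let ?m = "\<lambda>K. ennreal (r\<^sup>2) * emeasure lborel {w. straddles w (w - ?k) K}"
      have slice: "emeasure lborel ((\<lambda>z. (z, (r, K))) -` S) = ?m K" if K: "closed K" for K
      proof -
        have "(\<lambda>z. (z, (r, K))) -` S = {z. straddles ((x - z) /\<^sub>R r) ((x - z) /\<^sub>R r - ?k) K}"
        proof -
          have "(x - z) /\<^sub>R r - ?k = (y - z) /\<^sub>R r" for z by (simp add: scaleR_diff_right[symmetric])
          then show ?thesis using K elim by (auto simp: S_def space_pair_measure)
        qed
        moreover have "{w. straddles w (w - ?k) K} \<in> sets borel"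
        proof -
          have [measurable]: "K \<in> sets borel" "interior K \<in> sets borel" using K by auto
          have "{w \<in> space borel. straddles w (w - ?k) K} \<in> sets borel"
            unfolding straddles_def by measurable
          then show ?thesis by simp
        qed
        ultimately show ?thesis
          using elim emeasure_lborel_reflect_scale[of r "\<lambda>w. straddles w (w - ?k) K" x] by simp
      qed
      have meas: "(\<lambda>K. emeasure lborel ((\<lambda>z. (z, (r, K))) -` S)) \<in> borel_measurable fell"
      proof -
        have "(\<lambda>w. emeasure lborel ((\<lambda>z. (z, w)) -` S)) \<in> borel_measurable (borel \<Otimes>\<^sub>M fell)"
          using P.measurable_emeasure_Pair2[OF S'] measurable_cong_sets[OF sets_RQ refl] by blast
        then show ?thesis by (rule measurable_compose[rotated]) simp
      qed
      have "(\<integral>\<^sup>+K. emeasure lborel ((\<lambda>z. (z, (r, K))) -` S) \<partial>Q) =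
          (\<integral>\<^sup>+\<omega>. emeasure lborel ((\<lambda>z. (z, (r, Y \<omega>))) -` S) \<partial>N)"
        unfolding Q_def by (rule nn_integral_distr[OF Y_measurable]) (simp add: meas)
      also have "\<dots> \<le> (\<integral>\<^sup>+\<omega>. ennreal (r\<^sup>2) * ennreal (2 * (measure lborel (interior (Y \<omega>)) -
          overlap ?k \<omega>)) \<partial>N)"
      proof (intro nn_integral_mono_AE)
        show "AE \<omega> in N. emeasure lborel ((\<lambda>z. (z, (r, Y \<omega>))) -` S) \<le>
            ennreal (r\<^sup>2) * ennreal (2 * (measure lborel (interior (Y \<omega>)) -
              overlap ?k \<omega>))"
          using between frontier_null AE_space
        proof eventually_elim
          case (elim \<omega>)
          have "bounded (Y \<omega>)" using elim bounded_subset[OF bounded_cball] by blast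
          then show ?case
            unfolding slice[OF closed_Y[OF elim(3)]]
            by (intro mult_left_mono emeasure_straddles_le closed_Y elim) auto
        qed
      qed
      also have "\<dots> = ennreal (r\<^sup>2) * (\<integral>\<^sup>+\<omega>. ennreal (2 * (measure lborel (interior (Y \<omega>)) -
          overlap ?k \<omega>)) \<partial>N)"
        using covariogram_integrand_measurable[of ?k] covariogram_integrand_measurable[of 0]
        by (intro nn_integral_cmult) simp
      also have "\<dots> = ennreal (r\<^sup>2) *
          ennreal (2 * (covariogram_defect ?k))"
        by (subst nn_integral_covariogram_defect) simp
      finally show ?case .
    qed
  qed
  finally show ?thesis .
qed

end

section \<open>Growth of the covariogram defect\<close>

context random_grain
begin

lemma covariogram_nonneg: "0 \<le> geometric_covariogram N Y k"
  unfolding geometric_covariogram_def by (intro integral_nonneg_AE) auto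

text \<open>Let \<open>A\<close> be the interior of the grain, \<open>B\<close> and \<open>C\<close>
  its translates by \<open>y\<close> and \<open>y + z\<close>. Both \<open>A \<inter> B\<close> and
  \<open>B \<inter> C\<close> lie in \<open>B\<close> and they meet inside
  \<open>A \<inter> C\<close>, so their areas add up to at most the areas of \<open>B\<close> and
  \<open>A \<inter> C\<close> together. In the mean this is a triangle inequality for the
  defect.\<close>

lemma covariogram_defect_subadditive:
  "covariogram_defect (y + z) \<le> covariogram_defect y + covariogram_defect z"
proof -
  let ?m = "\<lambda>k \<omega>. overlap k \<omega>"
  have "AE \<omega> in N. ?m y \<omega> + ?m z \<omega> \<le> ?m 0 \<omega> + ?m (y + z) \<omega>"
    using between
  proof eventually_elim
    case (elim \<omega>)
    define A where "A = interior (Y \<omega>)"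
    define B where "B = (+) y ` A"
    define C where "C = (+) (y + z) ` A"
    have op: "open A" "open B" "open C"
      unfolding A_def B_def C_def by (auto intro: open_translation)
    have "bounded A"
      using elim bounded_subset[OF bounded_cball] bounded_interior unfolding A_def by blast
    then have bd: "bounded A" "bounded B" "bounded C"
      unfolding B_def C_def by (auto intro: bounded_translation)
    have fm: "P \<in> fmeasurable lborel" if "open P" "bounded P" for P :: "(real^2) set"
      using that emeasure_bounded_finite[of P] by (intro fmeasurableI) auto
    have trans: "measure lborel ((+) y ` P) = measure lborel P" if "open P" for P :: "(real^2) set"
    proof -
      have "measure lebesgue ((+) y ` P) = measure lebesgue P" by (rule measure_translation)
      then show ?thesis using that open_translation[OF that, of y] by (simp add: measure_completion)
    qed
    have fmI: "A \<inter> B \<in> fmeasurable lborel" "B \<inter> C \<in> fmeasurable lborel" "A \<inter> C \<in> fmeasurable lborel"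
      using op bd by (auto intro!: fm open_Int bounded_Int)
    have BC: "B \<inter> C = (+) y ` (A \<inter> (+) z ` A)"
      unfolding B_def C_def set_eq_iff Int_iff mem_translation_iff by (simp add: diff_diff_eq)
    have "measure lborel (A \<inter> B) + measure lborel (B \<inter> C) =
        measure lborel ((A \<inter> B) \<union> (B \<inter> C)) + measure lborel ((A \<inter> B) \<inter> (B \<inter> C))"
      using measure_Un3[OF fmI(1,2)] by simp
    also have "\<dots> \<le> measure lborel B + measure lborel (A \<inter> C)"
      using op fm[OF op(2) bd(2)] fmI(3)
      by (intro add_mono measure_mono_fmeasurable) auto
    also have "measure lborel B = measure lborel A" unfolding B_def by (rule trans[OF op(1)])
    also have "measure lborel (B \<inter> C) = measure lborel (A \<inter> (+) z ` A)"
      unfolding BC using op(1) by (intro trans open_Int open_translation)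
    finally show ?case by (simp add: A_def B_def C_def)
  qed
  moreover have int0: "integrable N (\<lambda>\<omega>. measure lborel (interior (Y \<omega>)))"
    using covariogram_integrable[of 0] by simp
  ultimately have "(\<integral>\<omega>. ?m y \<omega> + ?m z \<omega> \<partial>N) \<le> (\<integral>\<omega>. ?m 0 \<omega> + ?m (y + z) \<omega> \<partial>N)"
    using covariogram_integrable by (intro integral_mono_AE integrable_add) auto
  then show ?thesis
    using covariogram_integrable int0 unfolding geometric_covariogram_def
    by (subst (asm) (1 2) Bochner_Integration.integral_add) auto
qed

lemma covariogram_defect_multiple:
  "covariogram_defect (real n *\<^sub>R k) \<le>
   real n * (covariogram_defect k)"
proof (induction n)
  case (Suc n)
  have "real (Suc n) *\<^sub>R k = k + real n *\<^sub>R k" by (simp add: scaleR_left_distrib)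
  then show ?case
    using covariogram_defect_subadditive[of k "real n *\<^sub>R k"] Suc by (simp add: algebra_simps)
qed simp

text \<open>
  Subadditivity bounds the defect at \<open>k\<close> by \<open>n\<close> times the defect at \<open>k / n\<close>, so the directional
  derivatives at \<open>0\<close> control it globally.
\<close>

lemma covariogram_defect_le_linear:
  assumes "condition_A2 N Y"
  obtains C where "0 \<le> C" "\<And>k. covariogram_defect k \<le> C * norm k"
proof -
  let ?\<gamma> = "geometric_covariogram N Y"
  obtain c C where cC: "0 < c" "\<And>u. norm u = 1 \<Longrightarrow> \<exists>d. ((\<lambda>x. ?\<gamma> (x *\<^sub>R u)) has_real_derivative d) (at_right 0) \<and>
      c \<le> \<bar>d\<bar> \<and> \<bar>d\<bar> \<le> C"
    using assms unfolding condition_A2_def by blast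
  have le: "?\<gamma> 0 - ?\<gamma> k \<le> max 0 C * norm k" for k
  proof (cases "k = 0")
    case False
    define u where "u = k /\<^sub>R norm k"
    have "norm u = 1" using False by (simp add: u_def)
    then obtain d where d: "((\<lambda>x. ?\<gamma> (x *\<^sub>R u)) has_real_derivative d) (at_right 0)" "\<bar>d\<bar> \<le> C"
      using cC(2) by blast
    then have "((\<lambda>x. (?\<gamma> (x *\<^sub>R u) - ?\<gamma> 0) / x) \<longlongrightarrow> d) (at_right 0)"
      by (simp add: has_field_derivative_iff)
    moreover have "filterlim (\<lambda>n. norm k / real (Suc n)) (at_right 0) sequentially"
    proof (rule tendsto_imp_filterlim_at_right)
      show "(\<lambda>n. norm k / real (Suc n)) \<longlonglongrightarrow> 0"
        using LIMSEQ_Suc[OF lim_const_over_n[of "norm k"]] by simp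
      show "eventually (\<lambda>n. norm k / real (Suc n) > 0) sequentially" using False by simp
    qed
    ultimately have "(\<lambda>n. (?\<gamma> ((norm k / real (Suc n)) *\<^sub>R u) - ?\<gamma> 0) / (norm k / real (Suc n))) \<longlonglongrightarrow> d"
      by (rule filterlim_compose)
    then have "(\<lambda>n. - norm k * ((?\<gamma> ((norm k / real (Suc n)) *\<^sub>R u) - ?\<gamma> 0) / (norm k / real (Suc n)))) \<longlonglongrightarrow> - norm k * d"
      by (intro tendsto_mult tendsto_const)
    moreover have "- norm k * ((?\<gamma> ((norm k / real (Suc n)) *\<^sub>R u) - ?\<gamma> 0) / (norm k / real (Suc n))) \<ge> ?\<gamma> 0 - ?\<gamma> k" for n
    proof -
      have ku: "(norm k / real (Suc n)) *\<^sub>R u = k /\<^sub>R real (Suc n)"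
        using False by (simp add: u_def divide_inverse mult.commute)
      have "?\<gamma> 0 - ?\<gamma> (real (Suc n) *\<^sub>R (k /\<^sub>R real (Suc n))) \<le> real (Suc n) * (?\<gamma> 0 - ?\<gamma> (k /\<^sub>R real (Suc n)))"
        by (rule covariogram_defect_multiple)
      moreover have "real (Suc n) *\<^sub>R (k /\<^sub>R real (Suc n)) = k" by simp
      moreover have "- norm k * ((?\<gamma> ((norm k / real (Suc n)) *\<^sub>R u) - ?\<gamma> 0) / (norm k / real (Suc n))) =
          real (Suc n) * (?\<gamma> 0 - ?\<gamma> (k /\<^sub>R real (Suc n)))"
        unfolding ku using False by (simp add: field_simps)
      ultimately show ?thesis by simp
    qed
    ultimately have "?\<gamma> 0 - ?\<gamma> k \<le> - norm k * d" by (intro LIMSEQ_le_const) auto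
    also have "\<dots> \<le> norm k * max 0 C" using d(2) mult_left_mono[of "- d" "max 0 C" "norm k"] by simp
    finally show ?thesis by (simp add: mult.commute)
  qed simp
  show thesis by (rule that[OF _ le]) simp
qed

text \<open>Near 0 the bound is (A-3) with \<open>\<delta> = 1 - \<beta>\<close>. At distance at
  least \<open>e\<close> the defect is at most the covariogram at 0, and
  \<open>norm k powr \<beta>\<close> is at least \<open>e powr \<beta>\<close>, which gives the
  second candidate for \<open>C\<close>.\<close>

lemma covariogram_defect_le_powr:
  assumes A3: "condition_A3 N Y" and \<beta>: "0 < \<beta>" "\<beta> < 1"
  obtains C where "0 \<le> C" "\<And>k. covariogram_defect k \<le> C * norm k powr \<beta>"
proof -
  let ?\<gamma> = "geometric_covariogram N Y"
  have "(\<lambda>x. ?\<gamma> x - ?\<gamma> 0) \<in> o[at 0](\<lambda>x. norm x powr (1 - (1 - \<beta>)))"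
    using A3 \<beta> unfolding condition_A3_def by (metis diff_gt_0_iff_gt)
  then have "(\<lambda>x. ?\<gamma> x - ?\<gamma> 0) \<in> o[at 0](\<lambda>x. norm x powr \<beta>)" by simp
  from landau_o.smallD[OF this, of 1] have "eventually (\<lambda>x. norm (?\<gamma> x - ?\<gamma> 0) \<le> 1 * norm (norm x powr \<beta>)) (at 0)"
    by simp
  then obtain e where e: "e > 0" "\<And>x. x \<noteq> 0 \<Longrightarrow> dist x 0 < e \<Longrightarrow> norm (?\<gamma> x - ?\<gamma> 0) \<le> norm x powr \<beta>"
    unfolding eventually_at by auto
  define C where "C = max 1 (?\<gamma> 0 / e powr \<beta>)"
  have "?\<gamma> 0 - ?\<gamma> k \<le> C * norm k powr \<beta>" for k
  proof -
    consider "k = 0" | "k \<noteq> 0" "norm k < e" | "norm k \<ge> e" by linarith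
    then show ?thesis
    proof cases
      case 1
      then show ?thesis by simp
    next
      case 2
      then have "?\<gamma> 0 - ?\<gamma> k \<le> 1 * norm k powr \<beta>" using e(2)[of k] by simp
      also have "\<dots> \<le> C * norm k powr \<beta>" by (intro mult_right_mono) (auto simp: C_def)
      finally show ?thesis .
    next
      case 3
      have "?\<gamma> 0 - ?\<gamma> k \<le> ?\<gamma> 0 / e powr \<beta> * e powr \<beta>"
        using covariogram_nonneg[of k] e(1) by simp
      also have "\<dots> \<le> C * norm k powr \<beta>"
        using 3 e(1) \<beta> by (intro mult_mono powr_mono2) (auto simp: C_def)
      finally show ?thesis .
    qed
  qed
  then show thesis by (intro that[of C]) (auto simp: C_def)
qed

end

section \<open>Bounds on the colors and on the probability that two points differ\<close>

lemma AE_color_unit: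
  assumes U: "U \<in> measurable M lborel" "distr M lborel U = uniform_measure lborel {0<..<1::real}"
  shows "AE \<omega> in M. 0 < U \<omega> \<and> U \<omega> < 1"
proof -
  have "AE u in uniform_measure lborel {0<..<1::real}. u \<in> {0<..<1}"
    by (rule AE_uniform_measureI) auto
  then have "AE u in distr M lborel U. u \<in> {0<..<1}" by (simp only: U(2))
  then show ?thesis using AE_distrD[OF U(1)] by fastforce
qed

lemma colored_field_bounds:
  assumes "\<And>i. 0 < U i \<and> U i < 1"
  shows "0 \<le> colored_field z X U y \<and> colored_field z X U y \<le> 1"
  using assms by (auto simp: colored_field_def less_imp_le)

lemma colored_dead_leaves_prob_space: "colored_dead_leaves M L I \<Longrightarrow> prob_space M"
  unfolding colored_dead_leaves_def dead_leaves_model_def by (elim exE conjE)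

lemma colored_dead_leaves_bounds:
  assumes "colored_dead_leaves M L I"
  shows "AE \<omega> in M. \<forall>y. 0 \<le> I \<omega> y \<and> I \<omega> y \<le> 1"
proof -
  interpret prob_space M by (rule colored_dead_leaves_prob_space[OF assms])
  obtain Z X U where U: "indep_vars (\<lambda>_. borel) U UNIV"
      "\<And>i. distr M lborel (U i) = uniform_measure lborel {0<..<1::real}"
    and I: "\<forall>\<omega>\<in>space M. \<forall>y. I \<omega> y = colored_field (\<lambda>i. Z i \<omega>) (\<lambda>i. X i \<omega>) (\<lambda>i. U i \<omega>) y"
    using assms unfolding colored_dead_leaves_def by blast
  have Um: "U i \<in> measurable M lborel" for i
    using U(1) by (simp add: indep_vars_def)
  have "AE \<omega> in M. \<forall>i. 0 < U i \<omega> \<and> U i \<omega> < 1"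
    unfolding AE_all_countable by (intro allI AE_color_unit Um U(2))
  then show ?thesis using AE_space
  proof eventually_elim
    case (elim \<omega>)
    show ?case
    proof
      fix y
      have "I \<omega> y = colored_field (\<lambda>i. Z i \<omega>) (\<lambda>i. X i \<omega>) (\<lambda>i. U i \<omega>) y"
        using I elim(2) by blast
      then show "0 \<le> I \<omega> y \<and> I \<omega> y \<le> 1"
        using colored_field_bounds[of "\<lambda>i. U i \<omega>"] elim(1) by simp
    qed
  qed
qed

text \<open>The set of outcomes where the two values differ need not be an event; \<open>E\<close>
  is any measurable set that contains it up to a null set.\<close>

abbreviation differ_prob_le :: "'w measure \<Rightarrow> ('w \<Rightarrow> 'a \<Rightarrow> real) \<Rightarrow> 'a \<Rightarrow> 'a \<Rightarrow> real \<Rightarrow> bool" where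
  "differ_prob_le M I x y c \<equiv> \<exists>E\<in>sets M. emeasure M E \<le> ennreal c \<and>
    (AE \<omega> in M. \<omega> \<notin> E \<longrightarrow> I \<omega> x = I \<omega> y)"

text \<open>With the ball radius \<open>a\<^sub>1 * s\<close>, almost every leaf of size at least
  \<open>s\<close> is a covering one. The factor \<open>4 * C\<close> combines the 2 of the time
  slots with the \<open>2 * C\<close> of the straddled area; there \<open>r\<^sup>2\<close> and the
  bound on the defect at \<open>(x - y) / r\<close> combine to
  \<open>r powr (2 - \<beta>)\<close>.\<close>

lemma (in scaled_grain) colored_dead_leaves_discrepancy:
  assumes I: "colored_dead_leaves M L I"
    and C: "0 \<le> C" "\<And>k. covariogram_defect k \<le> C * norm k powr \<beta>"
    and fin: "(\<integral>\<^sup>+r. ennreal (r\<^sup>2) \<partial>R) < \<infinity>"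
    and s: "0 < s" "0 < measure R {r. s \<le> r}"
    and K: "ennreal (4 * C) * (\<integral>\<^sup>+r. ennreal (r powr (2 - \<beta>)) \<partial>R) \<le>
      ennreal (K * (measure R {r. s \<le> r} * measure lborel (ball (0::real^2) (a\<^sub>1 * s))))"
  shows "differ_prob_le M I x y (K * norm (x - y) powr \<beta>)"
proof -
  obtain Z X U where model: "dead_leaves_model M L Z X"
    and I_eq: "\<forall>\<omega>\<in>space M. \<forall>y. I \<omega> y = colored_field (\<lambda>i. Z i \<omega>) (\<lambda>i. X i \<omega>) (\<lambda>i. U i \<omega>) y"
    using I unfolding colored_dead_leaves_def by blast
  interpret D: dead_leaves M L Z X by unfold_locales (rule model)
  define p v where "p = measure R {r. s \<le> r}" and "v = measure lborel (ball (0::real^2) (a\<^sub>1 * s))"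
  define q where "q = measure L (covering (a\<^sub>1 * s))"
  have as: "0 < a\<^sub>1 * s" using a s by simp
  have pq: "p \<le> q"
    using measure_L_ball_subset_ge[OF as] a by (simp add: p_def q_def)
  have p: "0 < p" using s by (simp add: p_def)
  have v: "0 < v" using as by (simp add: v_def content_ball_pos)
  obtain E where E: "E \<in> sets M"
    "emeasure M E \<le> ennreal (2 / (q * v)) *
      (\<integral>\<^sup>+z. emeasure L (straddling (x - z) (y - z)) \<partial>lborel)"
    "AE \<omega> in M. \<omega> \<notin> E \<longrightarrow> (\<forall>U. colored_field (\<lambda>i. Z i \<omega>) (\<lambda>i. X i \<omega>) U x =
       colored_field (\<lambda>i. Z i \<omega>) (\<lambda>i. X i \<omega>) U y)"
    using D.color_discrepancy[OF as _ hit_ball_integral_finite[OF fin], of x y] pq p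
    unfolding q_def v_def by auto
  let ?J = "\<integral>\<^sup>+r. ennreal (r powr (2 - \<beta>)) \<partial>R"
  have "(\<integral>\<^sup>+z. emeasure L (straddling (x - z) (y - z)) \<partial>lborel) \<le>
      (\<integral>\<^sup>+r. ennreal (r\<^sup>2) *
        ennreal (2 * (covariogram_defect ((x - y) /\<^sub>R r))) \<partial>R)"
    by (rule straddle_integral_le)
  also have "\<dots> \<le> (\<integral>\<^sup>+r. ennreal (2 * C * norm (x - y) powr \<beta>) * ennreal (r powr (2 - \<beta>)) \<partial>R)"
  proof (intro nn_integral_mono_AE)
    show "AE r in R. ennreal (r\<^sup>2) *
        ennreal (2 * (covariogram_defect ((x - y) /\<^sub>R r))) \<le>
        ennreal (2 * C * norm (x - y) powr \<beta>) * ennreal (r powr (2 - \<beta>))"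
      using R_pos
    proof eventually_elim
      case (elim r)
      have "2 * (covariogram_defect ((x - y) /\<^sub>R r)) \<le>
          2 * (C * norm ((x - y) /\<^sub>R r) powr \<beta>)"
        by (rule mult_left_mono[OF C(2)]) simp
      also have "norm ((x - y) /\<^sub>R r) powr \<beta> = norm (x - y) powr \<beta> * r powr (- \<beta>)"
      proof -
        have "norm ((x - y) /\<^sub>R r) = norm (x - y) / r" using elim by (simp add: divide_inverse mult.commute)
        then show ?thesis using elim by (simp add: powr_divide powr_minus_divide)
      qed
      finally have "ennreal (r\<^sup>2) *
          ennreal (2 * (covariogram_defect ((x - y) /\<^sub>R r))) \<le>
          ennreal (r\<^sup>2) * ennreal (2 * (C * (norm (x - y) powr \<beta> * r powr (- \<beta>))))"
        by (intro mult_left_mono ennreal_leI) auto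
      also have "\<dots> = ennreal (2 * C * norm (x - y) powr \<beta> * (r\<^sup>2 * r powr (- \<beta>)))"
        using C(1) elim by (simp add: ennreal_mult[symmetric] mult_ac)
      also have "r\<^sup>2 * r powr (- \<beta>) = r powr (2 - \<beta>)"
        using elim powr_add[of r 2 "- \<beta>"] by simp
      finally show ?case using C(1) by (simp add: ennreal_mult)
    qed
  qed
  also have "\<dots> = ennreal (2 * C * norm (x - y) powr \<beta>) * ?J"
  proof -
    note [measurable_cong] = sets_R
    show ?thesis by (rule nn_integral_cmult) measurable
  qed
  finally have "emeasure M E \<le> ennreal (2 / (q * v)) * (ennreal (2 * C * norm (x - y) powr \<beta>) * ?J)"
    using E(2) by (meson mult_left_mono order_trans zero_le)
  also have "\<dots> \<le> ennreal (2 / (p * v)) * (ennreal (2 * C * norm (x - y) powr \<beta>) * ?J)"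
    using pq p v by (intro mult_right_mono ennreal_leI divide_left_mono) auto
  also have "\<dots> = ennreal (norm (x - y) powr \<beta> / (p * v)) * (ennreal (4 * C) * ?J)"
    using p v C(1) by (simp add: ennreal_mult[symmetric] mult.assoc[symmetric])
       (simp add: mult_ac)
  also have "\<dots> \<le> ennreal (norm (x - y) powr \<beta> / (p * v)) * ennreal (K * (p * v))"
    using K by (intro mult_left_mono) (auto simp: p_def v_def)
  also have "\<dots> = ennreal (norm (x - y) powr \<beta> / (p * v) * (K * (p * v)))"
    using p v by (intro ennreal_mult'[symmetric]) auto
  also have "norm (x - y) powr \<beta> / (p * v) * (K * (p * v)) = K * norm (x - y) powr \<beta>"
    using p v by (simp add: field_simps)
  finally have "emeasure M E \<le> ennreal (K * norm (x - y) powr \<beta>)" .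
  moreover have "AE \<omega> in M. \<omega> \<notin> E \<longrightarrow> I \<omega> x = I \<omega> y"
    using E(3) AE_space by eventually_elim (simp add: I_eq)
  ultimately show ?thesis using E(1) by blast
qed

section \<open>Integrals of powers and moments of the size law\<close>

lemma nn_integral_powr_tail:
  fixes e a :: real
  assumes "e < -1" "0 < a"
  shows "(\<integral>\<^sup>+r. ennreal (r powr e) * indicator {a..} r \<partial>lborel) < \<infinity>"
proof -
  have "(\<integral>\<^sup>+r. ennreal (indicator {a..} r * r powr e) \<partial>lborel) = ennreal (-(a powr (e+1)) / (e+1))"
    by (rule nn_integral_has_integral_lebesgue[OF _ has_integral_powr_to_inf[OF assms]]) simp
  moreover have "ennreal (indicator {a..} r * r powr e) = ennreal (r powr e) * indicator {a..} r" for r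
    by (simp add: indicator_def)
  ultimately show ?thesis by simp
qed

lemma nn_integral_powr_from_zero:
  fixes e c :: real
  assumes "-1 < e" "0 \<le> c"
  shows "(\<integral>\<^sup>+r. ennreal (r powr e) * indicator {0..c} r \<partial>lborel) = ennreal (c powr (e+1) / (e+1))"
proof -
  have "(\<integral>\<^sup>+r. ennreal (indicator {0..c} r * r powr e) \<partial>lborel) = ennreal (c powr (e+1) / (e+1))"
    by (rule nn_integral_has_integral_lebesgue[OF _ has_integral_powr_from_0[OF assms]]) simp
  moreover have "ennreal (indicator {0..c} r * r powr e) = ennreal (r powr e) * indicator {0..c} r" for r
    by (simp add: indicator_def)
  ultimately show ?thesis by simp
qed

abbreviation size_weight :: "real \<Rightarrow> real \<Rightarrow> ereal \<Rightarrow> real \<Rightarrow> ennreal" where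
  "size_weight \<alpha> r\<^sub>0 r\<^sub>1 r \<equiv> ennreal (r powr (- \<alpha>)) * indicator {r. r\<^sub>0 \<le> r \<and> ereal r \<le> r\<^sub>1} r"

lemma sets_size_law: "sets (size_law \<alpha> r\<^sub>0 r\<^sub>1) = sets borel"
  by (simp add: size_law_def Let_def)

text \<open>The normalising constant \<open>i\<close> is finite because
  \<open>r powr (- \<alpha>)\<close> is integrable at infinity for \<open>\<alpha> > 1\<close>, and
  positive because the sizes fill an interval \<open>{r\<^sub>0..b}\<close> of positive length;
  \<open>b\<close> is a finite stand-in for \<open>r\<^sub>1\<close>, which may be infinite.\<close>

lemma nn_integral_size_law:
  assumes r: "0 < r\<^sub>0" "ereal r\<^sub>0 < r\<^sub>1" and \<alpha>: "1 < \<alpha>"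
  obtains i where "0 < i"
    "(\<integral>\<^sup>+r. size_weight \<alpha> r\<^sub>0 r\<^sub>1 r \<partial>lborel) = ennreal i"
    "\<And>f. f \<in> borel_measurable borel \<Longrightarrow> (\<integral>\<^sup>+r. f r \<partial>size_law \<alpha> r\<^sub>0 r\<^sub>1) =
      ennreal (1 / i) * (\<integral>\<^sup>+r. f r * size_weight \<alpha> r\<^sub>0 r\<^sub>1 r \<partial>lborel)"
proof -
  define g where "g r = size_weight \<alpha> r\<^sub>0 r\<^sub>1 r" for r
  have g [measurable]: "g \<in> borel_measurable borel" unfolding g_def by measurable
  define T where "T = (\<integral>\<^sup>+r. g r \<partial>lborel)"
  have "T \<le> (\<integral>\<^sup>+r. ennreal (r powr (- \<alpha>)) * indicator {r\<^sub>0..} r \<partial>lborel)"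
    unfolding T_def by (intro nn_integral_mono) (auto simp: g_def indicator_def)
  also have "\<dots> < \<infinity>" using r \<alpha> by (intro nn_integral_powr_tail) auto
  finally have T_fin: "T < \<infinity>" .
  obtain b where b: "r\<^sub>0 < b" "ereal b \<le> r\<^sub>1"
    using ereal_dense2[OF r(2)] by (metis less_ereal.simps(1) less_imp_le)
  have "ennreal (b powr (- \<alpha>) * (b - r\<^sub>0)) = (\<integral>\<^sup>+r. ennreal (b powr (- \<alpha>)) * indicator {r\<^sub>0..b} r \<partial>lborel)"
    using b by (simp add: nn_integral_cmult_indicator ennreal_mult)
  also have "\<dots> \<le> T"
    unfolding T_def
  proof (intro nn_integral_mono)
    fix x
    show "ennreal (b powr (- \<alpha>)) * indicator {r\<^sub>0..b} x \<le> g x"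
    proof (cases "x \<in> {r\<^sub>0..b}")
      case True
      have "b powr (- \<alpha>) \<le> x powr (- \<alpha>)" using True r \<alpha> by (intro powr_mono2') auto
      moreover have "ereal x \<le> r\<^sub>1" using True b(2) by (meson atLeastAtMost_iff ereal_less_eq(3) order_trans)
      ultimately show ?thesis using True by (simp add: g_def ennreal_leI)
    qed simp
  qed
  finally have "0 < b powr (- \<alpha>) * (b - r\<^sub>0)" "ennreal (b powr (- \<alpha>) * (b - r\<^sub>0)) \<le> T"
    using b r by auto
  then have T_pos: "0 < T" using ennreal_less_zero_iff less_le_trans by blast
  define i where "i = enn2real T"
  have i: "0 < i" "T = ennreal i" using T_pos T_fin by (auto simp: i_def enn2real_positive_iff)
  have law: "size_law \<alpha> r\<^sub>0 r\<^sub>1 = density lborel (\<lambda>r. g r * ennreal (1 / i))"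
    unfolding size_law_def Let_def g_def[symmetric] T_def[symmetric] i(2)
    using i(1) by (simp add: divide_ennreal_def inverse_ennreal inverse_eq_divide)
  show thesis
  proof (rule that[OF i(1)])
    show "(\<integral>\<^sup>+r. size_weight \<alpha> r\<^sub>0 r\<^sub>1 r \<partial>lborel) = ennreal i"
      using i(2) by (simp add: T_def g_def)
    fix f :: "real \<Rightarrow> ennreal" assume [measurable]: "f \<in> borel_measurable borel"
    have "(\<integral>\<^sup>+r. f r \<partial>size_law \<alpha> r\<^sub>0 r\<^sub>1) = (\<integral>\<^sup>+r. ennreal (1 / i) * (f r * g r) \<partial>lborel)"
      unfolding law by (subst nn_integral_density) (auto simp: mult_ac)
    also have "\<dots> = ennreal (1 / i) * (\<integral>\<^sup>+r. f r * g r \<partial>lborel)" by (rule nn_integral_cmult) simp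
    finally show "(\<integral>\<^sup>+r. f r \<partial>size_law \<alpha> r\<^sub>0 r\<^sub>1) = ennreal (1 / i) *
        (\<integral>\<^sup>+r. f r * size_weight \<alpha> r\<^sub>0 r\<^sub>1 r \<partial>lborel)"
      by (simp add: g_def)
  qed
qed

lemma prob_space_size_law:
  assumes "0 < r\<^sub>0" "ereal r\<^sub>0 < r\<^sub>1" "1 < \<alpha>"
  shows "prob_space (size_law \<alpha> r\<^sub>0 r\<^sub>1)"
proof
  obtain i where i: "0 < i"
    "(\<integral>\<^sup>+r. size_weight \<alpha> r\<^sub>0 r\<^sub>1 r \<partial>lborel) = ennreal i"
    "\<And>f. f \<in> borel_measurable borel \<Longrightarrow> (\<integral>\<^sup>+r. f r \<partial>size_law \<alpha> r\<^sub>0 r\<^sub>1) =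
      ennreal (1 / i) * (\<integral>\<^sup>+r. f r * size_weight \<alpha> r\<^sub>0 r\<^sub>1 r \<partial>lborel)"
    using nn_integral_size_law[OF assms] by blast
  have "emeasure (size_law \<alpha> r\<^sub>0 r\<^sub>1) (space (size_law \<alpha> r\<^sub>0 r\<^sub>1)) = (\<integral>\<^sup>+r. 1 \<partial>size_law \<alpha> r\<^sub>0 r\<^sub>1)" by simp
  also have "\<dots> = ennreal (1 / i) * ennreal i" by (subst i(3)) (simp_all add: i(2))
  also have "\<dots> = 1" using i(1) by (simp add: ennreal_mult[symmetric])
  finally show "emeasure (size_law \<alpha> r\<^sub>0 r\<^sub>1) (space (size_law \<alpha> r\<^sub>0 r\<^sub>1)) = 1" .
qed

lemma AE_size_law: "AE r in size_law \<alpha> r\<^sub>0 r\<^sub>1. r\<^sub>0 \<le> r \<and> ereal r \<le> r\<^sub>1"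
  unfolding size_law_def Let_def
  by (subst AE_density) (auto intro!: AE_I2 simp: indicator_def divide_ennreal_def split: if_splits)

text \<open>That the leaf law has mass 1 is read off from the model, in which it is the law of a
  mark, and not from measurability of the scaling map.\<close>

lemma (in random_grain) scaled_grain_size_law:
  assumes "0 < r\<^sub>0" "ereal r\<^sub>0 < r\<^sub>1" "1 < \<alpha>" and I: "colored_dead_leaves M (leaf_law N Y \<alpha> r\<^sub>0 r\<^sub>1) I"
  shows "scaled_grain N Y a\<^sub>1 a\<^sub>2 (size_law \<alpha> r\<^sub>0 r\<^sub>1) (leaf_law N Y \<alpha> r\<^sub>0 r\<^sub>1)"
proof (rule scaled_grain.intro[OF random_grain_axioms scaled_grain_axioms.intro])
  show "prob_space (size_law \<alpha> r\<^sub>0 r\<^sub>1)" by (rule prob_space_size_law[OF assms(1-3)])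
  show "sets (size_law \<alpha> r\<^sub>0 r\<^sub>1) = sets borel" by (rule sets_size_law)
  show "AE r in size_law \<alpha> r\<^sub>0 r\<^sub>1. 0 < r"
    using AE_size_law[of r\<^sub>0 r\<^sub>1 \<alpha>] by eventually_elim (use assms(1) in auto)
  show "leaf_law N Y \<alpha> r\<^sub>0 r\<^sub>1 =
      distr (size_law \<alpha> r\<^sub>0 r\<^sub>1 \<Otimes>\<^sub>M distr N fell Y) fell (\<lambda>(r, K). (\<lambda>x. r *\<^sub>R x) ` K)"
    by (rule leaf_law_def)
  obtain Z X where "dead_leaves_model M (leaf_law N Y \<alpha> r\<^sub>0 r\<^sub>1) Z X"
    using I unfolding colored_dead_leaves_def by blast
  then interpret D: dead_leaves M "leaf_law N Y \<alpha> r\<^sub>0 r\<^sub>1" Z X by unfold_locales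
  show "prob_space (leaf_law N Y \<alpha> r\<^sub>0 r\<^sub>1)" by (rule D.prob_space_L)
qed

lemma nn_integral_square_size_law_bounded:
  assumes "0 < r\<^sub>0" "ereal r\<^sub>0 < ereal r\<^sub>1" "1 < \<alpha>"
  shows "(\<integral>\<^sup>+r. ennreal (r\<^sup>2) \<partial>size_law \<alpha> r\<^sub>0 (ereal r\<^sub>1)) < \<infinity>"
proof -
  interpret prob_space "size_law \<alpha> r\<^sub>0 (ereal r\<^sub>1)" by (rule prob_space_size_law[OF assms])
  have "(\<integral>\<^sup>+r. ennreal (r\<^sup>2) \<partial>size_law \<alpha> r\<^sub>0 (ereal r\<^sub>1)) \<le> (\<integral>\<^sup>+r. ennreal (r\<^sub>1\<^sup>2) \<partial>size_law \<alpha> r\<^sub>0 (ereal r\<^sub>1))"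
  proof (rule nn_integral_mono_AE)
    show "AE r in size_law \<alpha> r\<^sub>0 (ereal r\<^sub>1). ennreal (r\<^sup>2) \<le> ennreal (r\<^sub>1\<^sup>2)"
      using AE_size_law[of r\<^sub>0 "ereal r\<^sub>1" \<alpha>]
      by eventually_elim (use assms(1) in \<open>auto intro!: ennreal_leI power_mono\<close>)
  qed
  also have "\<dots> < \<infinity>" by (simp add: emeasure_space_1)
  finally show ?thesis .
qed

lemma nn_integral_square_size_law_unbounded:
  assumes r: "0 < r\<^sub>0" "ereal r\<^sub>0 < r\<^sub>1" and \<alpha>: "3 < \<alpha>"
  shows "(\<integral>\<^sup>+r. ennreal (r\<^sup>2) \<partial>size_law \<alpha> r\<^sub>0 r\<^sub>1) < \<infinity>"
proof -
  have "1 < \<alpha>" using \<alpha> by simp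
  from nn_integral_size_law[OF r this] obtain i where i: "0 < i"
    "\<And>f. f \<in> borel_measurable borel \<Longrightarrow> (\<integral>\<^sup>+r. f r \<partial>size_law \<alpha> r\<^sub>0 r\<^sub>1) =
      ennreal (1 / i) * (\<integral>\<^sup>+r. f r * size_weight \<alpha> r\<^sub>0 r\<^sub>1 r \<partial>lborel)"
    by blast
  have "(\<integral>\<^sup>+r. ennreal (r\<^sup>2) * size_weight \<alpha> r\<^sub>0 r\<^sub>1 r \<partial>lborel) \<le>
      (\<integral>\<^sup>+r. ennreal (r powr (2 - \<alpha>)) * indicator {r\<^sub>0..} r \<partial>lborel)"
  proof (intro nn_integral_mono)
    fix r
    have "r\<^sup>2 * r powr (- \<alpha>) = r powr (2 - \<alpha>)" if "0 < r" for r :: real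
      using that powr_add[of r 2 "- \<alpha>"] by simp
    then show "ennreal (r\<^sup>2) * size_weight \<alpha> r\<^sub>0 r\<^sub>1 r \<le>
        ennreal (r powr (2 - \<alpha>)) * indicator {r\<^sub>0..} r"
      using r(1) by (auto simp: indicator_def ennreal_mult[symmetric])
  qed
  also have "\<dots> < \<infinity>" using r \<alpha> by (intro nn_integral_powr_tail) auto
  finally show ?thesis by (subst i(2)) (auto simp: ennreal_mult_less_top)
qed

text \<open>Either range of \<open>\<alpha>\<close> and \<open>r\<^sub>1\<close> gives the size a
  finite second moment, which dominates the first moment needed for \<open>\<beta> = 1\<close>
  through \<open>r \<le> 1 + r\<^sup>2\<close>. As no size is below \<open>r\<^sub>0\<close>, the
  choice \<open>s = r\<^sub>0\<close> makes almost every leaf a covering one.\<close>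

lemma (in random_grain) colored_dead_leaves_discrepancy_A2:
  assumes cases: "1 < \<alpha> \<and> \<alpha> \<le> 3 \<and> 0 < r\<^sub>0 \<and> ereal r\<^sub>0 < r\<^sub>1 \<and> r\<^sub>1 < \<infinity> \<or>
       3 < \<alpha> \<and> 0 < r\<^sub>0 \<and> ereal r\<^sub>0 < r\<^sub>1 \<and> r\<^sub>1 \<le> \<infinity>"
    and A2: "condition_A2 N Y"
    and I: "colored_dead_leaves M (leaf_law N Y \<alpha> r\<^sub>0 r\<^sub>1) I"
  obtains K where "\<And>x y. differ_prob_le M I x y (K * norm (x - y) powr 1)"
proof -
  have r: "0 < r\<^sub>0" "ereal r\<^sub>0 < r\<^sub>1" "1 < \<alpha>" using cases by auto
  let ?R = "size_law \<alpha> r\<^sub>0 r\<^sub>1"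
  interpret R: prob_space ?R by (rule prob_space_size_law[OF r])
  interpret G: scaled_grain N Y a\<^sub>1 a\<^sub>2 ?R "leaf_law N Y \<alpha> r\<^sub>0 r\<^sub>1"
    by (rule scaled_grain_size_law[OF r I])
  have fin: "(\<integral>\<^sup>+r. ennreal (r\<^sup>2) \<partial>?R) < \<infinity>"
  proof (cases "3 < \<alpha>")
    case True
    then show ?thesis by (rule nn_integral_square_size_law_unbounded[OF r(1,2)])
  next
    case False
    then obtain b where "r\<^sub>1 = ereal b" using cases r by (cases r\<^sub>1) auto
    then show ?thesis using nn_integral_square_size_law_bounded[of r\<^sub>0 b \<alpha>] r by simp
  qed
  obtain C where C: "0 \<le> C" "\<And>k. covariogram_defect k \<le> C * norm k"
    using covariogram_defect_le_linear[OF A2] by blast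
  note [measurable_cong] = sets_size_law
  have "AE r in ?R. r \<in> {r. r\<^sub>0 \<le> r}" using AE_size_law[of r\<^sub>0 r\<^sub>1 \<alpha>] by eventually_elim simp
  then have one: "measure ?R {r. r\<^sub>0 \<le> r} = 1" by (subst R.prob_eq_1) auto
  let ?J = "\<integral>\<^sup>+r. ennreal (r powr (2 - 1)) \<partial>?R"
  have "?J \<le> (\<integral>\<^sup>+r. 1 + ennreal (r\<^sup>2) \<partial>?R)"
  proof (rule nn_integral_mono_AE)
    show "AE r in ?R. ennreal (r powr (2 - 1)) \<le> 1 + ennreal (r\<^sup>2)"
      using AE_size_law[of r\<^sub>0 r\<^sub>1 \<alpha>]
    proof eventually_elim
      case (elim r)
      have "r \<le> 1 + r\<^sup>2" using sum_squares_bound[of 1 r] elim r(1) by (simp add: power2_eq_square)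
      then have "ennreal r \<le> ennreal (1 + r\<^sup>2)" by (rule ennreal_leI)
      then show ?case using elim r(1) by (simp add: ennreal_plus)
    qed
  qed
  also have "\<dots> = 1 + (\<integral>\<^sup>+r. ennreal (r\<^sup>2) \<partial>?R)"
    by (subst nn_integral_add) (auto simp: R.emeasure_space_1)
  also have "\<dots> < \<infinity>" using fin by simp
  finally have J: "ennreal (4 * C) * ?J < \<infinity>" by (simp add: ennreal_mult_less_top)
  define v where "v = measure lborel (ball (0::real^2) (a\<^sub>1 * r\<^sub>0))"
  have v: "0 < v" using a r by (simp add: v_def content_ball_pos)
  define K where "K = enn2real (ennreal (4 * C) * ?J) / v"
  have "differ_prob_le M I x y (K * norm (x - y) powr 1)" for x y
  proof (rule G.colored_dead_leaves_discrepancy[OF I C(1) _ fin r(1)])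
    show "covariogram_defect k \<le> C * norm k powr 1" for k
      using C(2)[of k] by simp
    show "0 < measure ?R {r. r\<^sub>0 \<le> r}" by (simp add: one)
    show "ennreal (4 * C) * ?J \<le> ennreal (K * (measure ?R {r. r\<^sub>0 \<le> r} * measure lborel (ball (0::real^2) (a\<^sub>1 * r\<^sub>0))))"
      unfolding v_def[symmetric] one K_def using J v by simp
  qed
  then show thesis by (rule that)
qed

text \<open>
  Both the mean area of straddled positions and the probability of a leaf of size at least
  \<open>r\<^sub>1 / 2\<close> carry the normalising constant of the size law, which cancels; hence
  the bound is uniform in \<open>r\<^sub>0\<close>.
\<close>

lemma (in random_grain) colored_dead_leaves_discrepancy_A3:
  assumes \<alpha>: "2 < \<alpha>" "\<alpha> < 3" and r1: "0 < r\<^sub>1" and A3: "condition_A3 N Y"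
    and \<beta>: "0 < \<beta>" "\<beta> < 3 - \<alpha>"
  obtains K where "\<And>r (M :: 'c measure) I x y. 0 < r \<Longrightarrow> r < r\<^sub>1 / 2 \<Longrightarrow>
    colored_dead_leaves M (leaf_law N Y \<alpha> r (ereal r\<^sub>1)) I \<Longrightarrow>
    differ_prob_le M I x y (K * norm (x - y) powr \<beta>)"
proof -
  have "\<beta> < 1" using \<alpha> \<beta> by simp
  then obtain C where C: "0 \<le> C" "\<And>k. covariogram_defect k \<le> C * norm k powr \<beta>"
    using covariogram_defect_le_powr[OF A3 \<beta>(1)] by blast
  \<comment> \<open>Sizes in \<open>{s..r\<^sub>1}\<close> are admissible for every
    \<open>r < r\<^sub>1 / 2\<close>, so up to the normalising constant their probability has a
    lower bound that does not depend on \<open>r\<close>.\<close>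
  define s where "s = r\<^sub>1 / 2"
  have s: "0 < s" "s < r\<^sub>1" using r1 by (auto simp: s_def)
  define v where "v = measure lborel (ball (0::real^2) (a\<^sub>1 * s))"
  have v: "0 < v" using a s by (simp add: v_def content_ball_pos)
  \<comment> \<open>A lower bound for the unnormalised mass of \<open>{s..r\<^sub>1}\<close>, where
    the density is at least its value at \<open>r\<^sub>1\<close>.\<close>
  define D where "D = r\<^sub>1 powr (- \<alpha>) * (r\<^sub>1 - s)"
  have D: "0 < D" using s r1 by (simp add: D_def)
  \<comment> \<open>The integral of \<open>x powr (2 - \<beta> - \<alpha>)\<close> over
    \<open>{0..r\<^sub>1}\<close>. It is finite because \<open>\<beta> < 3 - \<alpha>\<close> puts
    the exponent above -1; this is where the threshold \<open>3 - \<alpha>\<close> enters.\<close>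
  define F where "F = r\<^sub>1 powr (2 - \<beta> - \<alpha> + 1) / (2 - \<beta> - \<alpha> + 1)"
  have F: "0 \<le> F" using \<beta> by (simp add: F_def)
  define K where "K = 4 * C * F / (D * v)"
  have K: "0 \<le> K" using C(1) F D v by (simp add: K_def)
  have "differ_prob_le M I x y (K * norm (x - y) powr \<beta>)"
    if r: "0 < r" "r < r\<^sub>1 / 2" and I: "colored_dead_leaves M (leaf_law N Y \<alpha> r (ereal r\<^sub>1)) I"
    for r and M :: "'c measure" and I x y
  proof -
    let ?R = "size_law \<alpha> r (ereal r\<^sub>1)"
    have rr: "0 < r" "ereal r < ereal r\<^sub>1" "1 < \<alpha>" using r r1 \<alpha> by auto
    interpret R: prob_space ?R by (rule prob_space_size_law[OF rr])
    interpret G: scaled_grain N Y a\<^sub>1 a\<^sub>2 ?R "leaf_law N Y \<alpha> r (ereal r\<^sub>1)"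
      by (rule scaled_grain_size_law[OF rr I])
    note [measurable_cong] = sets_size_law
    obtain i where i: "0 < i"
      "\<And>f. f \<in> borel_measurable borel \<Longrightarrow> (\<integral>\<^sup>+x. f x \<partial>?R) =
        ennreal (1 / i) * (\<integral>\<^sup>+x. f x * size_weight \<alpha> r r\<^sub>1 x \<partial>lborel)"
      using nn_integral_size_law[OF rr] by blast
    have "ennreal (D / i) = ennreal (1 / i) * ennreal D"
      using i(1) D by (simp add: ennreal_mult[symmetric])
    also have "ennreal D = (\<integral>\<^sup>+x. ennreal (r\<^sub>1 powr (- \<alpha>)) * indicator {s..r\<^sub>1} x \<partial>lborel)"
      using s by (simp add: nn_integral_cmult_indicator ennreal_mult D_def)
    also have "ennreal (1 / i) * \<dots> \<le> ennreal (1 / i) * (\<integral>\<^sup>+x. indicator {x. s \<le> x} x *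
        size_weight \<alpha> r r\<^sub>1 x \<partial>lborel)"
    proof (intro mult_left_mono nn_integral_mono)
      fix x
      show "ennreal (r\<^sub>1 powr (- \<alpha>)) * indicator {s..r\<^sub>1} x \<le> indicator {x. s \<le> x} x *
        size_weight \<alpha> r r\<^sub>1 x"
      proof (cases "x \<in> {s..r\<^sub>1}")
        case True
        then have "r\<^sub>1 powr (- \<alpha>) \<le> x powr (- \<alpha>)" using s \<alpha> by (intro powr_mono2') auto
        then show ?thesis using True r by (simp add: s_def ennreal_leI)
      qed simp
    qed simp
    also have "\<dots> = (\<integral>\<^sup>+x. indicator {x. s \<le> x} x \<partial>?R)" by (rule i(2)[symmetric]) simp
    also have "\<dots> = emeasure ?R {x. s \<le> x}" by (rule nn_integral_indicator) simp
    finally have p: "D / i \<le> measure ?R {x. s \<le> x}"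
      by (simp add: R.emeasure_eq_measure)
    have "0 < D / i" using D i(1) by simp
    then have p_pos: "0 < measure ?R {x. s \<le> x}" using p by simp
    have "(\<integral>\<^sup>+x. ennreal (x powr (2 - \<beta>)) \<partial>?R) = ennreal (1 / i) * (\<integral>\<^sup>+x. ennreal (x powr (2 - \<beta>)) *
        size_weight \<alpha> r r\<^sub>1 x \<partial>lborel)"
      by (rule i(2)) simp
    also have "\<dots> \<le> ennreal (1 / i) * (\<integral>\<^sup>+x. ennreal (x powr (2 - \<beta> - \<alpha>)) * indicator {0..r\<^sub>1} x \<partial>lborel)"
    proof (intro mult_left_mono nn_integral_mono)
      fix x
      have "x powr (2 - \<beta>) * x powr (- \<alpha>) = x powr (2 - \<beta> - \<alpha>)"
        using powr_add[of x "2 - \<beta>" "- \<alpha>"] by simp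
      then show "ennreal (x powr (2 - \<beta>)) *
          size_weight \<alpha> r r\<^sub>1 x \<le>
          ennreal (x powr (2 - \<beta> - \<alpha>)) * indicator {0..r\<^sub>1} x"
        using r(1) by (auto simp: indicator_def ennreal_mult[symmetric])
    qed simp
    also have "(\<integral>\<^sup>+x. ennreal (x powr (2 - \<beta> - \<alpha>)) * indicator {0..r\<^sub>1} x \<partial>lborel) = ennreal F"
      unfolding F_def using \<beta> r1 by (intro nn_integral_powr_from_zero) auto
    finally have J: "(\<integral>\<^sup>+x. ennreal (x powr (2 - \<beta>)) \<partial>?R) \<le> ennreal (F / i)"
      using i(1) F by (simp add: ennreal_mult[symmetric])
    show ?thesis
    proof (rule G.colored_dead_leaves_discrepancy[OF I C _ s(1) p_pos])
      show "(\<integral>\<^sup>+x. ennreal (x\<^sup>2) \<partial>?R) < \<infinity>"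
        by (rule nn_integral_square_size_law_bounded[OF rr])
      have "ennreal (4 * C) * (\<integral>\<^sup>+x. ennreal (x powr (2 - \<beta>)) \<partial>?R) \<le> ennreal (4 * C) * ennreal (F / i)"
        by (intro mult_left_mono J) simp
      also have "\<dots> = ennreal (K * (D / i * v))"
        using C(1) F i(1) D v by (simp add: K_def ennreal_mult[symmetric])
      also have "\<dots> \<le> ennreal (K * (measure ?R {x. s \<le> x} * measure lborel (ball (0::real^2) (a\<^sub>1 * s))))"
        unfolding v_def[symmetric] using K p v by (intro ennreal_leI mult_left_mono mult_right_mono) auto
      finally show "ennreal (4 * C) * (\<integral>\<^sup>+x. ennreal (x powr (2 - \<beta>)) \<partial>?R) \<le>
        ennreal (K * (measure ?R {x. s \<le> x} * measure lborel (ball (0::real^2) (a\<^sub>1 * s))))" .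
    qed
  qed
  then show thesis by (rule that)
qed

section \<open>Besov regularity\<close>

lemma unit_square_cbox: "unit_square = cbox 0 1"
  by (auto simp: unit_square_def mem_box_cart)

lemma unit_square_sets [measurable]: "unit_square \<in> sets borel"
  by (simp add: unit_square_cbox)

lemma emeasure_unit_square_finite: "emeasure lborel unit_square < \<infinity>"
  unfolding unit_square_cbox by (rule emeasure_bounded_finite[OF bounded_cbox])

lemma nn_integral_unit_square:
  "(\<integral>\<^sup>+x. g x \<partial>lebesgue_on unit_square) = (\<integral>\<^sup>+x. g x * indicator unit_square x \<partial>lborel)"
proof -
  have "unit_square \<in> sets lebesgue" using unit_square_sets by simp
  then show ?thesis by (subst nn_integral_restrict_space) (simp_all add: nn_integral_completion)
qed

lemma nn_integral_lborel_shift: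
  fixes g :: "'a::euclidean_space \<Rightarrow> ennreal"
  assumes g: "g \<in> borel_measurable borel"
  shows "(\<integral>\<^sup>+x. g (x + h) \<partial>lborel) = (\<integral>\<^sup>+x. g x \<partial>lborel)"
proof -
  have "(\<integral>\<^sup>+x. g x \<partial>lborel) = (\<integral>\<^sup>+x. g x \<partial>distr lborel borel ((+) h))"
    by (simp only: lborel_distr_plus)
  also have "\<dots> = (\<integral>\<^sup>+x. g (h + x) \<partial>lborel)" using g by (intro nn_integral_distr) simp_all
  finally show ?thesis by (simp add: add.commute)
qed

lemma AE_lborel_shift:
  fixes h :: "'a::euclidean_space"
  assumes "AE x in lborel. P x" shows "AE x in lborel. P (x + h)"
proof -
  have "AE x in distr lborel borel ((+) h). P x" using assms by (simp only: lborel_distr_plus)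
  from AE_distrD[OF _ this] have "AE x in lborel. P (h + x)" by simp
  then show ?thesis by (simp add: add.commute)
qed

lemma ennreal_powr_ennreal: "0 \<le> t \<Longrightarrow> ennreal_powr (ennreal t) e = ennreal (t powr e)"
  by (simp add: ennreal_powr_def)

lemma ennreal_powr_mono: "x \<le> y \<Longrightarrow> 0 \<le> e \<Longrightarrow> ennreal_powr x e \<le> ennreal_powr y e"
  by (auto simp: ennreal_powr_def top_unique less_top intro!: ennreal_leI powr_mono2 enn2real_mono)

text \<open>
  Truncating increments at \<open>1\<close> costs nothing for fields with values in \<open>[0, 1]\<close> and makes their
  expectations continuous under convergence of the finite-dimensional distributions.
\<close>

abbreviation increment :: "('a \<Rightarrow> real) \<Rightarrow> 'a \<Rightarrow> 'a \<Rightarrow> ennreal" where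
  "increment f x y \<equiv> ennreal (min 1 \<bar>f x - f y\<bar>)"

abbreviation near :: "real^2 \<Rightarrow> real \<Rightarrow> (real^2) set" where
  "near x u \<equiv> {z. z \<in> unit_square \<and> dist x z \<le> 3 * u}"

abbreviation shift_domain :: "real^2 \<Rightarrow> (real^2) set" where
  "shift_domain h \<equiv> {x. x \<in> unit_square \<and> x + h \<in> unit_square}"

text \<open>The 3 in \<open>near\<close> leaves room for a detour: a point within
  \<open>2 * u\<close> of \<open>x\<close> is within \<open>3 * u\<close> of \<open>x + h\<close>
  when \<open>norm h < u\<close>. Integrating over both points gives one random variable per scale,
  with a mean that Fubini computes, in place of a supremum over shifts.\<close>

definition oscillation :: "(real^2 \<Rightarrow> real) \<Rightarrow> real \<Rightarrow> ennreal" where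
  "oscillation f u = (\<integral>\<^sup>+x. (\<integral>\<^sup>+z. increment f x z *
     indicator (near x u) z \<partial>lborel) * indicator unit_square x \<partial>lborel)"

lemma oscillation_mono: "u \<le> v \<Longrightarrow> oscillation f u \<le> oscillation f v"
  unfolding oscillation_def
  by (intro nn_integral_mono mult_right_mono mult_left_mono) (auto simp: indicator_def)

text \<open>In each coordinate the side of length \<open>u\<close> ends at \<open>x\<close> if there
  is room below and starts at 0 otherwise, so it stays in the unit interval and within
  \<open>u\<close> of \<open>x\<close>. The distance in the plane is at most the sum of the two
  coordinate distances.\<close>

lemma ex_subsquare:
  assumes x: "x \<in> unit_square" and u: "0 < u" "u \<le> 1"
  shows "\<exists>B \<in> sets borel. B \<subseteq> unit_square \<and> (\<forall>z\<in>B. dist x z \<le> 2 * u) \<and> emeasure lborel B = ennreal (u\<^sup>2)"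
proof -
  define l :: "real^2" where "l = (\<chi> i. if u \<le> x $ i then x $ i - u else 0)"
  define r :: "real^2" where "r = (\<chi> i. l $ i + u)"
  let ?B = "cbox l r"
  have lr: "0 \<le> l $ i" "r $ i \<le> 1" "x $ i - u \<le> l $ i" "r $ i \<le> x $ i + u" "l $ i \<le> r $ i" "r $ i - l $ i = u" for i
    using x u by (auto simp: l_def r_def unit_square_def)
  have "?B \<subseteq> unit_square"
  proof
    fix z assume "z \<in> ?B"
    then have "l $ i \<le> z $ i \<and> z $ i \<le> r $ i" for i by (simp add: mem_box_cart)
    then show "z \<in> unit_square" using lr(1,2) unfolding unit_square_def by (blast intro: order_trans)
  qed
  moreover have "dist x z \<le> 2 * u" if "z \<in> ?B" for z
  proof -
    have z: "l $ i \<le> z $ i \<and> z $ i \<le> r $ i" for i using that by (simp add: mem_box_cart)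
    have "dist x z \<le> (\<Sum>i\<in>UNIV. \<bar>(x - z) $ i\<bar>)" unfolding dist_norm by (rule norm_le_l1_cart)
    also have "\<dots> \<le> (\<Sum>i\<in>(UNIV :: 2 set). u)"
    proof (rule sum_mono)
      fix i
      show "\<bar>(x - z) $ i\<bar> \<le> u" using z[of i] lr(3,4)[of i] by (simp add: abs_le_iff)
    qed
    finally show ?thesis by simp
  qed
  moreover have "emeasure lborel ?B = ennreal (u\<^sup>2)"
  proof -
    have "l \<in> ?B" using lr(5) by (simp add: mem_box_cart)
    then have ne: "?B \<noteq> {}" by blast
    have "measure lborel ?B = (\<Prod>i\<in>(UNIV :: 2 set). u)"
      unfolding content_cbox_cart[OF ne] by (simp add: lr(6))
    then have "measure lborel ?B = u\<^sup>2" by simp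
    moreover have "emeasure lborel ?B \<noteq> \<infinity>"
      using emeasure_bounded_finite[OF bounded_cbox[of l r]] by simp
    ultimately show ?thesis by (simp add: emeasure_eq_ennreal_measure)
  qed
  ultimately show ?thesis by (intro bexI[of _ ?B]) auto
qed

text \<open>
  The increment from \<open>x\<close> to \<open>x + h\<close> is compared with the increments to a third point that is averaged
  over a square of side \<open>u\<close> near both.
\<close>

lemma difference_integral_le_oscillation:
  assumes f [measurable]: "f \<in> borel_measurable borel" and u: "0 < u" "u \<le> 1" and h: "norm h < u"
  shows "(\<integral>\<^sup>+x. increment f (x + h) x *
      indicator (shift_domain h) x \<partial>lborel) * ennreal (u\<^sup>2) \<le> 2 * oscillation f u"
proof -
  define A where "A x = (\<integral>\<^sup>+z. increment f x z *
     indicator (near x u) z \<partial>lborel) * indicator unit_square x" for x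
  have A [measurable]: "A \<in> borel_measurable borel"
    unfolding A_def by measurable
  have D [measurable]: "shift_domain h \<in> sets borel"
    using measurable_sets[of "\<lambda>x::real^2. x + h" borel borel unit_square]
    by (simp add: vimage_def Collect_conj_eq sets.Int)
  have point: "increment f (x + h) x *
      indicator (shift_domain h) x * ennreal (u\<^sup>2) \<le> A (x + h) + A x" for x
  proof (cases "x \<in> unit_square \<and> x + h \<in> unit_square")
    case True
    obtain B where B [measurable]: "B \<in> sets borel" and B': "B \<subseteq> unit_square" "\<And>z. z \<in> B \<Longrightarrow> dist x z \<le> 2 * u"
      "emeasure lborel B = ennreal (u\<^sup>2)"
      using ex_subsquare[of x u] True u by blast
    have "increment f (x + h) x * ennreal (u\<^sup>2) =
        (\<integral>\<^sup>+z. increment f (x + h) x * indicator B z \<partial>lborel)"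
      using B'(3) by (simp add: nn_integral_cmult_indicator)
    also have "\<dots> \<le> (\<integral>\<^sup>+z. increment f (x + h) z *
          indicator (near (x + h) u) z +
        increment f x z * indicator (near x u) z \<partial>lborel)"
    proof (intro nn_integral_mono)
      fix z
      show "increment f (x + h) x * indicator B z \<le>
          increment f (x + h) z * indicator (near (x + h) u) z +
          increment f x z * indicator (near x u) z"
      proof (cases "z \<in> B")
        case True
        have "dist x z \<le> 2 * u" using B'(2) True by blast
        moreover have "dist (x + h) z \<le> dist (x + h) x + dist x z" by (rule dist_triangle)
        moreover have "dist (x + h) x = norm h" by (simp add: dist_norm)
        ultimately have "dist x z \<le> 3 * u" "dist (x + h) z \<le> 3 * u" using h u by linarith+
        moreover have "min 1 \<bar>f (x + h) - f x\<bar> \<le> min 1 \<bar>f (x + h) - f z\<bar> + min 1 \<bar>f x - f z\<bar>" by linarith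
        then have "increment f (x + h) x \<le>
            ennreal (min 1 \<bar>f (x + h) - f z\<bar> + min 1 \<bar>f x - f z\<bar>)"
          by (rule ennreal_leI)
        then have "increment f (x + h) x \<le>
            increment f (x + h) z + increment f x z"
          by (subst (asm) ennreal_plus) simp_all
        ultimately show ?thesis using True B'(1) by auto
      qed simp
    qed
    also have "\<dots> = A (x + h) + A x"
      using True by (subst nn_integral_add) (auto simp: A_def)
    finally show ?thesis using True by simp
  qed simp
  have "(\<integral>\<^sup>+x. increment f (x + h) x *
      indicator (shift_domain h) x \<partial>lborel) * ennreal (u\<^sup>2) =
      (\<integral>\<^sup>+x. increment f (x + h) x *
      indicator (shift_domain h) x * ennreal (u\<^sup>2) \<partial>lborel)"
    by (rule nn_integral_multc[symmetric]) measurable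
  also have "\<dots> \<le> (\<integral>\<^sup>+x. A (x + h) + A x \<partial>lborel)" by (intro nn_integral_mono point)
  also have "\<dots> = (\<integral>\<^sup>+x. A (x + h) \<partial>lborel) + (\<integral>\<^sup>+x. A x \<partial>lborel)" by (rule nn_integral_add) measurable
  also have "\<dots> = 2 * oscillation f u"
    unfolding nn_integral_lborel_shift[OF A] by (simp add: mult_2 oscillation_def A_def[abs_def])
  finally show ?thesis .
qed

lemma Lp_norm_difference_le:
  assumes p: "1 \<le> p" and f01: "AE x in lborel. 0 \<le> f x \<and> f x \<le> 1"
    and le: "(\<integral>\<^sup>+x. increment f (x + h) x *
      indicator (shift_domain h) x \<partial>lborel) \<le> ennreal B" and B: "0 \<le> B"
  shows "Lp_norm (ereal p) (difference f h) \<le> ennreal (B powr (1 / p))"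
proof -
  have "(\<integral>\<^sup>+x. ennreal (\<bar>difference f h x\<bar> powr p) * indicator unit_square x \<partial>lborel) \<le>
      (\<integral>\<^sup>+x. increment f (x + h) x *
        indicator (shift_domain h) x \<partial>lborel)"
  proof (rule nn_integral_mono_AE)
    show "AE x in lborel. ennreal (\<bar>difference f h x\<bar> powr p) * indicator unit_square x \<le>
        increment f (x + h) x * indicator (shift_domain h) x"
      using f01 AE_lborel_shift[OF f01, of h]
    proof eventually_elim
      case (elim x)
      then have "\<bar>f (x + h) - f x\<bar> \<le> 1" by linarith
      then have "\<bar>f (x + h) - f x\<bar> powr p \<le> \<bar>f (x + h) - f x\<bar> powr 1"
        using p by (intro powr_mono') auto
      then have "ennreal (\<bar>f (x + h) - f x\<bar> powr p) \<le> increment f (x + h) x"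
        using \<open>\<bar>f (x + h) - f x\<bar> \<le> 1\<close> by (intro ennreal_leI) simp
      then show ?case using p by (auto simp: difference_def indicator_def)
    qed
  qed
  then have "(\<integral>\<^sup>+x. ennreal (\<bar>difference f h x\<bar> powr p) \<partial>lebesgue_on unit_square) \<le> ennreal B"
    using le unfolding nn_integral_unit_square by (rule order_trans)
  then show ?thesis
    using ennreal_powr_mono[of _ "ennreal B" "1 / p"] p B by (simp add: Lp_norm_def ennreal_powr_ennreal)
qed

text \<open>The Besov integral is split at 1. For small \<open>u\<close>, dividing the oscillation
  bound by the area \<open>u\<^sup>2\<close> of the averaging square leaves
  \<open>u powr \<kappa>\<close> under the \<open>p\<close>-th root, and
  \<open>s < \<kappa> / p\<close> gives integrability at 0. For large \<open>u\<close> the modulus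
  is at most a constant, and \<open>s > 0\<close> gives integrability at infinity.\<close>

lemma besov_space_if_oscillation_le:
  assumes f: "f \<in> borel_measurable borel" and f01: "AE x in lborel. 0 \<le> f x \<and> f x \<le> 1"
    and A: "0 \<le> A" and osc: "\<And>u. 0 < u \<Longrightarrow> u \<le> 1 \<Longrightarrow> oscillation f u \<le> ennreal (A * u powr (2 + \<kappa>))"
    and p: "1 \<le> p" and q: "1 \<le> q" and s: "0 < s" "s * p < \<kappa>"
  shows "f \<in> besov_space (ereal p) q s"
proof -
  define W where "W = measure lborel unit_square powr (1 / p)"
  \<comment> \<open>The 2 stems from the two legs of the detour through the intermediate
    point.\<close>
  define c where "c = (2 * A) powr (1 / p)"
  have c: "0 \<le> c" and W: "0 \<le> W" by (auto simp: c_def W_def)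
  have mQ: "emeasure lborel unit_square = ennreal (measure lborel unit_square)"
    using emeasure_unit_square_finite by (simp add: emeasure_eq_ennreal_measure less_top)
  have modulus_W: "Lp_modulus (ereal p) f u \<le> ennreal W" for u
    unfolding Lp_modulus_def
  proof (intro SUP_least)
    fix h
    have "(\<integral>\<^sup>+x. increment f (x + h) x *
        indicator (shift_domain h) x \<partial>lborel) \<le> (\<integral>\<^sup>+x. indicator unit_square x \<partial>lborel)"
      by (intro nn_integral_mono) (auto simp: indicator_def ennreal_le_1)
    then show "Lp_norm (ereal p) (difference f h) \<le> ennreal W"
      unfolding W_def using mQ by (intro Lp_norm_difference_le[OF p f01]) auto
  qed
  have modulus_c: "Lp_modulus (ereal p) f u \<le> ennreal (c * u powr (\<kappa> / p))" if u: "0 < u" "u \<le> 1" for u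
    unfolding Lp_modulus_def
  proof (intro SUP_least)
    fix h :: "real^2" assume "h \<in> {y. norm y < u}"
    then have h: "norm h < u" by simp
    let ?D = "\<integral>\<^sup>+x. increment f (x + h) x *
        indicator (shift_domain h) x \<partial>lborel"
    have "?D * ennreal (u\<^sup>2) \<le> 2 * ennreal (A * u powr (2 + \<kappa>))"
      using difference_integral_le_oscillation[OF f u h] mult_left_mono[OF osc[OF u], of 2]
      by (meson order_trans zero_le)
    also have "\<dots> = ennreal (2 * A * u powr \<kappa>) * ennreal (u\<^sup>2)"
    proof -
      have "u powr (2 + \<kappa>) = u powr \<kappa> * u\<^sup>2" using u by (simp add: powr_add)
      then show ?thesis using A by (simp add: ennreal_mult[symmetric] mult_ac flip: ennreal_numeral)
    qed
    finally have "ennreal (u\<^sup>2) * ?D \<le> ennreal (u\<^sup>2) * ennreal (2 * A * u powr \<kappa>)"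
      by (simp only: mult.commute)
    then have "?D \<le> ennreal (2 * A * u powr \<kappa>)"
      using u by (subst (asm) ennreal_mult_le_mult_iff) auto
    then have "Lp_norm (ereal p) (difference f h) \<le> ennreal ((2 * A * u powr \<kappa>) powr (1 / p))"
      using A by (intro Lp_norm_difference_le[OF p f01]) auto
    also have "(2 * A * u powr \<kappa>) powr (1 / p) = c * u powr (\<kappa> / p)"
      using A by (simp add: c_def powr_mult powr_powr)
    finally show "Lp_norm (ereal p) (difference f h) \<le> ennreal (c * u powr (\<kappa> / p))" .
  qed
  have ks: "s < \<kappa> / p" using s p by (simp add: field_simps)
  have small: "Lp_modulus (ereal p) f u * ennreal (u powr (- s)) \<le> ennreal (c * u powr (\<kappa> / p - s))"
    if "0 < u" "u \<le> 1" for u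
  proof -
    have "Lp_modulus (ereal p) f u * ennreal (u powr (- s)) \<le> ennreal (c * u powr (\<kappa> / p)) * ennreal (u powr (- s))"
      by (intro mult_right_mono modulus_c that) simp
    also have "\<dots> = ennreal (c * u powr (\<kappa> / p - s))"
      using c by (simp add: ennreal_mult[symmetric] powr_add[symmetric] mult.assoc)
    finally show ?thesis .
  qed
  have large: "Lp_modulus (ereal p) f u * ennreal (u powr (- s)) \<le> ennreal (W * u powr (- s))" for u
    using mult_right_mono[OF modulus_W[of u], of "ennreal (u powr (- s))"] W by (simp add: ennreal_mult)
  have norm_fin: "Lp_norm (ereal p) f < \<infinity>"
  proof -
    have "(\<integral>\<^sup>+x. ennreal (\<bar>f x\<bar> powr p) \<partial>lebesgue_on unit_square) \<le> (\<integral>\<^sup>+x. indicator unit_square x \<partial>lborel)"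
      unfolding nn_integral_unit_square
    proof (rule nn_integral_mono_AE)
      show "AE x in lborel. ennreal (\<bar>f x\<bar> powr p) * indicator unit_square x \<le> indicator unit_square x"
        using f01
      proof eventually_elim
        case (elim x)
        then have "\<bar>f x\<bar> powr p \<le> 1" using p by (intro powr_le1) auto
        then show ?case by (auto simp: indicator_def ennreal_le_1)
      qed
    qed
    then have "(\<integral>\<^sup>+x. ennreal (\<bar>f x\<bar> powr p) \<partial>lebesgue_on unit_square) < \<infinity>"
      using emeasure_unit_square_finite by (simp add: le_less_trans)
    then show ?thesis by (simp add: Lp_norm_def ennreal_powr_def less_top)
  qed
  have "besov_norm (ereal p) q s f < \<infinity>"
  proof (cases "q = \<infinity>")
    case True
    have "Lp_modulus (ereal p) f u * ennreal (u powr (- s)) \<le> ennreal (max c W)" if u: "0 < u" for u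
    proof (cases "u \<le> 1")
      case True
      have "Lp_modulus (ereal p) f u * ennreal (u powr (- s)) \<le> ennreal (c * u powr (\<kappa> / p - s))"
        by (rule small[OF u True])
      also have "\<dots> \<le> ennreal (c * 1)"
        using c u True ks by (intro ennreal_leI mult_left_mono powr_le1) auto
      also have "\<dots> \<le> ennreal (max c W)" by (simp add: ennreal_leI)
      finally show ?thesis .
    next
      case False
      have "Lp_modulus (ereal p) f u * ennreal (u powr (- s)) \<le> ennreal (W * u powr (- s))" by (rule large)
      also have "\<dots> \<le> ennreal (W * 1)"
        using W s False powr_mono[of "- s" 0 u] by (intro ennreal_leI mult_left_mono) auto
      also have "\<dots> \<le> ennreal (max c W)" by (simp add: ennreal_leI)
      finally show ?thesis .
    qed
    then have "(SUP u\<in>{0<..}. Lp_modulus (ereal p) f u * ennreal (u powr (- s))) \<le> ennreal (max c W)"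
      by (intro SUP_least) auto
    then have "(SUP u\<in>{0<..}. Lp_modulus (ereal p) f u * ennreal (u powr (- s))) < \<infinity>"
      by (simp add: le_less_trans)
    then show ?thesis using True norm_fin by (simp add: besov_norm_def)
  next
    case False
    then obtain k where k: "q = ereal k" "1 \<le> k" using q by (cases q) auto
    \<comment> \<open>The exponents of the integrand below and above 1; the \<open>- 1\<close> comes
      from the measure \<open>du / u\<close>.\<close>
    define e1 where "e1 = (\<kappa> / p - s) * k - 1"
    define e2 where "e2 = - s * k - 1"
    have e1: "-1 < e1" using ks k by (simp add: e1_def)
    have e2: "e2 < -1" using s k by (simp add: e2_def)
    let ?F = "\<lambda>u. ennreal_powr (Lp_modulus (ereal p) f u * ennreal (u powr (- s))) k * ennreal (1 / u)"
    have "(\<integral>\<^sup>+u\<in>{0<..}. ?F u \<partial>lborel) \<le> (\<integral>\<^sup>+u. ennreal (c powr k) * (ennreal (u powr e1) * indicator {0..1} u) +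
        ennreal (W powr k) * (ennreal (u powr e2) * indicator {1..} u) \<partial>lborel)"
    proof (intro nn_integral_mono)
      fix u :: real
      show "?F u * indicator {0<..} u \<le> ennreal (c powr k) * (ennreal (u powr e1) * indicator {0..1} u) +
        ennreal (W powr k) * (ennreal (u powr e2) * indicator {1..} u)"
      proof (cases "0 < u")
        case u: True
        show ?thesis
        proof (cases "u \<le> 1")
          case True
          have "?F u \<le> ennreal_powr (ennreal (c * u powr (\<kappa> / p - s))) k * ennreal (1 / u)"
            using k small[OF u True] by (intro mult_right_mono ennreal_powr_mono) auto
          also have "\<dots> = ennreal (c powr k * (u powr ((\<kappa> / p - s) * k) * u powr (- 1)))"
            using c u by (simp add: ennreal_powr_ennreal ennreal_mult[symmetric] powr_mult powr_powr
                powr_minus_divide mult.assoc)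
          also have "u powr ((\<kappa> / p - s) * k) * u powr (- 1) = u powr e1"
            using powr_add[of u "(\<kappa> / p - s) * k" "- 1"] by (simp add: e1_def)
          also have "ennreal (c powr k * u powr e1) = ennreal (c powr k) * ennreal (u powr e1)"
            by (simp add: ennreal_mult)
          finally show ?thesis using u True by (simp add: add_increasing2)
        next
          case False
          have "?F u \<le> ennreal_powr (ennreal (W * u powr (- s))) k * ennreal (1 / u)"
            using k large[of u] by (intro mult_right_mono ennreal_powr_mono) auto
          also have "\<dots> = ennreal (W powr k * (u powr (- s * k) * u powr (- 1)))"
            using W u by (simp add: ennreal_powr_ennreal ennreal_mult[symmetric] powr_mult powr_powr mult.assoc)
          also have "u powr (- s * k) * u powr (- 1) = u powr e2"
            using powr_add[of u "- s * k" "- 1"] by (simp add: e2_def)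
          also have "ennreal (W powr k * u powr e2) = ennreal (W powr k) * ennreal (u powr e2)"
            by (simp add: ennreal_mult)
          finally show ?thesis using u False by simp
        qed
      qed simp
    qed
    also have "\<dots> = ennreal (c powr k) * (\<integral>\<^sup>+u. ennreal (u powr e1) * indicator {0..1} u \<partial>lborel) +
        ennreal (W powr k) * (\<integral>\<^sup>+u. ennreal (u powr e2) * indicator {1..} u \<partial>lborel)"
      by (subst nn_integral_add) (auto simp: nn_integral_cmult)
    also have "\<dots> < \<infinity>"
      using nn_integral_powr_from_zero[OF e1, of 1] nn_integral_powr_tail[OF e2, of 1]
      by (simp add: ennreal_mult_less_top)
    finally have "(\<integral>\<^sup>+u\<in>{0<..}. ?F u \<partial>lborel) < \<infinity>" .
    then show ?thesis
      using norm_fin k by (simp add: besov_norm_def ennreal_powr_def[of "nn_integral _ _"] less_top)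
  qed
  moreover have "f \<in> borel_measurable (lebesgue_on unit_square)"
    using measurable_completion[of f lborel borel] f by (intro measurable_restrict_space1) simp
  ultimately show ?thesis by (simp add: besov_space_def)
qed

section \<open>From increments in the mean to almost sure regularity\<close>

lemma nn_integral_cball_le:
  fixes x :: "real^2"
  assumes "0 \<le> \<rho>"
  shows "(\<integral>\<^sup>+z. indicator {z. dist x z \<le> \<rho>} z \<partial>lborel) = ennreal (unit_ball_vol 2 * \<rho>\<^sup>2)"
proof -
  have "{z. dist x z \<le> \<rho>} = cball x \<rho>" by (auto simp: cball_def)
  then show ?thesis using assms by (simp add: emeasure_cball)
qed

lemma AE_besov_space:
  assumes M: "prob_space M" and I [measurable]: "(\<lambda>(\<omega>, y). I \<omega> y) \<in> borel_measurable (M \<Otimes>\<^sub>M borel)"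
    and I01: "\<And>x. AE \<omega> in M. 0 \<le> I \<omega> x \<and> I \<omega> x \<le> 1"
    and K: "\<And>x y. (\<integral>\<^sup>+\<omega>. increment (I \<omega>) x y \<partial>M) \<le> ennreal (K * norm (x - y) powr \<theta>)"
    and p: "1 \<le> p" and q: "1 \<le> q" and s: "0 < s" "s * p < \<theta>"
  shows "AE \<omega> in M. I \<omega> \<in> besov_space (ereal p) q s"
proof -
  interpret prob_space M by fact
  interpret P: pair_sigma_finite M "lborel :: (real^2) measure" ..
  \<comment> \<open>The gap between \<open>\<kappa>\<close> and \<open>\<theta>\<close> makes the
    dyadic series converge, the gap between \<open>s * p\<close> and \<open>\<kappa>\<close> the
    Besov integral.\<close>
  obtain \<kappa> where \<kappa>: "s * p < \<kappa>" "\<kappa> < \<theta>" using dense s(2) by blast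
  have \<kappa>_pos: "0 < \<kappa>" using \<kappa>(1) s p by (meson less_le_trans mult_pos_pos not_less order_less_trans zero_less_one)
  define K' where "K' = max 0 K"
  have IK: "(\<integral>\<^sup>+\<omega>. increment (I \<omega>) x y \<partial>M) \<le> ennreal (K' * dist x y powr \<theta>)" for x y
  proof -
    have "K * norm (x - y) powr \<theta> \<le> K' * dist x y powr \<theta>"
      by (simp add: K'_def dist_norm mult_right_mono)
    then show ?thesis using K[of x y] ennreal_leI order_trans by blast
  qed
  have I_sec: "I \<omega> \<in> borel_measurable borel" if "\<omega> \<in> space M" for \<omega>
    using measurable_compose[OF measurable_Pair1'[OF that] I] by simp
  have [measurable]: "(\<lambda>w. I (fst w) (snd w)) \<in> borel_measurable (M \<Otimes>\<^sub>M lborel)"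
    using I by (simp add: split_beta')
  have [measurable]: "(\<lambda>w. I (fst (fst w)) (snd (fst w))) \<in> borel_measurable ((M \<Otimes>\<^sub>M lborel) \<Otimes>\<^sub>M lborel)"
    "(\<lambda>w. I (fst (fst w)) (snd w)) \<in> borel_measurable ((M \<Otimes>\<^sub>M lborel) \<Otimes>\<^sub>M lborel)"
    using measurable_compose[OF _ I, of "\<lambda>w. (fst (fst w), snd (fst w))" "(M \<Otimes>\<^sub>M lborel) \<Otimes>\<^sub>M lborel"]
      measurable_compose[OF _ I, of "\<lambda>w. (fst (fst w), snd w)" "(M \<Otimes>\<^sub>M lborel) \<Otimes>\<^sub>M lborel"]
    by simp_all
  have inner: "(\<lambda>w. \<integral>\<^sup>+z. increment (I (fst w)) (snd w) z * indicator (near (snd w) u) z \<partial>lborel) \<in>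
      borel_measurable (M \<Otimes>\<^sub>M lborel)" for u
    by (rule lborel.borel_measurable_nn_integral) (simp add: split_beta', measurable)
  have osc_M [measurable]: "(\<lambda>\<omega>. oscillation (I \<omega>) u) \<in> borel_measurable M" for u
  proof -
    have "(\<lambda>\<omega>. \<integral>\<^sup>+x. (\<integral>\<^sup>+z. increment (I \<omega>) x z * indicator (near x u) z \<partial>lborel) *
        indicator unit_square x \<partial>lborel) \<in> borel_measurable M"
      using inner by (intro lborel.borel_measurable_nn_integral) (simp add: split_beta')
    then show ?thesis by (simp add: oscillation_def)
  qed
  define V where "V = measure lborel unit_square"
  have V: "emeasure lborel unit_square = ennreal V"
    using emeasure_unit_square_finite by (simp add: V_def emeasure_eq_ennreal_measure less_top)
  \<comment> \<open>The factors are the mean increment at distance \<open>3 * u\<close>, the area of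
    a disc of radius \<open>3 * u\<close> and the area of the square, each without its power of
    \<open>u\<close>.\<close>
  define B where "B = K' * 3 powr \<theta> * (unit_ball_vol 2 * 9) * V"
  have B: "0 \<le> B" by (simp add: B_def K'_def V_def)
  have osc_mean: "(\<integral>\<^sup>+\<omega>. oscillation (I \<omega>) u \<partial>M) \<le> ennreal (B * u powr (2 + \<theta>))" if u: "0 < u" for u
  proof -
    have [measurable]: "(\<lambda>w. I (fst w) x) \<in> borel_measurable (M \<Otimes>\<^sub>M lborel)" for x
      using measurable_compose[OF _ I, of "\<lambda>w. (fst w, x)" "M \<Otimes>\<^sub>M lborel"] by simp
    have "(\<integral>\<^sup>+\<omega>. oscillation (I \<omega>) u \<partial>M) =
        (\<integral>\<^sup>+x. \<integral>\<^sup>+\<omega>. (\<integral>\<^sup>+z. increment (I \<omega>) x z *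
          indicator (near x u) z \<partial>lborel) * indicator unit_square x \<partial>M \<partial>lborel)"
      unfolding oscillation_def using inner by (intro P.Fubini'[symmetric]) (simp add: split_beta')
    also have "\<dots> \<le> (\<integral>\<^sup>+x. ennreal (K' * (3 * u) powr \<theta> * (unit_ball_vol 2 * (3 * u)\<^sup>2)) * indicator unit_square x \<partial>lborel)"
    proof (intro nn_integral_mono)
      fix x :: "real^2"
      have [measurable]: "(\<lambda>\<omega>. I \<omega> x) \<in> borel_measurable M"
        using measurable_compose[OF _ I, of "\<lambda>\<omega>. (\<omega>, x)" M] by simp
      have "(\<lambda>\<omega>. \<integral>\<^sup>+z. increment (I \<omega>) x z *
          indicator (near x u) z \<partial>lborel) \<in> borel_measurable M"
        by (rule lborel.borel_measurable_nn_integral) (simp add: split_beta', measurable)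
      then have "(\<integral>\<^sup>+\<omega>. (\<integral>\<^sup>+z. increment (I \<omega>) x z *
          indicator (near x u) z \<partial>lborel) * indicator unit_square x \<partial>M) =
        (\<integral>\<^sup>+\<omega>. (\<integral>\<^sup>+z. increment (I \<omega>) x z *
          indicator (near x u) z \<partial>lborel) \<partial>M) * indicator unit_square x"
        by (rule nn_integral_multc)
      also have "(\<integral>\<^sup>+\<omega>. (\<integral>\<^sup>+z. increment (I \<omega>) x z *
          indicator (near x u) z \<partial>lborel) \<partial>M) =
        (\<integral>\<^sup>+z. (\<integral>\<^sup>+\<omega>. increment (I \<omega>) x z *
          indicator (near x u) z \<partial>M) \<partial>lborel)"
        by (rule P.Fubini'[symmetric]) (simp add: split_beta', measurable)
      also have "\<dots> \<le> (\<integral>\<^sup>+z. ennreal (K' * (3 * u) powr \<theta>) * indicator {z. dist x z \<le> 3 * u} z \<partial>lborel)"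
      proof (intro nn_integral_mono)
        fix z :: "real^2"
        have [measurable]: "(\<lambda>\<omega>. I \<omega> z) \<in> borel_measurable M"
          using measurable_compose[OF _ I, of "\<lambda>\<omega>. (\<omega>, z)" M] by simp
        have "(\<integral>\<^sup>+\<omega>. increment (I \<omega>) x z *
            indicator (near x u) z \<partial>M) =
          (\<integral>\<^sup>+\<omega>. increment (I \<omega>) x z \<partial>M) * indicator (near x u) z"
          by (rule nn_integral_multc) measurable
        also have "\<dots> \<le> ennreal (K' * dist x z powr \<theta>) * indicator (near x u) z"
          by (intro mult_right_mono IK) simp
        also have "\<dots> \<le> ennreal (K' * (3 * u) powr \<theta>) * indicator {z. dist x z \<le> 3 * u} z"
        proof (cases "dist x z \<le> 3 * u")
          case True
          then have "dist x z powr \<theta> \<le> (3 * u) powr \<theta>" using \<kappa> \<kappa>_pos by (intro powr_mono2) auto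
          then show ?thesis using True
            by (auto simp: indicator_def K'_def intro!: ennreal_leI mult_left_mono)
        qed simp
        finally show "(\<integral>\<^sup>+\<omega>. increment (I \<omega>) x z *
            indicator (near x u) z \<partial>M) \<le>
            ennreal (K' * (3 * u) powr \<theta>) * indicator {z. dist x z \<le> 3 * u} z" .
      qed
      also have "\<dots> = ennreal (K' * (3 * u) powr \<theta>) * ennreal (unit_ball_vol 2 * (3 * u)\<^sup>2)"
        using u by (subst nn_integral_cmult) (auto simp: nn_integral_cball_le simp del: nn_integral_indicator)
      also have "\<dots> = ennreal (K' * (3 * u) powr \<theta> * (unit_ball_vol 2 * (3 * u)\<^sup>2))"
        by (rule ennreal_mult[symmetric]) (auto simp: K'_def)
      finally show "(\<integral>\<^sup>+\<omega>. (\<integral>\<^sup>+z. increment (I \<omega>) x z *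
          indicator (near x u) z \<partial>lborel) * indicator unit_square x \<partial>M) \<le>
          ennreal (K' * (3 * u) powr \<theta> * (unit_ball_vol 2 * (3 * u)\<^sup>2)) * indicator unit_square x"
        by (simp add: mult_right_mono)
    qed
    also have "\<dots> = ennreal (K' * (3 * u) powr \<theta> * (unit_ball_vol 2 * (3 * u)\<^sup>2)) * ennreal V"
      by (simp add: nn_integral_cmult_indicator V)
    also have "\<dots> = ennreal (K' * (3 * u) powr \<theta> * (unit_ball_vol 2 * (3 * u)\<^sup>2) * V)"
      by (rule ennreal_mult[symmetric]) (auto simp: K'_def V_def)
    also have "K' * (3 * u) powr \<theta> * (unit_ball_vol 2 * (3 * u)\<^sup>2) * V = B * u powr (2 + \<theta>)"
      using u by (simp add: B_def powr_mult powr_add power_mult_distrib mult_ac)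
    finally show ?thesis .
  qed
  \<comment> \<open>One random variable controls all scales: its finiteness bounds every weighted
    term at once. The weights are the inverses of \<open>u powr (2 + \<kappa>)\<close> at
    \<open>u = 2 powr (- k)\<close>, and the means of the terms are bounded by multiples of
    \<open>b ^ k\<close>.\<close>
  define S where "S \<omega> = (\<Sum>k. ennreal (2 powr (real k * (2 + \<kappa>))) * oscillation (I \<omega>) (2 powr (- real k)))" for \<omega>
  have S_meas: "S \<in> borel_measurable M" unfolding S_def by measurable
  define b where "b = 2 powr (\<kappa> - \<theta>)"
  have b: "0 < b" "b < 1" using \<kappa> by (auto simp: b_def powr_less_one)
  have "(\<integral>\<^sup>+\<omega>. S \<omega> \<partial>M) = (\<Sum>k. ennreal (2 powr (real k * (2 + \<kappa>))) * (\<integral>\<^sup>+\<omega>. oscillation (I \<omega>) (2 powr (- real k)) \<partial>M))"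
    unfolding S_def by (subst nn_integral_suminf) (auto simp: nn_integral_cmult)
  also have "\<dots> \<le> (\<Sum>k. ennreal (B * b ^ k))"
  proof (intro suminf_le)
    fix k
    have "ennreal (2 powr (real k * (2 + \<kappa>))) * (\<integral>\<^sup>+\<omega>. oscillation (I \<omega>) (2 powr (- real k)) \<partial>M) \<le>
        ennreal (2 powr (real k * (2 + \<kappa>))) * ennreal (B * (2 powr (- real k)) powr (2 + \<theta>))"
      by (intro mult_left_mono osc_mean) auto
    also have "\<dots> = ennreal (B * (2 powr (real k * (2 + \<kappa>)) * (2 powr (- real k)) powr (2 + \<theta>)))"
      using B by (simp add: ennreal_mult[symmetric] mult_ac)
    also have "2 powr (real k * (2 + \<kappa>)) * (2 powr (- real k)) powr (2 + \<theta>) = b ^ k"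
    proof -
      have "b ^ k = b powr real k" using b by (simp add: powr_realpow)
      then show ?thesis by (simp add: b_def powr_powr powr_add[symmetric] algebra_simps)
    qed
    finally show "ennreal (2 powr (real k * (2 + \<kappa>))) * (\<integral>\<^sup>+\<omega>. oscillation (I \<omega>) (2 powr (- real k)) \<partial>M) \<le>
        ennreal (B * b ^ k)" .
  qed auto
  also have "\<dots> = ennreal (B * (1 / (1 - b)))"
    using B b by (intro suminf_ennreal_eq sums_mult geometric_sums) auto
  finally have "(\<integral>\<^sup>+\<omega>. S \<omega> \<partial>M) \<noteq> \<infinity>" by (auto simp: top_unique)
  then have S_fin: "AE \<omega> in M. S \<omega> \<noteq> \<infinity>" by (rule nn_integral_noteq_infinite[OF S_meas])
  \<comment> \<open>The bounds hold almost surely at each fixed point. By Fubini they hold, for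
    almost every outcome, at almost every point, which is the form the deterministic criterion asks
    for.\<close>
  have "{w \<in> space (M \<Otimes>\<^sub>M lborel). 0 \<le> I (fst w) (snd w) \<and> I (fst w) (snd w) \<le> 1} \<in> sets (M \<Otimes>\<^sub>M (lborel :: (real^2) measure))"
    by measurable
  from P.AE_commute[OF this] have "AE \<omega> in M. AE x in lborel. 0 \<le> I \<omega> x \<and> I \<omega> x \<le> 1"
    using I01 by simp
  then show ?thesis using S_fin AE_space
  proof eventually_elim
    case (elim \<omega>)
    \<comment> \<open>The factor \<open>2 powr (2 + \<kappa>)\<close> pays for rounding
      \<open>u\<close> up to a dyadic scale of size at most \<open>2 * u\<close>.\<close>
    define A where "A = enn2real (S \<omega>) * 2 powr (2 + \<kappa>)"
    have S_eq: "S \<omega> = ennreal (enn2real (S \<omega>))" using elim(2) by (simp add: less_top)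
    show ?case
    proof (rule besov_space_if_oscillation_le[OF I_sec[OF elim(3)] elim(1) _ _ p q s(1) \<kappa>(1)])
      show "0 \<le> A" by (simp add: A_def)
      fix u :: real assume u: "0 < u" "u \<le> 1"
      define k where "k = nat \<lfloor>- log 2 u\<rfloor>"
      have "0 \<le> - log 2 u" using u by (simp add: log_le_zero_cancel_iff)
      then have k: "real k \<le> - log 2 u" "- log 2 u < real k + 1" unfolding k_def by linarith+
      have "u = 2 powr (log 2 u)" using u by simp
      then have uk: "u \<le> 2 powr (- real k)" "2 powr (- real k) \<le> 2 * u"
      proof -
        have "2 powr (log 2 u) \<le> 2 powr (- real k)" using k by (intro powr_mono) auto
        then show "u \<le> 2 powr (- real k)" using u by simp
        have "2 powr (- real k) \<le> 2 powr (1 + log 2 u)" using k by (intro powr_mono) auto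
        also have "\<dots> = 2 * u" using u by (simp add: powr_add)
        finally show "2 powr (- real k) \<le> 2 * u" .
      qed
      have "ennreal (2 powr (real k * (2 + \<kappa>))) * oscillation (I \<omega>) (2 powr (- real k)) \<le> S \<omega>"
        unfolding S_def using sum_le_suminf[of "\<lambda>k. ennreal (2 powr (real k * (2 + \<kappa>))) * oscillation (I \<omega>) (2 powr (- real k))" "{k}"]
        by simp
      then have "ennreal ((2 powr (- real k)) powr (2 + \<kappa>)) *
          (ennreal (2 powr (real k * (2 + \<kappa>))) * oscillation (I \<omega>) (2 powr (- real k))) \<le>
          ennreal ((2 powr (- real k)) powr (2 + \<kappa>)) * S \<omega>"
        by (intro mult_left_mono) auto
      moreover have "ennreal ((2 powr (- real k)) powr (2 + \<kappa>)) * ennreal (2 powr (real k * (2 + \<kappa>))) = 1"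
        by (simp add: ennreal_mult[symmetric] powr_powr powr_add[symmetric])
      ultimately have "oscillation (I \<omega>) (2 powr (- real k)) \<le> ennreal ((2 powr (- real k)) powr (2 + \<kappa>)) * S \<omega>"
        by (simp add: mult.assoc[symmetric])
      also have "\<dots> \<le> ennreal ((2 * u) powr (2 + \<kappa>)) * S \<omega>"
        using uk \<kappa>_pos by (intro mult_right_mono ennreal_leI powr_mono2) auto
      also have "\<dots> = ennreal (A * u powr (2 + \<kappa>))"
        by (subst S_eq) (use u in \<open>simp add: A_def ennreal_mult[symmetric] powr_mult mult_ac\<close>)
      finally show "oscillation (I \<omega>) u \<le> ennreal (A * u powr (2 + \<kappa>))"
        using oscillation_mono[OF uk(1), of "I \<omega>"] by (rule order_trans[rotated])
    qed
  qed
qed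

section \<open>Passage to the limit of finite-dimensional distributions\<close>

lemma emeasure_distr_le: "emeasure (distr M N f) A \<le> emeasure M (f -` A \<inter> space M)"
proof (cases "emeasure (distr M N f) (space N) = 0")
  case True
  have "emeasure (distr M N f) A \<le> emeasure (distr M N f) (space (distr M N f))"
    by (rule emeasure_space)
  then show ?thesis using True by simp
next
  case False
  show ?thesis
  proof (cases "A \<in> sets N")
    case True
    then show ?thesis using emeasure_distr_nonzero[OF False] by simp
  qed (simp add: emeasure_notin_sets)
qed

text \<open>
  The approximating fields are not assumed to be measurable; even then, their finite-dimensional
  distributions are dominated by the measure of preimages.
\<close>

lemma integral_fdd_le:
  assumes P: "prob_space P" and J: "finite J" and E: "E \<in> sets P"
    and \<phi>: "\<phi> \<in> borel_measurable (Pi\<^sub>M J (\<lambda>_. borel))" "\<And>v. 0 \<le> \<phi> v \<and> \<phi> v \<le> 1"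
    and AE: "AE \<omega> in P. \<omega> \<notin> E \<longrightarrow> \<phi> (restrict (K \<omega>) J) = 0"
  shows "(\<integral>v. \<phi> v \<partial>fdd P K J) \<le> measure P E"
proof -
  interpret prob_space P by fact
  let ?PJ = "Pi\<^sub>M J (\<lambda>_. borel :: real measure)"
  have sets: "sets (fdd P K J) = sets ?PJ" by (simp add: fdd_def)
  have \<phi>m: "\<phi> \<in> borel_measurable (fdd P K J)"
    using \<phi>(1) measurable_cong_sets[OF sets refl] by blast
  define B where "B = {v \<in> space ?PJ. \<phi> v \<noteq> 0}"
  have B: "B \<in> sets ?PJ" unfolding B_def using \<phi>(1) by measurable
  have space: "space (fdd P K J) = space ?PJ" by (rule sets_eq_imp_space_eq[OF sets])
  have "(\<integral>\<^sup>+v. ennreal (\<phi> v) \<partial>fdd P K J) \<le> (\<integral>\<^sup>+v. indicator B v \<partial>fdd P K J)"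
    using \<phi>(2) by (intro nn_integral_mono) (auto simp: B_def indicator_def space ennreal_le_1)
  also have "\<dots> = emeasure (fdd P K J) B" using B by (simp add: sets)
  also have "\<dots> \<le> emeasure P ((\<lambda>\<omega>. restrict (K \<omega>) J) -` B \<inter> space P)"
    unfolding fdd_def by (rule emeasure_distr_le)
  also have "\<dots> \<le> emeasure P E"
  proof (rule emeasure_mono_AE[OF _ E])
    show "AE \<omega> in P. \<omega> \<in> (\<lambda>\<omega>. restrict (K \<omega>) J) -` B \<inter> space P \<longrightarrow> \<omega> \<in> E"
      using AE by eventually_elim (auto simp: B_def)
  qed
  finally have "(\<integral>\<^sup>+v. ennreal (\<phi> v) \<partial>fdd P K J) \<le> ennreal (measure P E)"
    by (simp add: emeasure_eq_measure)
  then show ?thesis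
    using \<phi>(2) by (subst integral_eq_nn_integral[OF \<phi>m]) (auto intro!: enn2real_leI)
qed

text \<open>Continuity and boundedness make \<open>\<phi>\<close> an admissible test function, so a
  bound on its integrals along the filter survives the limit. There the field is measurable, and the
  integral can be pulled back to the outcomes.\<close>

lemma fdd_limit_integral_le:
  fixes I :: "'w \<Rightarrow> 'a \<Rightarrow> real"
  assumes conv: "fdd_converge P K F M I" and I: "random_field M I" and J: "finite J"
    and F: "F \<noteq> bot" and P: "eventually (\<lambda>r. prob_space (P r)) F"
    and cont: "continuous_map (product_topology (\<lambda>_. euclideanreal) J) euclideanreal \<phi>"
    and \<phi>: "\<phi> \<in> borel_measurable (Pi\<^sub>M J (\<lambda>_. borel))" "\<And>v. 0 \<le> \<phi> v \<and> \<phi> v \<le> 1"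
    and c: "0 \<le> c" and bound: "eventually (\<lambda>r. \<exists>E\<in>sets (P r). measure (P r) E \<le> c \<and>
      (AE \<omega> in P r. \<omega> \<notin> E \<longrightarrow> \<phi> (restrict (K r \<omega>) J) = 0)) F"
  shows "(\<integral>\<^sup>+\<omega>. ennreal (\<phi> (restrict (I \<omega>) J)) \<partial>M) \<le> ennreal c"
proof -
  have M: "prob_space M" and Im: "\<And>y. (\<lambda>\<omega>. I \<omega> y) \<in> borel_measurable M"
    using I by (auto simp: random_field_def)
  interpret prob_space M by fact
  have bdd: "bounded (\<phi> ` (J \<rightarrow>\<^sub>E UNIV))"
    unfolding bounded_iff using \<phi>(2) by (intro exI[of _ 1]) (auto simp: abs_le_iff intro: order_trans[of _ 0])
  have lim: "((\<lambda>r. \<integral>v. \<phi> v \<partial>(fdd (P r) (K r) J)) \<longlongrightarrow> (\<integral>v. \<phi> v \<partial>(fdd M I J))) F"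
    using conv J cont bdd unfolding fdd_converge_def by blast
  have "eventually (\<lambda>r. (\<integral>v. \<phi> v \<partial>(fdd (P r) (K r) J)) \<le> c) F"
    using P bound
  proof eventually_elim
    case (elim r)
    then obtain E where E: "E \<in> sets (P r)" "measure (P r) E \<le> c"
      "AE \<omega> in P r. \<omega> \<notin> E \<longrightarrow> \<phi> (restrict (K r \<omega>) J) = 0" by blast
    show ?case using integral_fdd_le[OF elim(1) J E(1) \<phi> E(3)] E(2) by simp
  qed
  then have le: "(\<integral>v. \<phi> v \<partial>(fdd M I J)) \<le> c" by (rule tendsto_upperbound[OF lim _ F])
  have rm: "(\<lambda>\<omega>. restrict (I \<omega>) J) \<in> measurable M (Pi\<^sub>M J (\<lambda>_. borel))"
    by (rule measurable_restrict) (rule Im)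
  have m: "(\<lambda>\<omega>. \<phi> (restrict (I \<omega>) J)) \<in> borel_measurable M"
    by (rule measurable_compose[OF rm \<phi>(1)])
  have "(\<integral>v. \<phi> v \<partial>(fdd M I J)) = (\<integral>\<omega>. \<phi> (restrict (I \<omega>) J) \<partial>M)"
    unfolding fdd_def by (rule integral_distr[OF rm \<phi>(1)])
  moreover have "(\<integral>\<^sup>+\<omega>. ennreal (\<phi> (restrict (I \<omega>) J)) \<partial>M) = ennreal (\<integral>\<omega>. \<phi> (restrict (I \<omega>) J) \<partial>M)"
    using m \<phi>(2) by (intro nn_integral_eq_integral integrable_const_bound[where B = 1]) auto
  ultimately show ?thesis using le by (simp add: ennreal_leI)
qed

text \<open>The test function is a penalty that vanishes exactly when the value lies in
  \<open>{0..1}\<close>. It vanishes almost surely along the approximation, so its mean in the limit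
  is 0.\<close>

lemma fdd_limit_bounds:
  fixes I :: "'w \<Rightarrow> 'a \<Rightarrow> real"
  assumes conv: "fdd_converge P K F M I" and I: "random_field M I"
    and F: "F \<noteq> bot" and P: "eventually (\<lambda>r. prob_space (P r)) F"
    and bounds: "eventually (\<lambda>r. AE \<omega> in P r. \<forall>y. 0 \<le> K r \<omega> y \<and> K r \<omega> y \<le> 1) F"
  shows "AE \<omega> in M. 0 \<le> I \<omega> x \<and> I \<omega> x \<le> 1"
proof -
  define \<phi> :: "('a \<Rightarrow> real) \<Rightarrow> real" where "\<phi> v = min 1 (max 0 (- v x) + max 0 (v x - 1))" for v
  have Im [measurable]: "(\<lambda>\<omega>. I \<omega> x) \<in> borel_measurable M" using I by (simp add: random_field_def)
  have "(\<integral>\<^sup>+\<omega>. ennreal (\<phi> (restrict (I \<omega>) {x})) \<partial>M) \<le> ennreal 0"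
  proof (rule fdd_limit_integral_le[OF conv I _ F P])
    show "continuous_map (product_topology (\<lambda>_. euclideanreal) {x}) euclideanreal \<phi>"
      unfolding \<phi>_def
      by (intro continuous_map_real_min continuous_map_real_max continuous_map_add continuous_map_diff
          continuous_map_minus continuous_map_product_projection) auto
    show "\<phi> \<in> borel_measurable (Pi\<^sub>M {x} (\<lambda>_. borel))" unfolding \<phi>_def by measurable
    show "0 \<le> \<phi> v \<and> \<phi> v \<le> 1" for v by (simp add: \<phi>_def)
    show "eventually (\<lambda>r. \<exists>E\<in>sets (P r). measure (P r) E \<le> 0 \<and>
      (AE \<omega> in P r. \<omega> \<notin> E \<longrightarrow> \<phi> (restrict (K r \<omega>) {x}) = 0)) F"
      using bounds
    proof eventually_elim
      case (elim r)
      then have "AE \<omega> in P r. \<omega> \<notin> {} \<longrightarrow> \<phi> (restrict (K r \<omega>) {x}) = 0"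
        by eventually_elim (auto simp: \<phi>_def)
      then show ?case by (intro bexI[of _ "{}"]) auto
    qed
  qed auto
  then have "(\<integral>\<^sup>+\<omega>. ennreal (\<phi> (restrict (I \<omega>) {x})) \<partial>M) = 0" by simp
  moreover have "(\<lambda>\<omega>. ennreal (\<phi> (restrict (I \<omega>) {x}))) \<in> borel_measurable M"
    unfolding \<phi>_def by simp
  ultimately have "AE \<omega> in M. ennreal (\<phi> (restrict (I \<omega>) {x})) = 0" by (simp add: nn_integral_0_iff_AE)
  then show ?thesis
  proof eventually_elim
    case (elim \<omega>)
    then have "\<phi> (restrict (I \<omega>) {x}) \<le> 0" by (simp add: ennreal_eq_0_iff)
    then show ?case by (auto simp: \<phi>_def min_def max_def split: if_splits)
  qed
qed

lemma fdd_limit_discrepancy: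
  fixes I :: "'w \<Rightarrow> 'a \<Rightarrow> real"
  assumes conv: "fdd_converge P K F M I" and I: "random_field M I"
    and F: "F \<noteq> bot" and P: "eventually (\<lambda>r. prob_space (P r)) F"
    and bound: "eventually (\<lambda>r. differ_prob_le (P r) (K r) x y c) F"
  shows "(\<integral>\<^sup>+\<omega>. increment (I \<omega>) x y \<partial>M) \<le> ennreal c"
proof -
  define \<phi> :: "('a \<Rightarrow> real) \<Rightarrow> real" where "\<phi> v = min 1 \<bar>v x - v y\<bar>" for v
  \<comment> \<open>A negative \<open>c\<close> means 0 once it is read as \<open>ennreal c\<close>,
    so the real bound on the measure is taken to be \<open>max 0 c\<close>.\<close>
  have "(\<integral>\<^sup>+\<omega>. ennreal (\<phi> (restrict (I \<omega>) {x, y})) \<partial>M) \<le> ennreal (max 0 c)"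
  proof (rule fdd_limit_integral_le[OF conv I _ F P])
    show "continuous_map (product_topology (\<lambda>_. euclideanreal) {x, y}) euclideanreal \<phi>"
      unfolding \<phi>_def
      by (intro continuous_map_real_min continuous_map_real_abs continuous_map_diff
          continuous_map_product_projection) auto
    show "\<phi> \<in> borel_measurable (Pi\<^sub>M {x, y} (\<lambda>_. borel))" unfolding \<phi>_def by measurable
    show "0 \<le> \<phi> v \<and> \<phi> v \<le> 1" for v by (simp add: \<phi>_def)
    show "eventually (\<lambda>r. \<exists>E\<in>sets (P r). measure (P r) E \<le> max 0 c \<and>
      (AE \<omega> in P r. \<omega> \<notin> E \<longrightarrow> \<phi> (restrict (K r \<omega>) {x, y}) = 0)) F"
      using bound
    proof eventually_elim
      case (elim r)
      then obtain E where E: "E \<in> sets (P r)" "emeasure (P r) E \<le> ennreal c"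
        "AE \<omega> in P r. \<omega> \<notin> E \<longrightarrow> K r \<omega> x = K r \<omega> y" by blast
      have "emeasure (P r) E \<le> ennreal (max 0 c)" using E(2) ennreal_leI[of c "max 0 c"] by simp
      then have "measure (P r) E \<le> max 0 c" unfolding measure_def by (intro enn2real_leI) auto
      moreover have "AE \<omega> in P r. \<omega> \<notin> E \<longrightarrow> \<phi> (restrict (K r \<omega>) {x, y}) = 0"
        using E(3) by eventually_elim (auto simp: \<phi>_def)
      ultimately show ?case using E(1) by blast
    qed
  qed auto
  also have "ennreal (max 0 c) = ennreal c" by (simp add: max_def ennreal_neg)
  finally show ?thesis by (simp add: \<phi>_def)
qed

lemma exponent_bound:
  fixes p :: ereal
  assumes "1 \<le> p" "0 < s" "ereal s < ereal c / p"
  obtains t where "p = ereal t" "1 \<le> t" "s * t < c"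
proof (cases p)
  case (real t)
  then have "1 \<le> t" "s < c / t" using assms by (auto simp: one_ereal_def)
  then show thesis using real by (intro that[of t]) (auto simp: field_simps)
next
  case PInf
  then show thesis using assms by simp
next
  case MInf
  then show thesis using assms by simp
qed

text \<open>Both parts end in the same regularity criterion, with rate 1 in the first and some
  \<open>\<beta> < 3 - \<alpha>\<close> in the second. The modification may replace the field
  because the criterion involves one or two fixed points at a time.\<close>

theorem corollary4:
  fixes N :: "'n measure" and Y :: "'n \<Rightarrow> (real^2) set"
    and a\<^sub>1 a\<^sub>2 \<alpha> s :: real and p q :: ereal
  assumes "prob_space N"
    and "random_compact_set N Y"
    and "0 < a\<^sub>1" and "a\<^sub>1 < a\<^sub>2"
    and "AE \<omega> in N. cball 0 a\<^sub>1 \<subseteq> Y \<omega> \<and> Y \<omega> \<subseteq> cball 0 a\<^sub>2"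
    and "AE \<omega> in N. emeasure lborel (frontier (Y \<omega>)) = 0"
    and "1 \<le> p" and "1 \<le> q" and "0 < s" and "s < 1"
  shows
    "(\<forall>(r\<^sub>0::real) (r\<^sub>1::ereal) (M :: 'w measure) I I'.
        (1 < \<alpha> \<and> \<alpha> \<le> 3 \<and> 0 < r\<^sub>0 \<and> ereal r\<^sub>0 < r\<^sub>1 \<and> r\<^sub>1 < \<infinity> \<or>
         3 < \<alpha> \<and> 0 < r\<^sub>0 \<and> ereal r\<^sub>0 < r\<^sub>1 \<and> r\<^sub>1 \<le> \<infinity>) \<and>
        condition_A2 N Y \<and>
        colored_dead_leaves M (leaf_law N Y \<alpha> r\<^sub>0 r\<^sub>1) I \<and>
        measurable_modification M I I' \<and>
        ereal s < 1 / p \<longrightarrow>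
        (AE \<omega> in M. I' \<omega> \<in> besov_space p q s)) \<and>
     (\<forall>(r\<^sub>1::real) (P :: real \<Rightarrow> 'b measure) K (M :: 'w measure) I I'.
        2 < \<alpha> \<and> \<alpha> < 3 \<and> 0 < r\<^sub>1 \<and>
        condition_A3 N Y \<and>
        (\<forall>r. 0 < r \<and> r < r\<^sub>1 \<longrightarrow> colored_dead_leaves (P r) (leaf_law N Y \<alpha> r (ereal r\<^sub>1)) (K r)) \<and>
        random_field M I \<and>
        fdd_converge P K (at_right 0) M I \<and>
        measurable_modification M I I' \<and>
        ereal s < ereal (3 - \<alpha>) / p \<longrightarrow>
        (AE \<omega> in M. I' \<omega> \<in> besov_space p q s))"
proof (intro conjI allI impI)
  interpret N: random_grain N Y a\<^sub>1 a\<^sub>2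
    by (rule random_grain.intro[OF assms(1-6)])
  fix r\<^sub>0 :: real and r\<^sub>1 :: ereal and M :: "'w measure" and I I'
  assume asm: "(1 < \<alpha> \<and> \<alpha> \<le> 3 \<and> 0 < r\<^sub>0 \<and> ereal r\<^sub>0 < r\<^sub>1 \<and> r\<^sub>1 < \<infinity> \<or>
      3 < \<alpha> \<and> 0 < r\<^sub>0 \<and> ereal r\<^sub>0 < r\<^sub>1 \<and> r\<^sub>1 \<le> \<infinity>) \<and>
    condition_A2 N Y \<and>
    colored_dead_leaves M (leaf_law N Y \<alpha> r\<^sub>0 r\<^sub>1) I \<and>
    measurable_modification M I I' \<and>
    ereal s < 1 / p"
  then have cdl: "colored_dead_leaves M (leaf_law N Y \<alpha> r\<^sub>0 r\<^sub>1) I"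
    and modif: "measurable_modification M I I'" and sp: "ereal s < 1 / p" by auto
  obtain t where t: "p = ereal t" "1 \<le> t" "s * t < 1"
    using exponent_bound[OF assms(7,9) sp[unfolded one_ereal_def]] by blast
  have M: "prob_space M" by (rule colored_dead_leaves_prob_space[OF cdl])
  obtain K where K: "\<And>x y. differ_prob_le M I x y (K * norm (x - y) powr 1)"
    using N.colored_dead_leaves_discrepancy_A2[of \<alpha> r\<^sub>0 r\<^sub>1 M I] asm by blast
  have I': "AE \<omega> in M. I' \<omega> y = I \<omega> y" for y
    using modif by (simp add: measurable_modification_def)
  show "AE \<omega> in M. I' \<omega> \<in> besov_space p q s"
    unfolding t(1)
  proof (rule AE_besov_space[OF M _ _ _ t(2) assms(8,9) t(3)])
    show "(\<lambda>(\<omega>, y). I' \<omega> y) \<in> borel_measurable (M \<Otimes>\<^sub>M borel)"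
      using modif by (simp add: measurable_modification_def)
    show "AE \<omega> in M. 0 \<le> I' \<omega> x \<and> I' \<omega> x \<le> 1" for x
      using colored_dead_leaves_bounds[OF cdl] I'[of x] by eventually_elim simp
    fix x y
    obtain E where E: "E \<in> sets M" "emeasure M E \<le> ennreal (K * norm (x - y) powr 1)"
      "AE \<omega> in M. \<omega> \<notin> E \<longrightarrow> I \<omega> x = I \<omega> y" using K by blast
    \<comment> \<open>A truncated increment is at most 1 and vanishes almost surely off the
      exceptional event, so that event's indicator dominates it.\<close>
    have "(\<integral>\<^sup>+\<omega>. increment (I' \<omega>) x y \<partial>M) \<le> (\<integral>\<^sup>+\<omega>. indicator E \<omega> \<partial>M)"
    proof (rule nn_integral_mono_AE)
      show "AE \<omega> in M. increment (I' \<omega>) x y \<le> indicator E \<omega>"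
        using I'[of x] I'[of y] E(3)
        by eventually_elim (auto simp: indicator_def ennreal_le_1)
    qed
    then show "(\<integral>\<^sup>+\<omega>. increment (I' \<omega>) x y \<partial>M) \<le> ennreal (K * norm (x - y) powr 1)"
      using E(1,2) by simp
  qed
next
  interpret N: random_grain N Y a\<^sub>1 a\<^sub>2
    by (rule random_grain.intro[OF assms(1-6)])
  fix r\<^sub>1 :: real and P :: "real \<Rightarrow> 'b measure" and K and M :: "'w measure" and I I'
  assume asm: "2 < \<alpha> \<and> \<alpha> < 3 \<and> 0 < r\<^sub>1 \<and>
    condition_A3 N Y \<and>
    (\<forall>r. 0 < r \<and> r < r\<^sub>1 \<longrightarrow> colored_dead_leaves (P r) (leaf_law N Y \<alpha> r (ereal r\<^sub>1)) (K r)) \<and>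
    random_field M I \<and>
    fdd_converge P K (at_right 0) M I \<and>
    measurable_modification M I I' \<and>
    ereal s < ereal (3 - \<alpha>) / p"
  then have \<alpha>: "2 < \<alpha>" "\<alpha> < 3" and r1: "0 < r\<^sub>1" and A3: "condition_A3 N Y"
    and cdl: "\<And>r. 0 < r \<Longrightarrow> r < r\<^sub>1 \<Longrightarrow> colored_dead_leaves (P r) (leaf_law N Y \<alpha> r (ereal r\<^sub>1)) (K r)"
    and rf: "random_field M I" and conv: "fdd_converge P K (at_right 0) M I"
    and modif: "measurable_modification M I I'" and sp: "ereal s < ereal (3 - \<alpha>) / p" by auto
  obtain t where t: "p = ereal t" "1 \<le> t" "s * t < 3 - \<alpha>"
    using exponent_bound[OF assms(7,9) sp] by blast
  \<comment> \<open>The uniform bound under (A-3) is available for exponents strictly below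
    \<open>3 - \<alpha>\<close>; the strict inequality for \<open>s\<close> leaves room for
    one.\<close>
  obtain \<beta> where \<beta>: "s * t < \<beta>" "\<beta> < 3 - \<alpha>" using dense t(3) by blast
  have "0 < s * t" using assms(9) t(2) by simp
  then have \<beta>_pos: "0 < \<beta>" using \<beta>(1) by simp
  have M: "prob_space M" using rf by (simp add: random_field_def)
  obtain C where C: "\<And>r (M :: 'b measure) I x y. 0 < r \<Longrightarrow> r < r\<^sub>1 / 2 \<Longrightarrow>
    colored_dead_leaves M (leaf_law N Y \<alpha> r (ereal r\<^sub>1)) I \<Longrightarrow>
    differ_prob_le M I x y (C * norm (x - y) powr \<beta>)"
    by (rule N.colored_dead_leaves_discrepancy_A3[OF \<alpha> r1 A3 \<beta>_pos \<beta>(2)]) (rule that)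
  have ev: "eventually (\<lambda>r. 0 < r \<and> r < r\<^sub>1 / 2) (at_right 0)"
    using r1 eventually_at_right_real[of 0 "r\<^sub>1 / 2"] by simp
  have ev_prob: "eventually (\<lambda>r. prob_space (P r)) (at_right 0)"
    using ev
  proof eventually_elim
    case (elim r)
    then show ?case using colored_dead_leaves_prob_space[OF cdl[of r]] by simp
  qed
  have I': "AE \<omega> in M. I' \<omega> y = I \<omega> y" for y
    using modif by (simp add: measurable_modification_def)
  show "AE \<omega> in M. I' \<omega> \<in> besov_space p q s"
    unfolding t(1)
  proof (rule AE_besov_space[OF M _ _ _ t(2) assms(8,9) \<beta>(1)])
    show "(\<lambda>(\<omega>, y). I' \<omega> y) \<in> borel_measurable (M \<Otimes>\<^sub>M borel)"
      using modif by (simp add: measurable_modification_def)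
    have "eventually (\<lambda>r. AE \<omega> in P r. \<forall>y. 0 \<le> K r \<omega> y \<and> K r \<omega> y \<le> 1) (at_right 0)"
      using ev
    proof eventually_elim
      case (elim r)
      then show ?case using colored_dead_leaves_bounds[OF cdl[of r]] by simp
    qed
    then have bounds: "AE \<omega> in M. 0 \<le> I \<omega> x \<and> I \<omega> x \<le> 1" for x
      by (rule fdd_limit_bounds[OF conv rf trivial_limit_at_right_real ev_prob])
    show "AE \<omega> in M. 0 \<le> I' \<omega> x \<and> I' \<omega> x \<le> 1" for x
      using bounds[of x] I'[of x] by eventually_elim simp
    fix x y
    have "eventually (\<lambda>r. differ_prob_le (P r) (K r) x y (C * norm (x - y) powr \<beta>)) (at_right 0)"
      using ev
    proof eventually_elim
      case (elim r)
      then show ?case using C[of r "P r" "K r" x y] cdl[of r] by simp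
    qed
    then have "(\<integral>\<^sup>+\<omega>. increment (I \<omega>) x y \<partial>M) \<le> ennreal (C * norm (x - y) powr \<beta>)"
      by (rule fdd_limit_discrepancy[OF conv rf trivial_limit_at_right_real ev_prob])
    moreover have "(\<integral>\<^sup>+\<omega>. increment (I' \<omega>) x y \<partial>M) = (\<integral>\<^sup>+\<omega>. increment (I \<omega>) x y \<partial>M)"
    proof (rule nn_integral_cong_AE)
      show "AE \<omega> in M. increment (I' \<omega>) x y = increment (I \<omega>) x y"
        using I'[of x] I'[of y] by eventually_elim simp
    qed
    ultimately show "(\<integral>\<^sup>+\<omega>. increment (I' \<omega>) x y \<partial>M) \<le> ennreal (C * norm (x - y) powr \<beta>)"
      by simp
  qed
qed

end
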